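(* Let $G$ be a connected graph on $n$ vertices with minimum degree $\delta(G)$. (1) If $\delta(G) \ge 3$, then $rx_3(G) \le \frac{3}{4} n + 3$. (2) If $\delta(G) \ge 4$, then $rx_3(G) \le \frac{3}{5} n + \frac{17}{5}$. (3) If $\delta(G) \ge 5$, then $rx_3(G) \le \frac{1}{2} n + 3$. Moreover, these bounds are tight up to an additive constant: for each $\delta \in \{3,4,5\}$ there is a constant $C$ such that there are infinitely many (pairwise non-isomorphic) connected graphs $G^*$ with minimum degree at least $\delta$ satisfying $rx_3(G^* ) \ge \frac{3}{\delta+1} n - C$, where $n = |V(G^* )|$.
   Context: All graphs are undirected, finite and simple. An edge-coloring of a graph assigns a color to each edge; adjacent edges may receive the same color. A tree (subgraph) in an edge-colored graph is rainbow if no two of its edges have the same color. An edge-coloring of a connected graph $G$ is a 3-rainbow coloring if for every set $S$ of three vertices of $G$ there is a rainbow tree in $G$ whose vertex set contains $S$. The 3-rainbow index $rx_3(G)$ is the minimum number of colors in a 3-rainbow coloring of $G$. *)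

theory Defs
  imports Complex_Main
begin

record 'a ugraph =
  verts :: "'a set"
  edges :: "'a set set"

definition simple_graph :: "'a ugraph \<Rightarrow> bool" where
  "simple_graph G \<longleftrightarrow>
     finite (verts G) \<and> (\<forall>e \<in> edges G. e \<subseteq> verts G \<and> card e = 2)"

definition degree :: "'a ugraph \<Rightarrow> 'a \<Rightarrow> nat" where
  "degree G v = card {e \<in> edges G. v \<in> e}"

definition min_degree :: "'a ugraph \<Rightarrow> nat" where
  "min_degree G = Min (degree G ` verts G)"

definition walk :: "'a ugraph \<Rightarrow> 'a list \<Rightarrow> bool" where
  "walk G p \<longleftrightarrow>
     p \<noteq> [] \<and> set p \<subseteq> verts G \<and>
     (\<forall>i. Suc i < length p \<longrightarrow> {p ! i, p ! Suc i} \<in> edges G)"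

text \<open>The graph without vertices does not count as connected.\<close>

definition connected_graph :: "'a ugraph \<Rightarrow> bool" where
  "connected_graph G \<longleftrightarrow>
     verts G \<noteq> {} \<and>
     (\<forall>u \<in> verts G. \<forall>v \<in> verts G. \<exists>p. walk G p \<and> hd p = u \<and> last p = v)"

text \<open>A cycle is listed without repeating its first vertex at the end; the bound on the
  length excludes going back and forth along a single edge.\<close>

definition is_cycle :: "'a ugraph \<Rightarrow> 'a list \<Rightarrow> bool" where
  "is_cycle G p \<longleftrightarrow>
     walk G p \<and> distinct p \<and> 3 \<le> length p \<and> {last p, hd p} \<in> edges G"

definition is_tree :: "'a ugraph \<Rightarrow> bool" where
  "is_tree T \<longleftrightarrow> simple_graph T \<and> connected_graph T \<and> (\<nexists>p. is_cycle T p)"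

definition subgraph :: "'a ugraph \<Rightarrow> 'a ugraph \<Rightarrow> bool" where
  "subgraph H G \<longleftrightarrow> verts H \<subseteq> verts G \<and> edges H \<subseteq> edges G"

definition graph_isomorphic :: "'a ugraph \<Rightarrow> 'b ugraph \<Rightarrow> bool" where
  "graph_isomorphic G H \<longleftrightarrow>
     (\<exists>f. bij_betw f (verts G) (verts H) \<and>
          (\<forall>u \<in> verts G. \<forall>v \<in> verts G. {u, v} \<in> edges G \<longleftrightarrow> {f u, f v} \<in> edges H))"

text \<open>An edge-coloring need not be proper. It is given by a function on all vertex sets, of
  which only the values on edges matter.\<close>

definition rainbow :: "('a set \<Rightarrow> 'c) \<Rightarrow> 'a ugraph \<Rightarrow> bool" where
  "rainbow c T \<longleftrightarrow> inj_on c (edges T)"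

definition three_rainbow_coloring :: "'a ugraph \<Rightarrow> ('a set \<Rightarrow> 'c) \<Rightarrow> bool" where
  "three_rainbow_coloring G c \<longleftrightarrow>
     (\<forall>S. S \<subseteq> verts G \<and> card S = 3 \<longrightarrow>
        (\<exists>T. is_tree T \<and> subgraph T G \<and> rainbow c T \<and> S \<subseteq> verts T))"

text \<open>In a finite connected graph an injective coloring of the edges is a 3-rainbow coloring
  (use a spanning tree), so the minimum is attained there. As there are finitely many edges,
  natural numbers suffice as colors.\<close>

definition rx3 :: "'a ugraph \<Rightarrow> nat" where
  "rx3 G = (LEAST k. \<exists>c :: 'a set \<Rightarrow> nat.
              three_rainbow_coloring G c \<and> card (c ` edges G) = k)"

end

theory Submission
  imports Defs
begin

text \<open>Upper bounds: choose a tree \<open>D\<close> and give its edges distinct colours. If every other vertex has a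
  neighbour in \<open>D\<close> and degree at least 3, then six further colours suffice to hang any three vertices
  on \<open>D\<close> with disjoint sets of colours. They are found with a normal spanning forest of
  the graph outside \<open>D\<close>, the depth modulo 3 deciding the colours. A few colours more take care of vertices at
  distance two from \<open>D\<close>. It remains to grow \<open>D\<close> so that its closed neighbourhood is large compared
  with \<open>card D\<close>, greedily for the minimum degrees 4 and 5 and with a potential function for the minimum degree 3.

  Lower bound: a chain of cliques of sizes 1, \<open>\<delta> - 1\<close>, 1, repeated, has diameter about
  \<open>3 * n / (\<delta> + 1)\<close>, and a rainbow tree containing both ends needs that many colours.\<close>

text \<open>The obstacle is a vertex with a single neighbour in \<open>D\<close>: its direct edge
  offers one colour, and three such vertices may all be offered the same one. So every vertex also
  needs detours ending with each of the two other direct colours. Depth modulo 3 supplies them, as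
  parent and child lie in the two other classes; roots and leaves, which lack one of these, are the
  hard cases. In a triple one vertex goes directly, with colour \<open>a\<close>, and the others end
  with the two remaining colours. Either one of them needs no detour, or the detours can meet only
  in \<open>3 + a\<close>, and exchanging the two final colours avoids that.

  Six colours give the bound \<open>card D + 5\<close>, so the additive constants of the theorem
  leave little room. A single undominated vertex must be served without a new colour, and the growth
  must start from a vertex or edge with many neighbours. The graphs without such a start are
  regular: for odd degree the order is even and rounding closes the gap; for degree 4 only the
  octahedron can leave a vertex undominated.\<close>

section \<open>Walks and reachability\<close>

lemma walk_rtrancl:
  assumes "walk T p" "i < length p"
  shows "(hd p, p ! i) \<in> {(a, b). {a, b} \<in> edges T}\<^sup>*"
  using assms(2)
proof (induction i)
  case 0
  then show ?case by (simp add: hd_conv_nth)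
next
  case (Suc i)
  have "{p ! i, p ! Suc i} \<in> edges T" using assms(1) Suc.prems by (simp add: walk_def)
  then show ?case using Suc by (auto intro: rtrancl_into_rtrancl)
qed

lemma rtrancl_walk:
  assumes "(u, v) \<in> {(a, b). {a, b} \<in> edges T}\<^sup>*" "u \<in> verts T" "\<And>e. e \<in> edges T \<Longrightarrow> e \<subseteq> verts T"
  shows "\<exists>p. walk T p \<and> hd p = u \<and> last p = v"
  using assms(1)
proof (induction rule: rtrancl_induct)
  case base
  show ?case by (rule exI[of _ "[u]"]) (simp add: walk_def assms)
next
  case (step y z)
  then obtain p where p: "walk T p" "hd p = u" "last p = y" by blast
  have e: "{y, z} \<in> edges T" using step by auto
  have "walk T (p @ [z])"
    unfolding walk_def
  proof (intro conjI allI impI)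
    show "set (p @ [z]) \<subseteq> verts T" using p(1) assms(3)[OF e] by (auto simp: walk_def)
  next
    fix i assume i: "Suc i < length (p @ [z])"
    show "{(p @ [z]) ! i, (p @ [z]) ! Suc i} \<in> edges T"
    proof (cases "Suc i < length p")
      case True
      then show ?thesis using p(1) by (auto simp: walk_def nth_append)
    next
      case False
      then have "Suc i = length p" using i by simp
      moreover have "p ! i = y" using calculation p by (metis diff_Suc_1 last_conv_nth length_0_conv nat.distinct(1))
      ultimately show ?thesis using e by (auto simp: nth_append)
    qed
  qed simp
  moreover have "hd (p @ [z]) = u" using p by (auto simp: walk_def)
  ultimately show ?case by (metis last_snoc)
qed

lemma connected_graph_rtrancl:
  assumes "connected_graph T" "u \<in> verts T" "v \<in> verts T"
  shows "(u, v) \<in> {(a, b). {a, b} \<in> edges T}\<^sup>*"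
proof -
  obtain p where p: "walk T p" "hd p = u" "last p = v" using assms by (auto simp: connected_graph_def)
  then have "p \<noteq> []" by (simp add: walk_def)
  then show ?thesis using walk_rtrancl[OF p(1), of "length p - 1"] p by (simp add: last_conv_nth)
qed

section \<open>Neighbourhoods and closed neighbourhoods\<close>

locale fin_graph =
  fixes G :: "'a ugraph"
  assumes sg: "simple_graph G" and con: "connected_graph G"
begin

abbreviation "V \<equiv> verts G"

definition N :: "'a \<Rightarrow> 'a set" where "N v = {w. {v, w} \<in> edges G}"

definition NC :: "'a set \<Rightarrow> 'a set" where "NC D = D \<union> (\<Union>v\<in>D. N v)"

lemma finV: "finite V" using sg by (simp add: simple_graph_def)

lemma finE: "finite (edges G)"
proof -
  have "edges G \<subseteq> Pow V" using sg by (auto simp: simple_graph_def)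
  then show ?thesis using finV by (meson finite_Pow_iff finite_subset)
qed

lemma N_sym: "w \<in> N v \<longleftrightarrow> v \<in> N w" by (simp add: N_def insert_commute)

lemma N_V: "w \<in> N v \<Longrightarrow> w \<in> V" "w \<in> N v \<Longrightarrow> v \<in> V"
  using sg by (auto simp: N_def simple_graph_def)

lemma N_irrefl: "w \<in> N v \<Longrightarrow> w \<noteq> v"
proof
  assume "w \<in> N v" "w = v"
  then have "card {v, v} = 2" using sg unfolding N_def simple_graph_def by blast
  then show False by simp
qed

lemma N_self [simp]: "v \<notin> N v" using N_irrefl by blast

lemma N_sub: "N v \<subseteq> V" using N_V by blast

lemma finN [simp]: "finite (N v)" using N_sub finV finite_subset by blast

lemma degree_N: "degree G v = card (N v)"
proof -
  have "{e \<in> edges G. v \<in> e} = (\<lambda>w. {v, w}) ` N v"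
  proof
    show "{e \<in> edges G. v \<in> e} \<subseteq> (\<lambda>w. {v, w}) ` N v"
    proof
      fix e assume e: "e \<in> {e \<in> edges G. v \<in> e}"
      then have "card e = 2" using sg by (auto simp: simple_graph_def)
      then obtain a b where "e = {a, b}" "a \<noteq> b" by (meson card_2_iff)
      then show "e \<in> (\<lambda>w. {v, w}) ` N v" using e by (auto simp: N_def insert_commute)
    qed
  qed (auto simp: N_def)
  moreover have "inj_on (\<lambda>w. {v, w}) (N v)"
    by (auto simp: inj_on_def doubleton_eq_iff)
  ultimately show ?thesis by (simp add: degree_def card_image)
qed

lemma min_degree_le: "v \<in> V \<Longrightarrow> min_degree G \<le> card (N v)"
  using finV by (simp add: min_degree_def flip: degree_N)

lemma NC_sub: "D \<subseteq> V \<Longrightarrow> NC D \<subseteq> V" using N_sub by (auto simp: NC_def)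

lemma NC_insert: "NC (insert v D) = insert v (NC D \<union> N v)" by (auto simp: NC_def)

subsection \<open>Trees grown vertex by vertex\<close>

text \<open>Only leaves are added, so connectedness, acyclicity and the number of edges all follow
  by induction.\<close>

inductive grow :: "'a set \<Rightarrow> 'a set set \<Rightarrow> bool" where
  base: "x \<in> V \<Longrightarrow> grow {x} {}"
| step: "grow S E \<Longrightarrow> u \<in> S \<Longrightarrow> v \<notin> S \<Longrightarrow> v \<in> N u \<Longrightarrow> grow (insert v S) (insert {u, v} E)"

lemma grow_facts:
  assumes "grow S E"
  shows "finite S" "finite E" "S \<subseteq> V" "E \<subseteq> edges G" "\<And>e. e \<in> E \<Longrightarrow> e \<subseteq> S" "S \<noteq> {}" "card S = card E + 1"
proof -
  have "finite S \<and> finite E \<and> S \<subseteq> V \<and> E \<subseteq> edges G \<and> (\<forall>e\<in>E. e \<subseteq> S) \<and> S \<noteq> {} \<and> card S = card E + 1"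
    using assms
  proof (induction rule: grow.induct)
    case (base x)
    then show ?case by simp
  next
    case (step S E u v)
    have "{u, v} \<notin> E" using step by auto
    then show ?case using step N_V by (auto simp: N_def)
  qed
  then show "finite S" "finite E" "S \<subseteq> V" "E \<subseteq> edges G" "\<And>e. e \<in> E \<Longrightarrow> e \<subseteq> S" "S \<noteq> {}" "card S = card E + 1"
    by blast+
qed

text \<open>The vertex added last has \<open>u\<close> as its only neighbour. On a cycle through it
  both cyclic neighbours would be \<open>u\<close>, at two different positions of a distinct
  list.\<close>

lemma grow_acyclic:
  assumes "grow S E" shows "\<not> is_cycle \<lparr>verts = S, edges = E\<rparr> p"
  using assms
proof (induction arbitrary: p rule: grow.induct)
  case (base x)
  show ?case by (auto simp: is_cycle_def)
next
  case (step S E u v)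
  show ?case
  proof
    assume cyc: "is_cycle \<lparr>verts = insert v S, edges = insert {u, v} E\<rparr> p"
    note c = cyc[unfolded is_cycle_def walk_def, simplified]
    have vE: "e \<in> E \<Longrightarrow> v \<notin> e" for e using grow_facts(5)[OF step(1)] step(3) by blast
    have uv: "u \<noteq> v" using step by blast
    have only: "\<And>x. {v, x} \<in> insert {u, v} E \<Longrightarrow> x = u"
      using vE uv by (auto simp: doubleton_eq_iff)
    have only': "\<And>x. {x, v} \<in> insert {u, v} E \<Longrightarrow> x = u"
      using only by (simp add: insert_commute)
    have len: "3 \<le> length p" and dist: "distinct p" using c by auto
    have inj: "\<And>a b. a < length p \<Longrightarrow> b < length p \<Longrightarrow> p ! a = p ! b \<Longrightarrow> a = b"
      using dist nth_eq_iff_index_eq by blast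
    have edge: "\<And>i. Suc i < length p \<Longrightarrow> {p ! i, p ! Suc i} \<in> insert {u, v} E" using c by auto
    have closing: "{last p, hd p} \<in> insert {u, v} E" using c by auto
    have lh: "last p = p ! (length p - 1)" "hd p = p ! 0" using c by (auto simp: last_conv_nth hd_conv_nth)
    show False
    proof (cases "v \<in> set p")
      case False
      have "is_cycle \<lparr>verts = S, edges = E\<rparr> p"
      proof -
        have "{p ! i, p ! Suc i} \<in> E" if "Suc i < length p" for i
        proof -
          have "p ! i \<noteq> v" "p ! Suc i \<noteq> v" using False that nth_mem by (metis Suc_lessD)+
          then have "{p ! i, p ! Suc i} \<noteq> {u, v}" by (auto simp: doubleton_eq_iff)
          then show ?thesis using edge[OF that] by blast
        qed
        moreover have "{last p, hd p} \<in> E"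
        proof -
          have "last p \<noteq> v" "hd p \<noteq> v" using False c by auto
          then have "{last p, hd p} \<noteq> {u, v}" by (auto simp: doubleton_eq_iff)
          then show ?thesis using closing by blast
        qed
        moreover have "set p \<subseteq> S" using c False by auto
        ultimately show ?thesis using c by (auto simp: is_cycle_def walk_def)
      qed
      then show False using step.IH by blast
    next
      case True
      then obtain i where i: "i < length p" "p ! i = v" by (meson in_set_conv_nth)
      consider "i = 0" | "i = length p - 1" "i \<noteq> 0" | "0 < i" "Suc i < length p" using i by linarith
      then show False
      proof cases
        case 1
        have "p ! 1 = u" by (rule only) (use edge[of 0] i 1 len in simp)
        moreover have "p ! (length p - 1) = u" by (rule only') (use closing lh i 1 in simp)
        ultimately have "1 = length p - 1" using len by (intro inj) auto
        then show False using len by linarith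
      next
        case 2
        have "Suc (i - 1) = i" using 2 by simp
        then have "{p ! (i - 1), v} \<in> insert {u, v} E" using edge[of "i - 1"] i by simp
        then have "p ! (i - 1) = u" by (rule only')
        moreover have "p ! 0 = u" by (rule only) (use closing lh i(2) 2(1) in simp)
        ultimately have "i - 1 = 0" using len i by (intro inj) auto
        then show False using len 2 by linarith
      next
        case 3
        have "Suc (i - 1) = i" using 3 by simp
        then have "{p ! (i - 1), v} \<in> insert {u, v} E" using edge[of "i - 1"] i by simp
        then have "p ! (i - 1) = u" by (rule only')
        moreover have "p ! (Suc i) = u" by (rule only) (use edge[of i] i 3 in simp)
        ultimately have "i - 1 = Suc i" using i 3 by (intro inj) auto
        then show False by linarith
      qed
    qed
  qed
qed

lemma grow_conn:
  assumes "grow S E" "x \<in> S" "y \<in> S" shows "(x, y) \<in> {(a, b). {a, b} \<in> E}\<^sup>*"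
  using assms
proof (induction arbitrary: x y rule: grow.induct)
  case (base z)
  then show ?case by simp
next
  case (step S E u v)
  let ?R = "{(a, b). {a, b} \<in> insert {u, v} E}"
  have mono: "{(a, b). {a, b} \<in> E}\<^sup>* \<subseteq> ?R\<^sup>*" by (rule rtrancl_mono) auto
  have uv: "(u, v) \<in> ?R\<^sup>*" "(v, u) \<in> ?R\<^sup>*" by (auto simp: insert_commute)
  have 1: "\<And>x. x \<in> insert v S \<Longrightarrow> (x, u) \<in> ?R\<^sup>* \<and> (u, x) \<in> ?R\<^sup>*"
    using step.IH step.hyps(2) mono uv by blast
  then show ?case using step.prems by (meson rtrancl_trans)
qed

lemma grow_tree: assumes "grow S E" shows "is_tree \<lparr>verts = S, edges = E\<rparr>"
  unfolding is_tree_def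
proof (intro conjI)
  note f = grow_facts[OF assms]
  show "simple_graph \<lparr>verts = S, edges = E\<rparr>" using f sg by (auto simp: simple_graph_def)
  show "connected_graph \<lparr>verts = S, edges = E\<rparr>"
    unfolding connected_graph_def
  proof (intro conjI ballI)
    fix u v assume "u \<in> verts \<lparr>verts = S, edges = E\<rparr>" "v \<in> verts \<lparr>verts = S, edges = E\<rparr>"
    then show "\<exists>p. walk \<lparr>verts = S, edges = E\<rparr> p \<and> hd p = u \<and> last p = v"
      using rtrancl_walk[of u v "\<lparr>verts = S, edges = E\<rparr>"] grow_conn[OF assms] f by auto
  qed (use f in auto)
  show "\<nexists>p. is_cycle \<lparr>verts = S, edges = E\<rparr> p" using grow_acyclic[OF assms] by blast
qed

text \<open>\<open>C\<close> is the colour set of a rainbow walk from \<open>z\<close> through \<open>P - D\<close> to a vertex of \<open>D\<close>.\<close>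

inductive att :: "('a set \<Rightarrow> nat) \<Rightarrow> 'a set \<Rightarrow> 'a set \<Rightarrow> 'a \<Rightarrow> nat set \<Rightarrow> bool" for c D P where
  nil: "z \<in> D \<Longrightarrow> att c D P z {}"
| ext: "z \<in> P \<Longrightarrow> z \<notin> D \<Longrightarrow> w \<in> N z \<Longrightarrow> att c D P w C \<Longrightarrow> c {z, w} \<notin> C \<Longrightarrow> att c D P z (insert (c {z, w}) C)"

text \<open>The walk is attached from its end in \<open>D\<close> backwards. Where it meets the tree
  built so far, the edge is dropped; hence the new colours are only contained in \<open>C\<close>,
  and the walk need not be a path.\<close>

lemma att_grow:
  assumes "att c D P z C" "grow S E" "D \<subseteq> S" "inj_on c E" "C \<inter> c ` E = {}"
  shows "\<exists>S' E'. grow S' E' \<and> S \<subseteq> S' \<and> z \<in> S' \<and> inj_on c E' \<and> c ` E' \<subseteq> c ` E \<union> C"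
  using assms
proof (induction rule: att.induct)
  case (nil z)
  then show ?case by blast
next
  case (ext z w C)
  have "C \<inter> c ` E = {}" using ext.prems(4) by blast
  then obtain S' E' where s: "grow S' E'" "S \<subseteq> S'" "w \<in> S'" "inj_on c E'" "c ` E' \<subseteq> c ` E \<union> C"
    using ext.IH[OF ext.prems(1,2,3)] by auto
  have zw: "z \<in> N w" using ext.hyps(3) N_sym by blast
  have new: "c {w, z} \<notin> C" "c {w, z} \<notin> c ` E"
    using ext.hyps(5) ext.prems(4) by (auto simp: insert_commute)
  show ?case
  proof (cases "z \<in> S'")
    case True
    moreover have "c ` E' \<subseteq> c ` E \<union> insert (c {z, w}) C" using s(5) by blast
    ultimately show ?thesis using s(1,2,4) by (intro exI[of _ S'] exI[of _ E'] conjI)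
  next
    case False
    have g: "grow (insert z S') (insert {w, z} E')" by (rule grow.step[OF s(1) s(3) False zw])
    have "c {w, z} \<notin> c ` E'" using s(5) new by blast
    then have i: "inj_on c (insert {w, z} E')" using s(4) by auto
    have "c ` (insert {w, z} E') \<subseteq> c ` E \<union> insert (c {z, w}) C" using s(5) by (auto simp: insert_commute)
    moreover have "S \<subseteq> insert z S'" "z \<in> insert z S'" using s(2) by blast+
    ultimately show ?thesis using g i by (intro exI[of _ "insert z S'"] exI[of _ "insert {w, z} E'"] conjI)
  qed
qed

text \<open>Edges inside \<open>D\<close> never occur on such a walk, so recolouring them is
  harmless; this is how the tree can receive colours of its own afterwards.\<close>

lemma att_cong:
  assumes "att c D P z C" "P \<subseteq> P'" "\<And>a b. a \<in> P \<Longrightarrow> b \<in> P \<union> D \<Longrightarrow> a \<notin> D \<Longrightarrow> c {a, b} = c' {a, b}"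
  shows "att c' D P' z C"
proof -
  have zin: "att c D P z C \<Longrightarrow> z \<in> P \<union> D" for z C by (auto elim: att.cases)
  show ?thesis using assms(1)
  proof (induction rule: att.induct)
    case (nil z)
    then show ?case by (rule att.nil)
  next
    case (ext z w C)
    have "c {z, w} = c' {z, w}" using assms(3) zin ext by blast
    then show ?case using att.ext[of z P' D w c' C] ext assms(2) by auto
  qed
qed

lemma att_range: "att c D P z C \<Longrightarrow> (\<And>e. c e < k) \<Longrightarrow> C \<subseteq> {..<k}"
  by (induction rule: att.induct) auto

section \<open>Triples attached with disjoint colour sets\<close>

definition T3 :: "('a set \<Rightarrow> nat) \<Rightarrow> 'a set \<Rightarrow> 'a \<Rightarrow> 'a \<Rightarrow> 'a \<Rightarrow> bool" where
  "T3 c D x y z \<longleftrightarrow> (\<exists>C1 C2 C3. att c D V x C1 \<and> att c D V y C2 \<and> att c D V z C3 \<and>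
     C1 \<inter> C2 = {} \<and> C1 \<inter> C3 = {} \<and> C2 \<inter> C3 = {})"

lemma T3_perm: "T3 c D x y z \<Longrightarrow> T3 c D y x z" "T3 c D x y z \<Longrightarrow> T3 c D x z y"
  unfolding T3_def by (metis (no_types, lifting) Int_commute)+

lemma rx3_le_colours:
  fixes c :: "'a set \<Rightarrow> nat"
  assumes "three_rainbow_coloring G c" shows "rx3 G \<le> card (c ` edges G)"
  unfolding rx3_def using assms by (intro Least_le exI[of _ c]) simp

text \<open>The tree edges get the colours from \<open>k\<close> upwards, and three walks with
  disjoint colours below \<open>k\<close> are hung on the tree in turn. A vertex of \<open>D\<close>
  needs no walk; \<open>b\<close> stands in for it, which is why \<open>T\<close> must also cover
  triples that repeat a vertex of \<open>B\<close>.\<close>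

lemma rx3_le:
  assumes g: "grow D E" and ck: "\<And>e. c e < k"
    and B: "b \<in> B" "B \<subseteq> V - D"
    and T: "\<And>x y z. x \<in> V - D \<Longrightarrow> y \<in> V - D \<Longrightarrow> z \<in> V - D \<Longrightarrow> (x = y \<longrightarrow> x \<in> B) \<Longrightarrow>
       (x = z \<longrightarrow> x \<in> B) \<Longrightarrow> (y = z \<longrightarrow> y \<in> B) \<Longrightarrow> T3 c D x y z"
  shows "rx3 G \<le> card D - 1 + k"
proof -
  note f = grow_facts[OF g]
  obtain h :: "'a set \<Rightarrow> nat" where h: "bij_betw h E {..<card E}"
    using f(2) by (metis atLeast0LessThan ex_bij_betw_finite_nat)
  define c' where "c' = (\<lambda>e. if e \<in> E then k + h e else c e)"
  have cong: "att c D V z C \<Longrightarrow> att c' D V z C" for z C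
    by (rule att_cong, assumption, simp) (use f in \<open>auto simp: c'_def\<close>)
  have injE: "inj_on c' E" using h by (auto simp: inj_on_def c'_def bij_betw_def)
  have "three_rainbow_coloring G c'"
    unfolding three_rainbow_coloring_def
  proof (intro allI impI)
    fix S assume S: "S \<subseteq> V \<and> card S = 3"
    then obtain x y z where xyz: "S = {x, y, z}" "x \<noteq> y" "y \<noteq> z" "x \<noteq> z" by (auto simp: card_3_iff)
    let ?g = "\<lambda>x. if x \<in> D then b else x"
    have "T3 c D (?g x) (?g y) (?g z)"
      by (rule T) (use B S xyz in auto)
    then obtain C1 C2 C3 where C: "att c D V (?g x) C1" "att c D V (?g y) C2" "att c D V (?g z) C3"
      "C1 \<inter> C2 = {}" "C1 \<inter> C3 = {}" "C2 \<inter> C3 = {}" unfolding T3_def by blast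
    have ranges: "C1 \<subseteq> {..<k}" "C2 \<subseteq> {..<k}" "C3 \<subseteq> {..<k}" using C att_range ck by blast+
    have d0: "{..<k} \<inter> c' ` E = {}" by (auto simp: c'_def)
    have e1: "C1 \<inter> c' ` E = {}" using ranges(1) d0 by blast
    obtain S1 E1 where 1: "grow S1 E1" "D \<subseteq> S1" "?g x \<in> S1" "inj_on c' E1" "c' ` E1 \<subseteq> c' ` E \<union> C1"
      using att_grow[OF cong[OF C(1)] g subset_refl injE e1] by auto
    have e2: "C2 \<inter> c' ` E1 = {}" using 1(5) C(4) ranges(2) d0 by (meson UnE disjoint_iff subsetD)
    obtain S2 E2 where 2: "grow S2 E2" "S1 \<subseteq> S2" "?g y \<in> S2" "inj_on c' E2" "c' ` E2 \<subseteq> c' ` E1 \<union> C2"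
      using att_grow[OF cong[OF C(2)] 1(1,2,4) e2] by auto
    have e3: "C3 \<inter> c' ` E2 = {}" using 1(5) 2(5) C(5,6) ranges(3) d0 by (meson UnE disjoint_iff subsetD)
    obtain S3 E3 where 3: "grow S3 E3" "S2 \<subseteq> S3" "?g z \<in> S3" "inj_on c' E3" "c' ` E3 \<subseteq> c' ` E2 \<union> C3"
      using att_grow[OF cong[OF C(3)] 2(1) subset_trans[OF 1(2) 2(2)] 2(4) e3] by auto
    have "p \<in> S3" if "p \<in> D" for p using that 1(2) 2(2) 3(2) by blast
    then have "x \<in> S3" "y \<in> S3" "z \<in> S3" using 1(3) 2(2,3) 3(2,3) by (auto split: if_splits)
    then have "S \<subseteq> S3" using xyz by auto
    moreover have "subgraph \<lparr>verts = S3, edges = E3\<rparr> G"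
      using grow_facts(3,4)[OF 3(1)] by (simp add: subgraph_def)
    ultimately show "\<exists>T. is_tree T \<and> subgraph T G \<and> rainbow c' T \<and> S \<subseteq> verts T"
      using grow_tree[OF 3(1)] 3(4)
      by (intro exI[of _ "\<lparr>verts = S3, edges = E3\<rparr>"]) (simp add: rainbow_def)
  qed
  then have "rx3 G \<le> card (c' ` edges G)" by (rule rx3_le_colours)
  also have "c' ` edges G \<subseteq> {..<k + card E}"
    using h ck by (auto simp: c'_def bij_betw_def intro: trans_less_add1)
  then have "card (c' ` edges G) \<le> k + card E" by (metis card_lessThan card_mono finite_lessThan)
  finally show ?thesis using f(7) by simp
qed

section \<open>Cuts and spanning trees\<close>

lemma connected_cut:
  assumes "A \<subseteq> V" "A \<noteq> {}" "A \<noteq> V" shows "\<exists>a\<in>A. \<exists>b\<in>V - A. b \<in> N a"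
proof (rule ccontr)
  assume no: "\<not> ?thesis"
  obtain a b where ab: "a \<in> A" "b \<in> V - A" using assms by blast
  have "(a, b) \<in> {(a, b). {a, b} \<in> edges G}\<^sup>*" using connected_graph_rtrancl[OF con] ab assms by blast
  then have "b \<in> A"
  proof (induction rule: rtrancl_induct)
    case (step y z)
    then have "z \<in> N y" by (simp add: N_def)
    then show ?case using no step N_V by blast
  qed (use ab in simp)
  then show False using ab by blast
qed

lemma spanning_grow:
  assumes "grow S E" shows "\<exists>E'. grow V E'"
proof -
  let ?P = "\<lambda>p. grow (fst p) (snd p)"
  have "\<exists>p. ?P p \<and> (\<forall>q. ?P q \<longrightarrow> card (fst q) \<le> card (fst p))"
    by (rule ex_has_greatest_nat[of ?P "(S, E)" _ "Suc (card V)"])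
      (use assms in \<open>simp_all add: less_Suc_eq_le card_mono finV grow_facts(3)\<close>)
  then obtain p where p: "?P p" "\<forall>q. ?P q \<longrightarrow> card (fst q) \<le> card (fst p)" by (elim exE conjE)
  define S E where "S = fst p" and "E = snd p"
  have s: "grow S E" using p(1) by (simp add: S_def E_def)
  have s2: "card S' \<le> card S" if "grow S' E'" for S' E'
    using p(2)[rule_format, of "(S', E')"] that by (simp add: S_def)
  have "S = V"
  proof (rule ccontr)
    assume "S \<noteq> V"
    then obtain a b where "a \<in> S" "b \<in> V - S" "b \<in> N a"
      using connected_cut[of S] grow_facts(3,6)[OF s] by blast
    then have "grow (insert b S) (insert {a, b} E)" using s by (intro grow.step) auto
    then have "card (insert b S) \<le> card S" by (rule s2)
    then show False using \<open>b \<in> V - S\<close> grow_facts(1)[OF s] by simp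
  qed
  then show ?thesis using s by blast
qed

text \<open>Turns the \<open>LEAST\<close> into an actual colouring, as the lower bound
  requires.\<close>

lemma rx3_attained: "\<exists>c :: 'a set \<Rightarrow> nat. three_rainbow_coloring G c \<and> card (c ` edges G) = rx3 G"
proof -
  obtain x where "x \<in> V" using con by (auto simp: connected_graph_def)
  then obtain E where E: "grow V E" using spanning_grow grow.base by blast
  obtain c :: "'a set \<Rightarrow> nat" where c: "inj_on c (edges G)"
    using finE finite_imp_inj_to_nat_seg by blast
  have "three_rainbow_coloring G c" unfolding three_rainbow_coloring_def
  proof (intro allI impI exI conjI)
    show "is_tree \<lparr>verts = V, edges = E\<rparr>" by (rule grow_tree[OF E])
    show "subgraph \<lparr>verts = V, edges = E\<rparr> G" using grow_facts[OF E] by (simp add: subgraph_def)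
    show "rainbow c \<lparr>verts = V, edges = E\<rparr>" using grow_facts(4)[OF E] c by (auto simp: rainbow_def intro: inj_on_subset)
  qed auto
  then have "\<exists>k. \<exists>c :: 'a set \<Rightarrow> nat. three_rainbow_coloring G c \<and> card (c ` edges G) = k" by blast
  then show ?thesis unfolding rx3_def by (rule LeastI_ex)
qed

subsection \<open>Six colours around a connected dominating set\<close>

text \<open>Roots are the vertices of depth 0, where \<open>p\<close> is arbitrary. Carrying the
  depth explicitly makes the sum of depths available as a measure.\<close>

definition forest :: "'a set \<Rightarrow> ('a \<Rightarrow> 'a) \<Rightarrow> ('a \<Rightarrow> nat) \<Rightarrow> bool" where
  "forest B p d \<longleftrightarrow> (\<forall>u\<in>B. 0 < d u \<longrightarrow> p u \<in> B \<and> p u \<in> N u \<and> d u = Suc (d (p u)))"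

definition par :: "'a set \<Rightarrow> ('a \<Rightarrow> 'a) \<Rightarrow> ('a \<Rightarrow> nat) \<Rightarrow> ('a \<times> 'a) set" where
  "par B p d = {(x, u). u \<in> B \<and> 0 < d u \<and> x = p u}"

text \<open>Climbing from \<open>u\<close> to its root meets every depth up to \<open>d u\<close>.
  The bound guarantees that a largest sum of depths exists.\<close>

lemma forest_depth:
  assumes "forest B p d" "finite B" "u \<in> B"
  shows "d u < card B"
proof -
  have "{..d u} \<subseteq> d ` B" using assms(3)
  proof (induction "d u" arbitrary: u)
    case 0
    then show ?case by force
  next
    case (Suc n)
    then have p: "p u \<in> B" "d u = Suc (d (p u))" using assms(1) by (auto simp: forest_def)
    have "{..d (p u)} \<subseteq> d ` B" by (rule Suc.hyps(1)) (use p Suc in auto)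
    moreover have "d u \<in> d ` B" using Suc.prems by blast
    ultimately show ?case unfolding p(2) atMost_Suc by blast
  qed
  then have "card {..d u} \<le> card (d ` B)" using assms(2) by (intro card_mono) auto
  also have "\<dots> \<le> card B" using assms(2) by (rule card_image_le)
  finally show ?thesis by simp
qed

lemma par_le:
  assumes "forest B p d" "(x, y) \<in> (par B p d)\<^sup>*" shows "d x \<le> d y"
  using assms(2)
proof (induction rule: rtrancl_induct)
  case (step y z)
  then show ?case using assms(1) by (force simp: par_def forest_def)
qed simp

lemma par_less:
  assumes "forest B p d" "(x, y) \<in> (par B p d)\<^sup>*" "x \<noteq> y"
  shows "d x < d y" "\<exists>z. (x, z) \<in> par B p d \<and> (z, y) \<in> (par B p d)\<^sup>*" "(x, p y) \<in> (par B p d)\<^sup>*"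
    "y \<in> B" "0 < d y"
proof -
  obtain z where z: "(x, z) \<in> par B p d" "(z, y) \<in> (par B p d)\<^sup>*"
    using assms(2,3) by (meson converse_rtranclE)
  have "d x < d z" using z(1) assms(1) by (force simp: par_def forest_def)
  then show "d x < d y" using par_le[OF assms(1) z(2)] by simp
  show "\<exists>z. (x, z) \<in> par B p d \<and> (z, y) \<in> (par B p d)\<^sup>*" using z by blast
  obtain w where w: "(x, w) \<in> (par B p d)\<^sup>*" "(w, y) \<in> par B p d"
    using assms(2,3) by (meson rtranclE)
  then show "(x, p y) \<in> (par B p d)\<^sup>*" "y \<in> B" "0 < d y" by (auto simp: par_def)
qed

text \<open>A forest with the largest sum of depths is normal: moving the subtree of a vertex below an
  incomparable neighbour that is not higher up would increase the sum.\<close>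

lemma normal_forest:
  assumes "finite B"
  obtains p d where "forest B p d"
    "\<And>x w. x \<in> B \<Longrightarrow> w \<in> B \<Longrightarrow> w \<in> N x \<Longrightarrow> d x \<le> d w \<Longrightarrow> (x, w) \<in> (par B p d)\<^sup>*"
proof -
  let ?P = "\<lambda>q. forest B (fst q) (snd q)"
  let ?f = "\<lambda>q :: ('a \<Rightarrow> 'a) \<times> ('a \<Rightarrow> nat). \<Sum>u\<in>B. snd q u"
  have "\<exists>q. ?P q \<and> (\<forall>q'. ?P q' \<longrightarrow> ?f q' \<le> ?f q)"
  proof (rule ex_has_greatest_nat[of ?P "(undefined, \<lambda>_. 0)" _ "Suc (card B * card B)"])
    show "?P (undefined, \<lambda>_. 0)" by (simp add: forest_def)
    show "\<forall>q. ?P q \<longrightarrow> ?f q < Suc (card B * card B)"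
    proof (intro allI impI)
      fix q assume "?P q"
      then have "\<And>u. u \<in> B \<Longrightarrow> snd q u \<le> card B" using forest_depth[OF _ assms] by (meson less_imp_le)
      then have "?f q \<le> (\<Sum>u\<in>B. card B)" by (rule sum_mono)
      then show "?f q < Suc (card B * card B)" by simp
    qed
  qed
  then obtain q where q: "?P q" "\<forall>q'. ?P q' \<longrightarrow> ?f q' \<le> ?f q" by (elim exE conjE)
  define p d where "p = fst q" and "d = snd q"
  have f: "forest B p d" using q(1) by (simp add: p_def d_def)
  have mx: "(\<Sum>u\<in>B. d' u) \<le> (\<Sum>u\<in>B. d u)" if "forest B p' d'" for p' d'
    using q(2)[rule_format, of "(p', d')"] that by (simp add: d_def)
  have "(x, w) \<in> (par B p d)\<^sup>*" if x: "x \<in> B" and w: "w \<in> B" "w \<in> N x" "d x \<le> d w" for x w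
  proof (rule ccontr)
    assume nxw: "(x, w) \<notin> (par B p d)\<^sup>*"
    \<comment> \<open>The subtraction is exact and the shift positive because
      \<open>d x \<le> d w\<close>; as \<open>w\<close> is not below \<open>x\<close>, its own depth
      does not change.\<close>
    define d' where "d' = (\<lambda>y. if (x, y) \<in> (par B p d)\<^sup>* then d y + (d w + 1 - d x) else d y)"
    define p' where "p' = p(x := w)"
    have "forest B p' d'"
      unfolding forest_def
    proof (intro ballI impI)
      fix u assume u: "u \<in> B" "0 < d' u"
      consider "u = x" | "u \<noteq> x" "(x, u) \<in> (par B p d)\<^sup>*" | "u \<noteq> x" "(x, u) \<notin> (par B p d)\<^sup>*" by blast
      then show "p' u \<in> B \<and> p' u \<in> N u \<and> d' u = Suc (d' (p' u))"
      proof cases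
        case 1
        then show ?thesis using w nxw by (simp add: p'_def d'_def)
      next
        case 2
        note l = par_less[OF f 2(2) not_sym[OF 2(1)]]
        have "p u \<in> B \<and> p u \<in> N u \<and> d u = Suc (d (p u))" using f l(4,5) by (simp add: forest_def)
        then show ?thesis using 2 l(3) by (simp add: p'_def d'_def)
      next
        case 3
        have "0 < d u" using u 3 by (simp add: d'_def)
        then have pu: "p u \<in> B \<and> p u \<in> N u \<and> d u = Suc (d (p u))" "(p u, u) \<in> par B p d"
          using f u by (simp_all add: forest_def par_def)
        have "(x, p u) \<notin> (par B p d)\<^sup>*" using 3 pu(2) by (meson rtrancl.rtrancl_into_rtrancl)
        then show ?thesis using 3 pu(1) by (simp add: p'_def d'_def)
      qed
    qed
    then have "(\<Sum>u\<in>B. d' u) \<le> (\<Sum>u\<in>B. d u)" by (rule mx)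
    moreover have "(\<Sum>u\<in>B. d u) < (\<Sum>u\<in>B. d' u)"
      by (rule sum_strict_mono_ex1[OF assms]) (use x w in \<open>auto simp: d'_def intro!: bexI[of _ x]\<close>)
    ultimately show False by simp
  qed
  then show ?thesis using that f by blast
qed

end

locale coloured_forest = fin_graph +
  fixes D B :: "'a set" and p :: "'a \<Rightarrow> 'a" and d :: "'a \<Rightarrow> nat"
  assumes finB: "finite B" and disj: "B \<inter> D = {}"
    and legs: "\<And>u. u \<in> B \<Longrightarrow> N u \<inter> D \<noteq> {}"
    and deg3: "\<And>u. u \<in> B \<Longrightarrow> 3 \<le> card (N u \<inter> (D \<union> B))"
    and fo: "forest B p d"
    and normal: "\<And>x w. x \<in> B \<Longrightarrow> w \<in> B \<Longrightarrow> w \<in> N x \<Longrightarrow> d x \<le> d w \<Longrightarrow> (x, w) \<in> (par B p d)\<^sup>*"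
begin

text \<open>The first edge from \<open>u\<close> to \<open>D\<close> is coloured by the depth of \<open>u\<close> modulo 3. Adding 3 to
  \<open>2 * (a + b) mod 3\<close> colours an edge between different classes \<open>a\<close>, \<open>b\<close> by the third class, and an edge inside
  a class by that class. The exceptions \<open>O1\<close> (leaves) and \<open>act\<close> (roots) are vertices with one neighbour in \<open>D\<close>
  whose neighbours in \<open>B\<close> are all in the same class; one edge of the forest is recoloured for each of them.\<close>

abbreviation "R \<equiv> par B p d"

definition cl :: "'a \<Rightarrow> nat" where "cl u = d u mod 3"
definition two :: "'a \<Rightarrow> bool" where "two u \<longleftrightarrow> 2 \<le> card (N u \<inter> D)"
definition leaf :: "'a \<Rightarrow> bool" where "leaf u \<longleftrightarrow> (\<forall>y. (u, y) \<notin> R)"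
text \<open>A leaf is chosen only if all children are leaves. So when the edge to the chosen child
  is a recoloured leaf edge, no child has descendants; \<open>good_adj\<close> depends on
  this.\<close>

definition ch :: "'a \<Rightarrow> 'a" where
  "ch u = (SOME y. (u, y) \<in> R \<and> (leaf y \<longrightarrow> (\<forall>z. (u, z) \<in> R \<longrightarrow> leaf z)))"
definition O1 :: "'a \<Rightarrow> bool" where
  "O1 u \<longleftrightarrow> u \<in> B \<and> leaf u \<and> 0 < d u \<and> \<not> two u \<and> (\<forall>w\<in>N u \<inter> B. cl w = (cl u + 2) mod 3)"
definition act :: "'a \<Rightarrow> bool" where
  "act r \<longleftrightarrow> r \<in> B \<and> d r = 0 \<and> \<not> leaf r \<and> \<not> two r \<and> (\<forall>w\<in>N r \<inter> B. cl w = 1)"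
definition f1 :: "'a \<Rightarrow> 'a" where "f1 u = (SOME f. f \<in> N u \<inter> D)"
definition f2 :: "'a \<Rightarrow> 'a" where "f2 u = (SOME f. f \<in> N u \<inter> D \<and> f \<noteq> f1 u)"
text \<open>A root has no parent and a leaf no child, so the second edge to \<open>D\<close>
  replaces what is missing: class \<open>cl u + 2\<close> for a root, class \<open>cl u + 1\<close>
  for other vertices. Further edges get the remaining class.\<close>

definition leg :: "'a \<Rightarrow> 'a \<Rightarrow> nat" where
  "leg u f = (if f = f1 u then cl u
     else if (f = f2 u) = (d u = 0) then (cl u + 2) mod 3 else (cl u + 1) mod 3)"
text \<open>By default all forest-side edges at an exceptional root have colour 5, and all those at
  an exceptional leaf have colour \<open>3 + (cl u + 1) mod 3\<close>, so no two detours would be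
  disjoint. One edge is moved to another colour: to 4 at a root, and to 3 plus the class of the
  parent, the end of smaller depth, at a leaf.\<close>

definition hc :: "'a set \<Rightarrow> nat" where
  "hc e = 3 + (if \<exists>r. act r \<and> e = {r, ch r} then 1
     else if \<exists>u. O1 u \<and> e = {u, p u} then Min (d ` e) mod 3
     else (2 * sum d e) mod 3)"
definition c :: "'a set \<Rightarrow> nat" where
  "c e = (if e \<subseteq> B then hc e else leg (the_elem (e \<inter> B)) (the_elem (e \<inter> D)))"

section \<open>Classes and colours of the edges inside the forest\<close>

lemma cl3: "cl u < 3" "cl u = 0 \<or> cl u = 1 \<or> cl u = 2" by (auto simp: cl_def)

lemma c6: "c e < 6"
proof -
  have "leg u f < 3" for u f using cl3 by (simp add: leg_def)
  moreover have "hc e < 6" by (auto simp: hc_def intro: less_le_trans[of _ 3])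
  ultimately show ?thesis by (simp add: c_def less_le_trans[of _ 3])
qed

lemma Rd: assumes "(x, y) \<in> R" shows "y \<in> B" "x \<in> B" "x = p y" "d y = Suc (d x)" "x \<in> N y" "y \<in> N x"
    "cl y = (cl x + 1) mod 3" "cl x = (cl y + 2) mod 3"
proof -
  show "y \<in> B" "x \<in> B" "x = p y" "d y = Suc (d x)" "x \<in> N y" using assms fo by (auto simp: par_def forest_def)
  then show "y \<in> N x" using N_sym by blast
  show "cl y = (cl x + 1) mod 3" "cl x = (cl y + 2) mod 3"
    using \<open>d y = Suc (d x)\<close> unfolding cl_def by presburger+
qed

lemma Rp: "u \<in> B \<Longrightarrow> 0 < d u \<Longrightarrow> (p u, u) \<in> R" by (simp add: par_def)

lemma R_not_leaf: "(x, y) \<in> R \<Longrightarrow> \<not> leaf x" by (auto simp: leaf_def)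

lemma chR: assumes "\<not> leaf u" shows "(u, ch u) \<in> R" "leaf (ch u) \<Longrightarrow> (u, z) \<in> R \<Longrightarrow> leaf z"
proof -
  have "\<exists>y. (u, y) \<in> R \<and> (leaf y \<longrightarrow> (\<forall>z. (u, z) \<in> R \<longrightarrow> leaf z))"
    using assms by (cases "\<exists>y. (u, y) \<in> R \<and> \<not> leaf y") (auto simp: leaf_def)
  then have "(u, ch u) \<in> R \<and> (leaf (ch u) \<longrightarrow> (\<forall>z. (u, z) \<in> R \<longrightarrow> leaf z))"
    unfolding ch_def by (rule someI_ex)
  then show "(u, ch u) \<in> R" "leaf (ch u) \<Longrightarrow> (u, z) \<in> R \<Longrightarrow> leaf z" by auto
qed

text \<open>Nothing lies below a leaf, so normality leaves only proper ancestors as neighbours in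
  \<open>B\<close>.\<close>

lemma leaf_nbr: assumes "u \<in> B" "leaf u" "w \<in> N u" "w \<in> B" shows "d w < d u" "(w, u) \<in> R\<^sup>*" "\<not> leaf w" "0 < d u"
proof -
  have "\<not> d u \<le> d w"
  proof
    assume "d u \<le> d w"
    then have "(u, w) \<in> R\<^sup>*" using normal assms by blast
    moreover have "u \<noteq> w" using assms N_irrefl by blast
    ultimately show False using par_less(2)[OF fo] assms(2) unfolding leaf_def by blast
  qed
  then show 1: "d w < d u" "0 < d u" by auto
  show 2: "(w, u) \<in> R\<^sup>*" using normal[of w u] assms 1 N_sym by (meson less_imp_le)
  show "\<not> leaf w" using par_less(2)[OF fo 2] 1 unfolding leaf_def by blast
qed

lemma many_nbrs: assumes "u \<in> B" "\<not> two u" shows "\<exists>w\<in>N u \<inter> B. w \<noteq> x"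
proof -
  have "card (N u \<inter> (D \<union> B)) \<le> card (N u \<inter> D) + card (N u \<inter> B)"
    by (metis Int_Un_distrib card_Un_le)
  then have "2 \<le> card (N u \<inter> B)" using deg3[OF assms(1)] assms(2) by (simp add: two_def)
  then have "\<not> N u \<inter> B \<subseteq> {x}" using card_mono[of "{x}" "N u \<inter> B"] by auto
  then show ?thesis by blast
qed

lemma cl_mod: "(2 * (d u + d w)) mod 3 = (2 * (cl u + cl w)) mod 3"
  unfolding cl_def by (metis mod_add_eq mod_mult_right_eq)

text \<open>Besides \<open>p u\<close> there is a neighbour \<open>w\<close>, which is a proper
  ancestor of \<open>p u\<close> in the same class and hence at least three levels higher. So
  recoloured leaf edges stay away from recoloured root edges, which join depths 0 and 1.\<close>

lemma O1_depth: assumes "O1 u" shows "4 \<le> d u"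
proof -
  have u: "u \<in> B" "leaf u" "0 < d u" "\<not> two u" using assms by (auto simp: O1_def)
  obtain w where w: "w \<in> N u" "w \<in> B" "w \<noteq> p u" using many_nbrs[OF u(1,4)] by blast
  note l = leaf_nbr[OF u(1,2) w(1,2)]
  have "w \<noteq> u" using l by blast
  then have "(w, p u) \<in> R\<^sup>*" using par_less(3)[OF fo l(2)] by blast
  then have "d w < d (p u)" using par_less(1)[OF fo] w(3) by blast
  moreover have "cl w = (cl u + 2) mod 3" using assms w unfolding O1_def by blast
  moreover have "d u = Suc (d (p u))" using Rd(4)[OF Rp[OF u(1,3)]] .
  ultimately show ?thesis unfolding cl_def by presburger
qed

lemma act_edge: assumes "act r" "{u, w} = {r, ch r}" shows "(u = r \<and> w = ch r \<and> d u = 0 \<and> d w = 1) \<or> (w = r \<and> u = ch r \<and> d w = 0 \<and> d u = 1)"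
proof -
  have "(r, ch r) \<in> R" using chR(1) assms(1) by (simp add: act_def)
  then have "d (ch r) = 1" "d r = 0" using Rd(4) assms(1) by (auto simp: act_def)
  then show ?thesis using assms(2) by (auto simp: doubleton_eq_iff)
qed

lemma c_default:
  assumes "u \<in> B" "w \<in> B" "w \<in> N u" "\<not> (act u \<and> w = ch u)" "\<not> (act w \<and> u = ch w)"
    "\<not> (O1 u \<and> w = p u)" "\<not> (O1 w \<and> u = p w)"
  shows "c {u, w} = 3 + (2 * (cl u + cl w)) mod 3"
proof -
  have 1: "\<not> (\<exists>r. act r \<and> {u, w} = {r, ch r})" using assms(4,5) by (auto simp: doubleton_eq_iff)
  have 2: "\<not> (\<exists>r. O1 r \<and> {u, w} = {r, p r})" using assms(6,7) by (auto simp: doubleton_eq_iff)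
  have "u \<noteq> w" using assms(3) by auto
  then have "sum d {u, w} = d u + d w" by simp
  moreover have "{u, w} \<subseteq> B" using assms(1,2) by blast
  ultimately show ?thesis unfolding c_def hc_def if_not_P[OF 1] if_not_P[OF 2] using cl_mod[of u w] by simp
qed

lemma c_act: assumes "act r" shows "c {r, ch r} = 4"
proof -
  have "(r, ch r) \<in> R" using chR(1) assms by (simp add: act_def)
  then have "{r, ch r} \<subseteq> B" using Rd by blast
  moreover have "\<exists>r'. act r' \<and> {r, ch r} = {r', ch r'}" using assms by blast
  ultimately show ?thesis unfolding c_def hc_def by simp
qed

lemma c_O1: assumes "O1 u" shows "c {u, p u} = 3 + cl (p u)"
proof -
  have R: "(p u, u) \<in> R" using assms Rp by (simp add: O1_def)
  have "4 \<le> d u" using O1_depth assms .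
  then have n: "\<not> (\<exists>r. act r \<and> {u, p u} = {r, ch r})" using act_edge[of _ u "p u"] Rd(4)[OF R] by force
  have "Min (d ` {u, p u}) = d (p u)" using Rd(4)[OF R] by simp
  moreover have "\<exists>v. O1 v \<and> {u, p u} = {v, p v}" using assms by blast
  moreover have "{u, p u} \<subseteq> B" using Rd(1,2)[OF R] by blast
  ultimately show ?thesis unfolding c_def hc_def cl_def if_not_P[OF n] by presburger
qed

lemma c_new: assumes "u \<in> B" "w \<in> B" shows "c {u, w} \<noteq> i mod 3"
proof -
  have "3 \<le> c {u, w}" using assms by (simp add: c_def hc_def)
  moreover have "i mod 3 < 3" by simp
  ultimately show ?thesis by linarith
qed

section \<open>Routes from a vertex of \<open>B\<close> to \<open>D\<close>\<close>

abbreviation "A \<equiv> att c D B"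

lemma A_leg: assumes "u \<in> B" "f \<in> N u \<inter> D" shows "A u {leg u f}"
proof -
  have "u \<notin> D" "f \<notin> B" using assms disj by blast+
  then have "{u, f} \<inter> B = {u}" "{u, f} \<inter> D = {f}" "\<not> {u, f} \<subseteq> B" using assms by auto
  then have "c {u, f} = leg u f" unfolding c_def by (metis the_elem_eq)
  then show ?thesis using att.ext[OF assms(1) \<open>u \<notin> D\<close> _ att.nil, of f c] assms by simp
qed

lemma f1D: assumes "u \<in> B" shows "f1 u \<in> N u \<inter> D"
  unfolding f1_def using legs[OF assms] by (metis all_not_in_conv someI_ex)

lemma own: assumes "u \<in> B" shows "A u {cl u}"
  using A_leg[OF assms f1D[OF assms]] by (simp add: leg_def)

lemma second: assumes "u \<in> B" "two u" shows "A u {if d u = 0 then (cl u + 2) mod 3 else (cl u + 1) mod 3}"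
proof -
  have "\<not> N u \<inter> D \<subseteq> {f1 u}"
    using assms(2) card_mono[of "{f1 u}" "N u \<inter> D"] by (auto simp: two_def)
  then have "\<exists>f. f \<in> N u \<inter> D \<and> f \<noteq> f1 u" by blast
  then have "f2 u \<in> N u \<inter> D \<and> f2 u \<noteq> f1 u" unfolding f2_def by (rule someI_ex)
  then show ?thesis using A_leg[OF assms(1), of "f2 u"] by (auto simp: leg_def)
qed

lemma third: assumes "u \<in> B" "3 \<le> card (N u \<inter> D)" "d u = 0" shows "A u {(cl u + 1) mod 3}"
proof -
  have "\<not> N u \<inter> D \<subseteq> {f1 u, f2 u}"
    using assms(2) card_mono[of "{f1 u, f2 u}" "N u \<inter> D"] card_insert_le_m1[of 2 "{f2 u}" "f1 u"] by auto
  then obtain f where "f \<in> N u \<inter> D" "f \<noteq> f1 u" "f \<noteq> f2 u" by blast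
  then show ?thesis using A_leg[OF assms(1), of f] assms(3) by (simp add: leg_def)
qed

lemma A_step: assumes "u \<in> B" "w \<in> N u" "A w C" "c {u, w} \<notin> C" shows "A u (insert (c {u, w}) C)"
  using assms disj by (intro att.ext) auto

lemma A_own: assumes "u \<in> B" "w \<in> B" "w \<in> N u" shows "A u (insert (c {u, w}) {cl w})"
  using c_new[OF assms(1,2), of "cl w"] cl3(1)[of w] by (intro A_step assms own) simp

lemma A_two: assumes "u \<in> B" "w \<in> B" "y \<in> B" "w \<in> N u" "y \<in> N w" "c {u, w} \<noteq> c {w, y}"
  shows "A u (insert (c {u, w}) (insert (c {w, y}) {cl y}))"
  using c_new[OF assms(1,2), of "cl y"] cl3(1)[of y] assms(6)
  by (intro A_step[OF assms(1,4)] A_own assms) simp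

text \<open>\<open>S\<close> and \<open>T\<close> are the prices, shifted by 3, for ending with the
  classes \<open>cl u + 1\<close> and \<open>cl u + 2\<close>. Two vertices of equal class can only
  be in conflict over \<open>3 + cl u\<close>; the last two conditions confine this colour to places
  in the forest that exclude a conflict along an edge.\<close>

definition good :: "'a \<Rightarrow> nat set \<Rightarrow> nat set \<Rightarrow> bool" where
  "good u S T \<longleftrightarrow> A u (insert ((cl u + 1) mod 3) ((+) 3 ` S)) \<and> A u (insert ((cl u + 2) mod 3) ((+) 3 ` T)) \<and>
     S \<subseteq> {cl u, (cl u + 2) mod 3} \<and> T \<subseteq> {cl u, (cl u + 1) mod 3} \<and> S \<inter> T = {} \<and>
     (cl u \<in> S \<longrightarrow> (\<forall>y. (u, y) \<in> R \<longrightarrow> leaf y)) \<and> (cl u \<in> T \<longrightarrow> d u \<le> 1)"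

lemma c_par_nonleaf:
  assumes "(x, u) \<in> R" "\<not> O1 u" "\<not> (act x \<and> u = ch x)"
  shows "c {u, x} = 3 + (cl u + 1) mod 3"
proof -
  note r = Rd[OF assms(1)]
  have "c {u, x} = 3 + (2 * (cl u + cl x)) mod 3"
  proof (rule c_default)
    show "\<not> (act u \<and> x = ch u)" using r(4) by (auto simp: act_def)
    show "\<not> (O1 x \<and> u = p x)" using R_not_leaf[OF assms(1)] by (auto simp: O1_def)
  qed (use r assms in auto)
  then show ?thesis using r(8) cl3(2)[of u] by (elim disjE) simp_all
qed

text \<open>The chosen child lies in class \<open>cl u + 1\<close> and the parent in class
  \<open>cl u + 2\<close>, so one edge in either direction is enough.\<close>

lemma good_internal:
  assumes u: "u \<in> B" "0 < d u" "\<not> leaf u"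
  shows "\<exists>S T. good u S T"
proof -
  define y where "y = ch u"
  have y: "(u, y) \<in> R" using chR(1)[OF u(3)] y_def by simp
  have pu: "(p u, u) \<in> R" using Rp u by blast
  note ry = Rd[OF y] and rp = Rd[OF pu]
  have nO: "\<not> O1 u" using u(3) by (simp add: O1_def)
  define T where "T = (if act (p u) \<and> u = ch (p u) then {cl u} else {(cl u + 1) mod 3})"
  define S where "S = (if O1 y then {cl u} else {(cl u + 2) mod 3})"
  have d1: "d u = 1" "cl u = 1" if "act (p u)"
    using that rp(4) by (auto simp: act_def cl_def)
  have cp: "insert (c {u, p u}) {(cl u + 2) mod 3} = insert ((cl u + 2) mod 3) ((+) 3 ` T)"
    using c_par_nonleaf[OF pu nO] c_act[of "p u"] d1 by (auto simp: T_def insert_commute)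
  have cy: "c {u, y} = (if O1 y then 3 + cl u else 3 + (cl u + 2) mod 3)"
  proof (cases "O1 y")
    case True
    then show ?thesis using c_O1[OF True] ry by (simp add: insert_commute)
  next
    case False
    have "\<not> (act u \<and> y = ch u)" using u(2) by (simp add: act_def)
    then have "c {y, u} = 3 + (cl y + 1) mod 3" using c_par_nonleaf[OF y False] by blast
    then show ?thesis using False ry(7) by (simp add: insert_commute mod_simps)
  qed
  have "A u (insert (c {u, y}) {(cl u + 1) mod 3})"
    using A_own[OF u(1) ry(1,6)] unfolding ry(7) .
  then have AS: "A u (insert ((cl u + 1) mod 3) ((+) 3 ` S))" using cy by (simp add: S_def insert_commute split: if_splits)
  have "A u (insert (c {u, p u}) {(cl u + 2) mod 3})"
    using A_own[OF rp(1,2,5)] unfolding rp(8) .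
  then have AT: "A u (insert ((cl u + 2) mod 3) ((+) 3 ` T))" unfolding cp .
  \<comment> \<open>A clash would need both edges to be recoloured; then \<open>y\<close> would have
    depth 2 and at the same time depth at least 4.\<close>
  have "S \<inter> T = {}"
  proof -
    have "\<not> (O1 y \<and> act (p u))" using O1_depth[of y] ry(4) d1(1) by auto
    then show ?thesis using cl3(2)[of u] by (auto simp: S_def T_def)
  qed
  moreover have "cl u \<in> S \<longrightarrow> (\<forall>y. (u, y) \<in> R \<longrightarrow> leaf y)"
    using chR(2)[OF u(3)] cl3(2)[of u] by (auto simp: S_def y_def O1_def)
  moreover have "cl u \<in> T \<longrightarrow> d u \<le> 1" using d1(1) cl3(2)[of u] by (auto simp: T_def split: if_splits)
  ultimately have "good u S T" unfolding good_def using AS AT by (auto simp: S_def T_def)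
  then show ?thesis by blast
qed

text \<open>Without a child, class \<open>cl u + 1\<close> must come from elsewhere: from a second
  edge to \<open>D\<close>, from a neighbour whose class is not that of the parent, or, for an
  exceptional leaf, over the parent from the grandparent.\<close>

lemma good_leaf:
  assumes u: "u \<in> B" "0 < d u" "leaf u"
  shows "\<exists>S T. good u S T"
proof -
  have pu: "(p u, u) \<in> R" using Rp u by blast
  note rp = Rd[OF pu]
  show ?thesis
  proof (cases "two u")
    case True
    have nO: "\<not> O1 u" using True by (simp add: O1_def)
    define T where "T = (if act (p u) \<and> u = ch (p u) then {cl u} else {(cl u + 1) mod 3})"
    have d1: "d u = 1" "cl u = 1" if "act (p u)"
      using that rp(4) by (auto simp: act_def cl_def)
    have cp: "insert (c {u, p u}) {(cl u + 2) mod 3} = insert ((cl u + 2) mod 3) ((+) 3 ` T)"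
      using c_par_nonleaf[OF pu nO] c_act[of "p u"] d1 by (auto simp: T_def insert_commute)
    have "A u (insert (c {u, p u}) {(cl u + 2) mod 3})"
      using A_own[OF rp(1,2,5)] unfolding rp(8) .
    then have AT: "A u (insert ((cl u + 2) mod 3) ((+) 3 ` T))" unfolding cp .
    have "A u {(cl u + 1) mod 3}" using second[OF u(1) True] u(2) by simp
    moreover have "cl u \<in> T \<longrightarrow> d u \<le> 1" using d1(1) cl3(2)[of u] by (auto simp: T_def split: if_splits)
    ultimately have "good u {} T" unfolding good_def using AT by (auto simp: T_def)
    then show ?thesis by blast
  next
    case False
    obtain w0 where w0: "w0 \<in> N u" "w0 \<in> B" "w0 \<noteq> p u" using many_nbrs[OF u(1) False] by blast
    have anc: "d w < d (p u)" if "w \<in> N u" "w \<in> B" "w \<noteq> p u" for w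
    proof -
      note l = leaf_nbr[OF u(1,3) that(1,2)]
      have "(w, p u) \<in> R\<^sup>*" using par_less(3)[OF fo l(2)] l(1) by blast
      then show ?thesis using par_less(1)[OF fo] that(3) by blast
    qed
    have d2: "2 \<le> d u" using anc[OF w0] rp(4) by simp
    have npact: "\<not> act (p u)" using d2 rp(4) by (auto simp: act_def)
    have ce: "c {u, w} = 3 + (2 * (cl u + cl w)) mod 3" if w: "w \<in> N u" "w \<in> B" "w \<noteq> p u" for w
    proof (rule c_default)
      show "\<not> (act w \<and> u = ch w)"
      proof
        assume "act w \<and> u = ch w"
        then have "(w, u) \<in> R" using chR(1) by (auto simp: act_def)
        then show False using Rd(3) w(3) by blast
      qed
      show "\<not> (O1 w \<and> u = p w)" using leaf_nbr(3)[OF u(1,3) w(1,2)] by (auto simp: O1_def)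
      show "\<not> (act u \<and> w = ch u)" using u by (simp add: act_def)
    qed (use u w in auto)
    have lf: "\<forall>y. (u, y) \<in> R \<longrightarrow> leaf y" using u(3) by (simp add: leaf_def)
    show ?thesis
    proof (cases "O1 u")
      case False
      have cp: "c {u, p u} = 3 + (cl u + 1) mod 3" using c_par_nonleaf[OF pu False] npact by blast
      have "A u (insert (c {u, p u}) {(cl u + 2) mod 3})"
        using A_own[OF rp(1,2,5)] unfolding rp(8) .
      then have AT: "A u (insert ((cl u + 2) mod 3) ((+) 3 ` {(cl u + 1) mod 3}))" using cp by (simp add: insert_commute)
      obtain w where w: "w \<in> N u" "w \<in> B" "cl w \<noteq> (cl u + 2) mod 3"
        using False u \<open>\<not> two u\<close> by (auto simp: O1_def)
      have wp: "w \<noteq> p u" using w rp(8) by auto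
      note l = leaf_nbr[OF u(1,3) w(1,2)]
      show ?thesis
      proof (cases "cl w = cl u")
        case False
        then have cw: "cl w = (cl u + 1) mod 3" using w(3) cl3(2)[of u] cl3(2)[of w] by auto
        have cuw: "c {u, w} = 3 + (cl u + 2) mod 3" using ce[OF w(1,2) wp] cw cl3(2)[of u] by (elim disjE) simp_all
        have "A u (insert (c {u, w}) {cl w})" by (rule A_own[OF u(1) w(2,1)])
        then have "good u {(cl u + 2) mod 3} {(cl u + 1) mod 3}"
          unfolding good_def using AT cuw cw cl3(2)[of u] lf by (auto simp: insert_commute)
        then show ?thesis by blast
      next
        case True
        have cuw: "c {u, w} = 3 + cl u" using ce[OF w(1,2) wp] True cl3(2)[of u] by (elim disjE) simp_all
        \<comment> \<open>An ancestor \<open>w\<close> of the same class gives nothing by itself.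
          The walk steps back down towards \<open>u\<close>, to the child \<open>y\<close> of
          \<open>w\<close> in class \<open>cl u + 1\<close>.\<close>
        obtain y where y: "(w, y) \<in> R" "(y, u) \<in> R\<^sup>*" using par_less(2)[OF fo l(2)] l(1) by blast
        note ry = Rd[OF y(1)]
        have yu: "y \<noteq> u" using ry(3) wp by blast
        have nly: "\<not> leaf y" using par_less(2)[OF fo y(2) yu] unfolding leaf_def by blast
        have "\<not> act w"
        proof
          assume a: "act w"
          then have "cl w = 0" by (simp add: act_def cl_def)
          moreover have "u \<in> N w \<inter> B" using w u N_sym by blast
          ultimately show False using a True by (auto simp: act_def)
        qed
        then have cyw: "c {y, w} = 3 + (cl y + 1) mod 3" using c_par_nonleaf[OF y(1)] nly by (auto simp: O1_def)
        have cwy: "c {w, y} = 3 + (cl u + 2) mod 3" using cyw ry(7) True cl3(2)[of u] by (auto simp: insert_commute)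
        have "c {u, w} \<noteq> c {w, y}" unfolding cuw cwy using cl3(2)[of u] by auto
        then have "A u (insert (c {u, w}) (insert (c {w, y}) {cl y}))"
          by (rule A_two[OF u(1) w(2) ry(1) w(1) ry(6)])
        then have "A u (insert ((cl u + 1) mod 3) ((+) 3 ` {cl u, (cl u + 2) mod 3}))"
          using cuw cwy ry(7) True by (simp add: insert_commute)
        then have "good u {cl u, (cl u + 2) mod 3} {(cl u + 1) mod 3}"
          unfolding good_def using AT cl3(2)[of u] lf by auto
        then show ?thesis by blast
      qed
    next
      case True
      have d4: "4 \<le> d u" using O1_depth True .
      \<comment> \<open>The recoloured parent edge begins the walk over the grandparent, ending with
        class \<open>cl u + 1\<close>; the other ancestor \<open>w0\<close> keeps its default edge
        colour and supplies class \<open>cl u + 2\<close>.\<close>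
      have cup: "c {u, p u} = 3 + (cl u + 2) mod 3" using c_O1[OF True] rp(8) by simp
      have ppR: "(p (p u), p u) \<in> R" using Rp[of "p u"] rp(2,4) d4 by simp
      have "\<not> act (p (p u))" using Rd(4)[OF ppR] rp(4) d4 by (auto simp: act_def)
      moreover have "\<not> O1 (p u)" using R_not_leaf[OF pu] by (simp add: O1_def)
      ultimately have cpp: "c {p u, p (p u)} = 3 + (cl (p u) + 1) mod 3" using c_par_nonleaf[OF ppR] by blast
      have cpp': "c {p u, p (p u)} = 3 + cl u" using cpp rp(8) cl3(2)[of u] by auto
      have clpp: "cl (p (p u)) = (cl u + 1) mod 3" using Rd(8)[OF ppR] rp(8) cl3(2)[of u] by auto
      have "c {u, p u} \<noteq> c {p u, p (p u)}" unfolding cup cpp' using cl3(2)[of u] by auto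
      then have "A u (insert (c {u, p u}) (insert (c {p u, p (p u)}) {cl (p (p u))}))"
        by (rule A_two[OF rp(1,2) Rd(2)[OF ppR] rp(5) Rd(5)[OF ppR]])
      then have AS: "A u (insert ((cl u + 1) mod 3) ((+) 3 ` {cl u, (cl u + 2) mod 3}))"
        using cup cpp' clpp by (simp add: insert_commute)
      have cw0: "cl w0 = (cl u + 2) mod 3" using True w0 by (auto simp: O1_def)
      have cuw: "c {u, w0} = 3 + (cl u + 1) mod 3" using ce[OF w0] cw0 cl3(2)[of u] by (elim disjE) simp_all
      have "A u (insert (c {u, w0}) {cl w0})" by (rule A_own[OF u(1) w0(2,1)])
      then have "A u (insert ((cl u + 2) mod 3) ((+) 3 ` {(cl u + 1) mod 3}))"
        using cuw cw0 by (simp add: insert_commute)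
      then have "good u {cl u, (cl u + 2) mod 3} {(cl u + 1) mod 3}"
        unfolding good_def using AS cl3(2)[of u] lf by auto
      then show ?thesis by blast
    qed
  qed
qed

text \<open>Without a parent, class 2 must come from elsewhere: from a second edge to
  \<open>D\<close>, from a neighbour of class 2, from the parent of a neighbour of class 0, or, for
  an exceptional root, over the recoloured edge to \<open>ch u\<close>.\<close>

lemma good_root:
  assumes u: "u \<in> B" "d u = 0"
  shows "\<exists>S T. good u S T"
proof -
  have cu: "cl u = 0" using u by (simp add: cl_def)
  show ?thesis
  proof (cases "leaf u")
    case True
    have "N u \<inter> B = {}" using leaf_nbr(4)[OF u(1) True] u(2) by auto
    then have "N u \<inter> (D \<union> B) = N u \<inter> D" by blast
    then have c3: "3 \<le> card (N u \<inter> D)" using deg3[OF u(1)] by simp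
    then have "two u" by (simp add: two_def)
    then have "good u {} {}" using second[OF u(1)] third[OF u(1) c3 u(2)] u cu by (simp add: good_def)
    then show ?thesis by blast
  next
    case nl: False
    define y where "y = ch u"
    have y: "(u, y) \<in> R" using chR(1)[OF nl] y_def by simp
    note ry = Rd[OF y]
    have cly: "cl y = 1" "d y = 1" using ry(7) cu ry(4) u by auto
    have nO: "\<not> O1 x" if "d x \<le> 3" for x using O1_depth that by fastforce
    have nOu: "\<not> O1 u" "\<not> O1 y" using nO u cly by auto
    have ay: "c {u, y} = 5" if "\<not> act u"
    proof -
      have "c {y, u} = 3 + (cl y + 1) mod 3" using c_par_nonleaf[OF y nOu(2)] that by blast
      then show ?thesis using cly by (simp add: insert_commute)
    qed
    have AS: "A u (insert 1 ((+) 3 ` {2}))" if "\<not> act u"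
    proof -
      have "A u (insert (c {u, y}) {cl y})" by (rule A_own[OF u(1) ry(1,6)])
      then show ?thesis using ay[OF that] cly by (simp add: insert_commute)
    qed
    have nb: "(u, w) \<in> R\<^sup>*" "0 < d w" if "w \<in> N u" "w \<in> B" for w
    proof -
      show 1: "(u, w) \<in> R\<^sup>*" using normal u that by simp
      have "u \<noteq> w" using that N_irrefl by blast
      then show "0 < d w" using par_less[OF fo 1] by simp
    qed
    have ce: "c {u, w} = 3 + (2 * cl w) mod 3" if w: "w \<in> N u" "w \<in> B" "\<not> (act u \<and> w = ch u)" for w
    proof -
      have "c {u, w} = 3 + (2 * (cl u + cl w)) mod 3"
      proof (rule c_default)
        show "\<not> (act w \<and> u = ch w)" using nb[OF w(1,2)] by (auto simp: act_def)
        show "\<not> (O1 w \<and> u = p w)"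
        proof
          assume a: "O1 w \<and> u = p w"
          then have "d w = 1" using nb[OF w(1,2)] Rd(4)[OF Rp[OF w(2)]] u by simp
          then show False using nO a by simp
        qed
        show "\<not> (O1 u \<and> w = p u)" using nOu by blast
      qed (use u w in auto)
      then show ?thesis using cu by simp
    qed
    show ?thesis
    proof (cases "two u")
      case True
      then have "\<not> act u" by (simp add: act_def)
      then have "good u {2} {}" using AS second[OF u(1) True] u cu by (simp add: good_def insert_commute)
      then show ?thesis by blast
    next
      case False
      show ?thesis
      proof (cases "act u")
        case True
        obtain b where b: "b \<in> N u" "b \<in> B" "b \<noteq> ch u" using many_nbrs[OF u(1) False] by blast
        have clb: "cl b = 1" using True b by (simp add: act_def)
        have cub: "c {u, b} = 5" using ce[OF b(1,2)] b(3) clb by simp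
        have "A u (insert (c {u, b}) {cl b})" by (rule A_own[OF u(1) b(2,1)])
        then have AS': "A u (insert 1 ((+) 3 ` {2}))" using cub clb by (simp add: insert_commute)
        have cuy: "c {u, y} = 4" using c_act[OF True] y_def by simp
        have "\<exists>T. A u (insert 2 ((+) 3 ` T)) \<and> T \<subseteq> {0, 1}"
        proof (cases "leaf y")
          case True
          \<comment> \<open>A leaf of depth 1 has only \<open>u\<close> as a neighbour in
            \<open>B\<close>; its second edge to \<open>D\<close> then has class 2.\<close>
          have "two y"
          proof (rule ccontr)
            assume "\<not> two y"
            then obtain w where w: "w \<in> N y" "w \<in> B" "w \<noteq> p y" using many_nbrs[OF ry(1)] by blast
            note l = leaf_nbr[OF ry(1) True w(1,2)]
            have "d w = 0" using l(1) cly by simp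
            moreover have "(w, p y) \<in> R\<^sup>*" using par_less(3)[OF fo l(2)] l(1) by blast
            ultimately show False using par_less(1)[OF fo, of w "p y"] w(3) ry(3) u(2) by simp
          qed
          then have "A y {2}" using second[OF ry(1)] cly by (simp add: numeral_2_eq_2)
          then have "A u (insert (c {u, y}) {2})" by (intro A_step u(1) ry(6)) (simp_all add: cuy)
          then show ?thesis using cuy by (intro exI[of _ "{1}"]) (simp add: insert_commute)
        next
          case False
          define z where "z = ch y"
          have z: "(y, z) \<in> R" using chR(1)[OF False] z_def by simp
          note rz = Rd[OF z]
          have clz: "cl z = 2" "d z = 2" using rz(7) cly rz(4) by auto
          have "\<not> act y" using cly by (simp add: act_def)
          then have "c {z, y} = 3 + (cl z + 1) mod 3" using c_par_nonleaf[OF z] nO[of z] clz by simp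
          then have cyz: "c {y, z} = 3" using clz by (simp add: insert_commute)
          have "A u (insert (c {u, y}) (insert (c {y, z}) {cl z}))"
            by (rule A_two[OF u(1) ry(1) rz(1) ry(6) rz(6)]) (simp add: cuy cyz)
          then show ?thesis using cuy cyz clz by (intro exI[of _ "{0, 1}"]) (simp add: insert_commute)
        qed
        then obtain T where T: "A u (insert 2 ((+) 3 ` T))" "T \<subseteq> {0, 1}" by blast
        then have "good u {2} T" unfolding good_def using AS' cu u by (auto simp del: add_2_eq_Suc')
        then show ?thesis by blast
      next
        case na: False
        have AS': "A u (insert 1 ((+) 3 ` {2}))" using AS na by blast
        obtain b where b: "b \<in> N u" "b \<in> B" "cl b \<noteq> 1" using na False u nl by (auto simp: act_def)
        have nbb: "0 < d b" using nb b by blast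
        show ?thesis
        proof (cases "cl b = 2")
          case True
          have cub: "c {u, b} = 4" using ce[OF b(1,2)] na True by simp
          have "A u (insert (c {u, b}) {cl b})" by (rule A_own[OF u(1) b(2,1)])
          then have "A u (insert 2 ((+) 3 ` {1}))" using cub True by (simp add: insert_commute)
          then have "good u {2} {1}" unfolding good_def using AS' cu u by (auto simp del: add_2_eq_Suc')
          then show ?thesis by blast
        next
          case False
          then have clb: "cl b = 0" using b(3) cl3(2)[of b] by auto
          have cub: "c {u, b} = 3" using ce[OF b(1,2)] na clb by simp
          have pb: "(p b, b) \<in> R" using Rp b nbb by blast
          note rb = Rd[OF pb]
          have clpb: "cl (p b) = 2" using rb(8) clb by simp
          have "\<not> O1 b"
          proof
            assume "O1 b"
            moreover have "u \<in> N b \<inter> B" using b u N_sym by blast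
            ultimately have "cl u = (cl b + 2) mod 3" unfolding O1_def by blast
            then show False using cu clb by simp
          qed
          moreover have "\<not> act (p b)" using clpb by (auto simp: act_def cl_def)
          ultimately have cbp: "c {b, p b} = 4" using c_par_nonleaf[OF pb] clb by simp
          have "A u (insert (c {u, b}) (insert (c {b, p b}) {cl (p b)}))"
            by (rule A_two[OF u(1) b(2) rb(2) b(1) rb(5)]) (simp add: cub cbp)
          then have "A u (insert 2 ((+) 3 ` {0, 1}))" using cub cbp clpb by (simp add: insert_commute)
          then have "good u {2} {0, 1}" unfolding good_def using AS' cu u by (auto simp del: add_2_eq_Suc')
          then show ?thesis by blast
        qed
      qed
    qed
  qed
qed

lemma good_ex: "u \<in> B \<Longrightarrow> \<exists>S T. good u S T"
  using good_internal good_leaf good_root by (cases "d u = 0"; cases "leaf u") auto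

text \<open>By normality, adjacent vertices of one class lie on one branch, at least three levels
  apart. The upper one has a child that is not a leaf, so \<open>S\<close> avoids its class; the
  lower one has depth above 1, so \<open>T'\<close> avoids it.\<close>

lemma good_adj:
  assumes u: "u \<in> B" "w \<in> B" "w \<in> N u" "cl u = cl w" "good u S T" "good w S' T'"
  shows "\<not> (cl u \<in> S \<and> cl u \<in> S')" "\<not> (cl u \<in> T \<and> cl u \<in> T')"
proof -
  have *: "\<not> (cl u \<in> S \<and> cl u \<in> S') \<and> \<not> (cl u \<in> T \<and> cl u \<in> T')"
    if u: "u \<in> B" "w \<in> B" "w \<in> N u" "cl u = cl w" "good u S T" "good w S' T'" and le: "d u \<le> d w" for u w S T S' T'
  proof -
    have r: "(u, w) \<in> R\<^sup>*" using normal u le by blast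
    have ne: "u \<noteq> w" using u N_irrefl by blast
    have "d u < d w" using par_less(1)[OF fo r ne] .
    then have d3: "d u + 3 \<le> d w" using u(4) unfolding cl_def by presburger
    obtain z where z: "(u, z) \<in> R" "(z, w) \<in> R\<^sup>*" using par_less(2)[OF fo r ne] by blast
    have "z \<noteq> w" using Rd(4)[OF z(1)] d3 by auto
    then have "\<not> leaf z" using par_less(2)[OF fo z(2)] unfolding leaf_def by blast
    then have "cl u \<notin> S" using u(5) z(1) unfolding good_def by blast
    moreover have "cl w \<notin> T'" using u(6) d3 unfolding good_def by auto
    ultimately show ?thesis using u(4) by simp
  qed
  have "w \<in> N u \<Longrightarrow> u \<in> N w" using N_sym by blast
  then have "\<not> (cl u \<in> S \<and> cl u \<in> S') \<and> \<not> (cl u \<in> T \<and> cl u \<in> T')"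
    using *[of u w S T S' T'] *[of w u S' T' S T] u by (cases "d u \<le> d w") auto
  then show "\<not> (cl u \<in> S \<and> cl u \<in> S')" "\<not> (cl u \<in> T \<and> cl u \<in> T')" by auto
qed

end

context fin_graph
begin

text \<open>Colours 0, 1, 2 are meant for the edges to \<open>D\<close> and colours 3, 4, 5 for the edges inside \<open>B\<close>.
  A vertex \<open>u\<close> reaches \<open>D\<close> directly with colour \<open>k u\<close>, and with final colour \<open>j\<close> at the price
  of the colours in \<open>3 + X u j\<close>, where colour \<open>3 + j\<close> is never needed. The last clause says that two adjacent
  vertices of the same class \<open>i\<close> do not need the colour \<open>3 + i\<close> for the same purpose.\<close>

definition six :: "('a set \<Rightarrow> nat) \<Rightarrow> 'a set \<Rightarrow> 'a set \<Rightarrow> ('a \<Rightarrow> nat) \<Rightarrow> ('a \<Rightarrow> nat \<Rightarrow> nat set) \<Rightarrow> bool" where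
  "six c D B k X \<longleftrightarrow> (\<forall>u\<in>B. k u < 3 \<and> X u (k u) = {} \<and>
      (\<forall>j<3. att c D B u (insert j ((+) 3 ` X u j)) \<and> X u j \<subseteq> {0, 1, 2} - {j}) \<and>
      (\<forall>i<3. \<forall>j<3. i \<noteq> j \<longrightarrow> X u i \<inter> X u j = {})) \<and>
    (\<forall>u\<in>B. \<forall>w\<in>B. w \<in> N u \<longrightarrow> k u = k w \<longrightarrow> (\<forall>j<3. \<not> (k u \<in> X u j \<and> k u \<in> X w j)))"

lemma six_exists:
  assumes "finite B" "B \<inter> D = {}" "\<And>u. u \<in> B \<Longrightarrow> N u \<inter> D \<noteq> {}"
    "\<And>u. u \<in> B \<Longrightarrow> 3 \<le> card (N u \<inter> (D \<union> B))"
  obtains c k X where "six c D B k X" "\<And>e. c e < 6"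
proof -
  obtain p d where pd: "forest B p d"
    "\<And>x w. x \<in> B \<Longrightarrow> w \<in> B \<Longrightarrow> w \<in> N x \<Longrightarrow> d x \<le> d w \<Longrightarrow> (x, w) \<in> (par B p d)\<^sup>*"
    using normal_forest[OF assms(1)] by blast
  interpret coloured_forest G D B p d
    by unfold_locales (use assms pd in auto)
  have "\<forall>u\<in>B. \<exists>S T. good u S T" using good_ex by blast
  then obtain S T where ST: "\<And>u. u \<in> B \<Longrightarrow> good u (S u) (T u)" by metis
  define X where "X = (\<lambda>u j. if j = (cl u + 1) mod 3 then S u else if j = (cl u + 2) mod 3 then T u else {})"
  have j3: "j = cl u \<or> j = (cl u + 1) mod 3 \<or> j = (cl u + 2) mod 3" if "j < 3" for u j
    using that cl3(2)[of u] by auto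
  have dist: "cl u \<noteq> (cl u + 1) mod 3" "cl u \<noteq> (cl u + 2) mod 3" "(cl u + 1) mod 3 \<noteq> (cl u + 2) mod 3" for u
    using cl3(2)[of u] by auto
  have X: "X u (cl u) = {}" "X u ((cl u + 1) mod 3) = S u" "X u ((cl u + 2) mod 3) = T u" for u
    using dist[of u] by (auto simp: X_def)
  have "six c D B cl X"
    unfolding six_def
  proof (intro conjI ballI allI impI)
    fix u j assume u: "u \<in> B" and j: "j < (3::nat)"
    note g = ST[OF u, unfolded good_def]
    show "att c D B u (insert j ((+) 3 ` X u j))"
      using j3[OF j, of u] X[of u] own[OF u] g by (elim disjE) auto
    show "X u j \<subseteq> {0, 1, 2} - {j}"
      using j3[OF j, of u] X[of u] g cl3(2)[of u] by (elim disjE) auto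
    fix i assume i: "i < (3::nat)" and ij: "i \<noteq> j"
    have "S u \<inter> T u = {}" "T u \<inter> S u = {}" using g by blast+
    then show "X u i \<inter> X u j = {}"
      using j3[OF j, of u] j3[OF i, of u] X[of u] ij by (elim disjE) auto
  next
    fix u w j assume u: "u \<in> B" "w \<in> B" "w \<in> N u" "cl u = cl w" "j < (3::nat)"
    have a: "\<not> (cl u \<in> S u \<and> cl u \<in> S w)" "\<not> (cl u \<in> T u \<and> cl u \<in> T w)"
      using good_adj[OF u(1-4) ST[OF u(1)] ST[OF u(2)]] .
    show "\<not> (cl u \<in> X u j \<and> cl u \<in> X w j)"
      using j3[OF u(5), of u] X[of u] X[of w] u(4) a by (elim disjE) auto
  qed (simp_all add: cl3 X)
  then show ?thesis using that c6 by blast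
qed

lemma sixD:
  assumes "six c D B k X" "u \<in> B"
  shows "k u < 3" "X u (k u) = {}" "\<And>j. j < 3 \<Longrightarrow> att c D B u (insert j ((+) 3 ` X u j))"
    "\<And>j. j < 3 \<Longrightarrow> X u j \<subseteq> {0, 1, 2} - {j}" "\<And>i j. i < 3 \<Longrightarrow> j < 3 \<Longrightarrow> i \<noteq> j \<Longrightarrow> X u i \<inter> X u j = {}"
    "\<And>w j. w \<in> B \<Longrightarrow> w \<in> N u \<Longrightarrow> k u = k w \<Longrightarrow> j < 3 \<Longrightarrow> \<not> (k u \<in> X u j \<and> k u \<in> X w j)"
  using assms unfolding six_def by blast+

section \<open>Serving triples with six colours\<close>

lemma six_cong:
  assumes "six c D B k X" "\<And>e. e \<subseteq> B \<union> D \<Longrightarrow> c e = c' e"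
  shows "six c' D B k X"
proof -
  have "att c' D B u C" if "att c D B u C" for u C
    by (rule att_cong[OF that subset_refl]) (use assms(2) in auto)
  then show ?thesis
    unfolding six_def
  proof (intro conjI ballI allI impI)
    fix u w j assume "u \<in> B" "w \<in> B" "w \<in> N u" "k u = k w" "j < (3 :: nat)"
    then show "\<not> (k u \<in> X u j \<and> k u \<in> X w j)" by (rule sixD(6)[OF assms(1)])
  qed (use sixD(1-5)[OF assms(1)] in simp_all)
qed

lemma six_att:
  assumes "six c D B k X" "B \<subseteq> V" "u \<in> B" "j < 3" shows "att c D V u (insert j ((+) 3 ` X u j))"
  by (rule att_cong[OF sixD(3)[OF assms(1,3,4)] assms(2)]) simp

lemma att_ext:
  assumes "c {z, w} = t" "z \<in> P" "z \<notin> D" "w \<in> N z" "att c D P w C" "t \<notin> C"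
  shows "att c D P z (insert t C)"
  using att.ext[OF assms(2-5)] assms(1,6) by simp

lemma other_colours: assumes "i < (3::nat)" obtains j l where "j < 3" "l < 3" "i \<noteq> j" "i \<noteq> l" "j \<noteq> l"
proof -
  have "i = 0 \<or> i = 1 \<or> i = 2" using assms by auto
  then show ?thesis using that[of 1 2] that[of 0 2] that[of 0 1] by (elim disjE) simp_all
qed

lemma other_colour: assumes "i < (3::nat)" "j < 3" "i \<noteq> j" obtains l where "l < 3" "i \<noteq> l" "j \<noteq> l"
proof -
  have "i = 0 \<or> i = 1 \<or> i = 2" "j = 0 \<or> j = 1 \<or> j = 2" using assms by auto
  then show ?thesis using that[of 0] that[of 1] that[of 2] assms(3) by (elim disjE) simp_all
qed

lemma three_colours:
  assumes "a < (3::nat)"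
  obtains i j where "i < 3" "j < 3" "i \<noteq> a" "j \<noteq> a" "i \<noteq> j" "{0, 1, 2} = {a, i, j}"
proof -
  have e: "{0, 1, 2} = {1, 0, 2::nat}" "{0, 1, 2} = {2, 0, 1::nat}" by auto
  have "a = 0 \<or> a = 1 \<or> a = 2" using assms by auto
  then show ?thesis using that[of 1 2] that[of 0 2] that[of 0 1] e by (elim disjE) simp_all
qed

lemma low_high: "A \<subseteq> {..<6} \<Longrightarrow> S \<subseteq> {6..} \<Longrightarrow> A \<inter> S = {}" for A S :: "nat set"
  by force

text \<open>Here \<open>a\<close> is the colour already spent by a third vertex. If \<open>y\<close>
  or \<open>z\<close> has one of the other two classes, it ends there for free. If both have class
  \<open>a\<close>, then \<open>X y i\<close> and \<open>X z j\<close> can share only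
  \<open>a\<close>; as \<open>X y i\<close> and \<open>X y j\<close> are disjoint, one of the two
  ways to distribute \<open>i\<close> and \<open>j\<close> avoids it.\<close>

lemma six_pair:
  assumes s: "six c D B k X" and y: "y \<in> B" and z: "z \<in> B" and a: "a < 3"
  obtains i j where "i < 3" "j < 3" "i \<noteq> a" "j \<noteq> a" "i \<noteq> j" "X y i \<inter> X z j = {}"
proof -
  obtain i j where ij: "i < 3" "j < 3" "i \<noteq> a" "j \<noteq> a" "i \<noteq> j" "{0, 1, 2} = {a, i, j}"
    using three_colours[OF a] .
  have third: "k u = a \<or> k u = i \<or> k u = j" if "u \<in> B" for u
  proof -
    have "k u \<in> {0, 1, 2}" using sixD(1)[OF s that] by auto
    then show ?thesis unfolding ij(6) by auto
  qed
  note sy = sixD[OF s y] and sz = sixD[OF s z]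
  consider "k y = i \<or> k z = j" | "k y = j \<or> k z = i" | "k y = a" "k z = a" using third y z by blast
  then show ?thesis
  proof cases
    case 1
    then show ?thesis using that[of i j] ij sy(2) sz(2) by auto
  next
    case 2
    then show ?thesis using that[of j i] ij sy(2) sz(2) by auto
  next
    case 3
    have y4: "X y i \<subseteq> {a, j}" "X y j \<subseteq> {a, i}" using sy(4)[OF ij(1)] sy(4)[OF ij(2)] unfolding ij(6) by auto
    have z4: "X z i \<subseteq> {a, j}" "X z j \<subseteq> {a, i}" using sz(4)[OF ij(1)] sz(4)[OF ij(2)] unfolding ij(6) by auto
    have "X y i \<inter> X y j = {}" "X z i \<inter> X z j = {}" using sy(5) sz(5) ij by auto
    moreover have "X y i \<inter> X z j \<subseteq> {a}" "X y j \<inter> X z i \<subseteq> {a}" using y4 z4 ij(5) by blast+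
    ultimately have "X y i \<inter> X z j = {} \<or> X y j \<inter> X z i = {}" by (cases "a \<in> X y i") blast+
    then show ?thesis
      using that[OF ij(1,2,3,4,5)] that[OF ij(2,1,4,3) not_sym[OF ij(5)]] by (elim disjE)
  qed
qed

text \<open>In a triple outside \<open>D\<close>, an \<open>own1\<close> vertex spends one colour below 3, a \<open>via\<close> vertex walks to some
  vertex of \<open>B\<close> and continues from there, and a \<open>flex\<close> vertex adapts to the colour \<open>a\<close> and the vertex \<open>y\<close>
  used by the other two.\<close>

definition own1 :: "('a set \<Rightarrow> nat) \<Rightarrow> 'a set \<Rightarrow> 'a \<Rightarrow> nat set \<Rightarrow> bool" where
  "own1 c D z S \<longleftrightarrow> (\<exists>a<3. att c D V z (insert a S))"

definition via :: "('a set \<Rightarrow> nat) \<Rightarrow> 'a set \<Rightarrow> 'a set \<Rightarrow> 'a \<Rightarrow> nat set \<Rightarrow> bool" where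
  "via c D B z S \<longleftrightarrow> (\<exists>u\<in>B. \<forall>C. att c D V u C \<longrightarrow> C \<inter> S = {} \<longrightarrow> att c D V z (S \<union> C))"

definition flex :: "('a set \<Rightarrow> nat) \<Rightarrow> 'a set \<Rightarrow> 'a set \<Rightarrow> 'a \<Rightarrow> bool" where
  "flex c D B z \<longleftrightarrow> (\<forall>a<3. \<forall>y\<in>B. \<exists>C C'. att c D V y C \<and> att c D V z C' \<and> C \<inter> C' = {} \<and>
     a \<notin> C \<and> a \<notin> C' \<and> C \<subseteq> {..<6} \<and> C' \<subseteq> {..<6})"

text \<open>The colours in \<open>S1\<close>, \<open>S2\<close>, \<open>S3\<close> are at least 6,
  so inside the six colours only the vertices of \<open>B\<close> where the walks continue matter,
  and \<open>six_pair\<close> serves these.\<close>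

lemma T3_via:
  assumes s: "six c D B k X" "B \<subseteq> V"
    and o: "own1 c D x S1" "S1 \<subseteq> {6..}" and v: "via c D B y S2" "S2 \<subseteq> {6..}" "via c D B z S3" "S3 \<subseteq> {6..}"
    and S: "S1 \<inter> S2 = {}" "S1 \<inter> S3 = {}" "S2 \<inter> S3 = {}"
  shows "T3 c D x y z"
proof -
  obtain a where a: "a < 3" "att c D V x (insert a S1)" using o by (auto simp: own1_def)
  obtain u where u: "u \<in> B" "\<And>C. att c D V u C \<Longrightarrow> C \<inter> S2 = {} \<Longrightarrow> att c D V y (S2 \<union> C)"
    using v(1) by (auto simp: via_def)
  obtain w where w: "w \<in> B" "\<And>C. att c D V w C \<Longrightarrow> C \<inter> S3 = {} \<Longrightarrow> att c D V z (S3 \<union> C)"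
    using v(3) by (auto simp: via_def)
  obtain i j where ij: "i < 3" "j < 3" "i \<noteq> a" "j \<noteq> a" "i \<noteq> j" "X u i \<inter> X w j = {}"
    using six_pair[OF s(1) u(1) w(1) a(1)] by blast
  have X: "X u i \<subseteq> {0, 1, 2}" "X w j \<subseteq> {0, 1, 2}" using sixD(4)[OF s(1)] u w ij by blast+
  have r: "insert i ((+) 3 ` X u i) \<subseteq> {..<6}" "insert j ((+) 3 ` X w j) \<subseteq> {..<6}" using X ij by auto
  define Ci Cj where "Ci = insert i ((+) 3 ` X u i)" and "Cj = insert j ((+) 3 ` X w j)"
  have ra: "{a} \<subseteq> {..<6}" using a(1) by simp
  note r' = r[folded Ci_def Cj_def]
  have d: "Ci \<inter> Cj = {}" "{a} \<inter> Ci = {}" "{a} \<inter> Cj = {}" using ij a by (auto simp: Ci_def Cj_def)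
  note lh = low_high[OF ra o(2)] low_high[OF ra v(2)] low_high[OF ra v(4)] low_high[OF r'(1) o(2)] low_high[OF r'(1) v(2)]
    low_high[OF r'(1) v(4)] low_high[OF r'(2) o(2)] low_high[OF r'(2) v(2)] low_high[OF r'(2) v(4)]
  have "att c D V y (S2 \<union> Ci)"
    using u(2)[OF six_att[OF s u(1) ij(1)]] lh(5) unfolding Ci_def .
  moreover have "att c D V z (S3 \<union> Cj)"
    using w(2)[OF six_att[OF s w(1) ij(2)]] lh(9) unfolding Cj_def .
  moreover have "insert a S1 \<inter> (S2 \<union> Ci) = {}" using d(2) lh(2,4) S(1) by blast
  moreover have "insert a S1 \<inter> (S3 \<union> Cj) = {}" using d(3) lh(3,7) S(2) by blast
  moreover have "(S2 \<union> Ci) \<inter> (S3 \<union> Cj) = {}" using d(1) lh(6,8) S(3) by blast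
  ultimately show ?thesis unfolding T3_def using a(2) by blast
qed

lemma T3_flex:
  assumes s: "six c D B k X" "B \<subseteq> V"
    and o: "own1 c D x S1" "S1 \<subseteq> {6..}" and v: "via c D B y S2" "S2 \<subseteq> {6..}" "flex c D B z"
    and S: "S1 \<inter> S2 = {}"
  shows "T3 c D x y z"
proof -
  obtain a where a: "a < 3" "att c D V x (insert a S1)" using o by (auto simp: own1_def)
  obtain u where u: "u \<in> B" "\<And>C. att c D V u C \<Longrightarrow> C \<inter> S2 = {} \<Longrightarrow> att c D V y (S2 \<union> C)"
    using v(1) by (auto simp: via_def)
  obtain C C' where C: "att c D V u C" "att c D V z C'" "C \<inter> C' = {}" "a \<notin> C" "a \<notin> C'" "C \<subseteq> {..<6}" "C' \<subseteq> {..<6}"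
    using v(3) a(1) u(1) unfolding flex_def by blast
  have ra: "{a} \<subseteq> {..<6}" using a(1) by simp
  note lh = low_high[OF C(6) o(2)] low_high[OF C(6) v(2)] low_high[OF C(7) o(2)] low_high[OF C(7) v(2)] low_high[OF ra v(2)]
  have "att c D V y (S2 \<union> C)" by (rule u(2)[OF C(1) lh(2)])
  moreover have "insert a S1 \<inter> (S2 \<union> C) = {}" using C(4) lh(1,5) S by blast
  moreover have "insert a S1 \<inter> C' = {}" using C(5) lh(3) by blast
  moreover have "(S2 \<union> C) \<inter> C' = {}" using C(3) lh(4) by blast
  ultimately show ?thesis unfolding T3_def using a(2) C(2) by blast
qed

lemma own1_B: "six c D B k X \<Longrightarrow> B \<subseteq> V \<Longrightarrow> z \<in> B \<Longrightarrow> own1 c D z {}"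
  unfolding own1_def using six_att sixD(1,2) by fastforce

lemma via_B: "z \<in> B \<Longrightarrow> via c D B z {}" unfolding via_def by auto

lemma own1_step:
  assumes "z \<in> V - D" "u \<in> N z" "own1 c D u S" "c {z, u} = t" "t \<notin> S" "3 \<le> t"
  shows "own1 c D z (insert t S)"
proof -
  obtain a where a: "a < 3" "att c D V u (insert a S)" using assms(3) by (auto simp: own1_def)
  have "att c D V z (insert t (insert a S))" by (rule att_ext[where w = u]) (use assms a in auto)
  then show ?thesis using a(1) unfolding own1_def by (metis insert_commute)
qed

lemma via_step:
  assumes "z \<in> V - D" "u \<in> N z" "via c D B u S" "c {z, u} = t" "t \<notin> S"
  shows "via c D B z (insert t S)"
proof -
  obtain w where w: "w \<in> B" "\<And>C. att c D V w C \<Longrightarrow> C \<inter> S = {} \<Longrightarrow> att c D V u (S \<union> C)"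
    using assms(3) by (auto simp: via_def)
  have "att c D V z (insert t S \<union> C)" if C: "att c D V w C" "C \<inter> insert t S = {}" for C
  proof -
    have a: "att c D V u (S \<union> C)" using w(2) C by blast
    have "att c D V z (insert t (S \<union> C))" by (rule att_ext[where w = u]) (use assms C(2) a in auto)
    then show ?thesis by simp
  qed
  then show ?thesis unfolding via_def using w(1) by blast
qed

text \<open>The counterpart of \<open>X\<close> for a vertex that may lie outside \<open>B\<close>.
  In contrast to \<open>X\<close>, the set \<open>Y\<close> may contain \<open>t\<close>
  itself.\<close>

definition reach :: "('a set \<Rightarrow> nat) \<Rightarrow> 'a set \<Rightarrow> 'a \<Rightarrow> nat \<Rightarrow> nat set \<Rightarrow> bool" where
  "reach c D z t Y \<longleftrightarrow> att c D V z (insert t ((+) 3 ` Y)) \<and> Y \<subseteq> {0, 1, 2}"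

lemma reach_own:
  assumes "z \<in> V - D" "u \<in> N z" "att c D V u {t}" "t < 3" "c {z, u} = 3 + e" "e < 3"
  shows "reach c D z t {e}"
proof -
  have "att c D V z (insert (3 + e) {t})" by (rule att_ext[where w = u]) (use assms in auto)
  then show ?thesis using assms by (auto simp: reach_def insert_commute)
qed

lemma reach_via:
  assumes "six c D B k X" "B \<subseteq> V" "z \<in> V - D" "u \<in> N z" "u \<in> B" "t < 3" "c {z, u} = 3 + e" "e < 3" "e \<notin> X u t"
  shows "reach c D z t (insert e (X u t))"
proof -
  have a: "att c D V u (insert t ((+) 3 ` X u t))" by (rule six_att[OF assms(1,2,5,6)])
  have "att c D V z (insert (3 + e) (insert t ((+) 3 ` X u t)))"
    by (rule att_ext[where w = u]) (use assms a in auto)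
  moreover have "X u t \<subseteq> {0, 1, 2}" using sixD(4)[OF assms(1,5,6)] by blast
  ultimately show ?thesis using assms(8) by (auto simp: reach_def insert_commute)
qed

text \<open>If the class of \<open>y\<close> is not \<open>a\<close>, then \<open>y\<close> goes
  directly and any way of \<open>z\<close> to end with the third colour will do. If it is
  \<open>a\<close>, the first alternative lets \<open>z\<close> spend at most \<open>3 + s\<close>
  for the third index \<open>s\<close>, while \<open>y\<close> ends with \<open>s\<close> and never
  needs \<open>3 + s\<close>; the second alternative is the exchange argument of
  \<open>six_pair\<close>.\<close>

lemma flexI:
  assumes s: "six c D B k X" "B \<subseteq> V"
    and all: "\<And>t. t < 3 \<Longrightarrow> \<exists>Y. reach c D z t Y"
    and cond: "\<And>a. a < 3 \<Longrightarrow> (\<exists>t<3. t \<noteq> a \<and> (\<exists>Y. reach c D z t Y \<and> Y \<inter> {a, t} = {})) \<or>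
       (\<forall>t<3. t \<noteq> a \<longrightarrow> (\<exists>Y. reach c D z t Y \<and> t \<notin> Y))"
  shows "flex c D B z"
  unfolding flex_def
proof (intro allI impI ballI)
  fix a y assume a: "a < (3::nat)" and y: "y \<in> B"
  note sy = sixD[OF s(1) y]
  have fin: "\<exists>C C'. att c D V y C \<and> att c D V z C' \<and> C \<inter> C' = {} \<and> a \<notin> C \<and> a \<notin> C' \<and> C \<subseteq> {..<6} \<and> C' \<subseteq> {..<6}"
    if h: "i < 3" "t < 3" "i \<noteq> a" "t \<noteq> a" "i \<noteq> t" "reach c D z t Y" "X y i \<inter> Y = {}" for i t Y
  proof (intro exI conjI)
    show "att c D V y (insert i ((+) 3 ` X y i))" by (rule six_att[OF s y h(1)])
    show "att c D V z (insert t ((+) 3 ` Y))" using h(6) by (simp add: reach_def)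
    show "insert i ((+) 3 ` X y i) \<inter> insert t ((+) 3 ` Y) = {}" using h by auto
    show "a \<notin> insert i ((+) 3 ` X y i)" "a \<notin> insert t ((+) 3 ` Y)" using h a by auto
    show "insert i ((+) 3 ` X y i) \<subseteq> {..<6}" using sy(4)[OF h(1)] h(1) by auto
    show "insert t ((+) 3 ` Y) \<subseteq> {..<6}" using h(2,6) by (auto simp: reach_def)
  qed
  show "\<exists>C C'. att c D V y C \<and> att c D V z C' \<and> C \<inter> C' = {} \<and> a \<notin> C \<and> a \<notin> C' \<and> C \<subseteq> {..<6} \<and> C' \<subseteq> {..<6}"
  proof (cases "k y = a")
    case False
    obtain t where t: "t < 3" "t \<noteq> a" "t \<noteq> k y" using other_colour[OF a sy(1)] False by metis
    obtain Y where "reach c D z t Y" using all t by blast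
    then show ?thesis using fin[of "k y" t Y] t False sy(1,2) by auto
  next
    case True
    obtain i j where ij: "i < 3" "j < 3" "i \<noteq> a" "j \<noteq> a" "i \<noteq> j" "{0, 1, 2} = {a, i, j}"
      using three_colours[OF a] .
    have Yij: "Y \<subseteq> {a, i, j}" if "reach c D z t Y" for t Y using that ij(6) by (auto simp: reach_def)
    have y4: "X y i \<subseteq> {a, j}" "X y j \<subseteq> {a, i}" using sy(4)[OF ij(1)] sy(4)[OF ij(2)] unfolding ij(6) by auto
    have dj: "X y i \<inter> X y j = {}" using sy(5) ij by auto
    consider t Y where "t < 3" "t \<noteq> a" "reach c D z t Y" "Y \<inter> {a, t} = {}"
      | "\<forall>t<3. t \<noteq> a \<longrightarrow> (\<exists>Y. reach c D z t Y \<and> t \<notin> Y)" using cond[OF a] by blast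
    then show ?thesis
    proof cases
      case 1
      have "t \<in> {0, 1, 2}" using 1(1) by auto
      then have "t = i \<or> t = j" using 1(2) unfolding ij(6) by auto
      then show ?thesis
      proof
        assume "t = i"
        moreover have "X y j \<inter> Y = {}" using 1(4) y4 Yij[OF 1(3)] \<open>t = i\<close> by blast
        ultimately show ?thesis using fin[of j i Y] ij 1 by blast
      next
        assume "t = j"
        moreover have "X y i \<inter> Y = {}" using 1(4) y4 Yij[OF 1(3)] \<open>t = j\<close> by blast
        ultimately show ?thesis using fin[of i j Y] ij 1 by blast
      qed
    next
      case 2
      obtain Yi where Yi: "reach c D z i Yi" "i \<notin> Yi" using 2 ij by blast
      obtain Yj where Yj: "reach c D z j Yj" "j \<notin> Yj" using 2 ij by blast
      show ?thesis
      proof (cases "a \<in> X y i")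
        case True
        then have "X y j \<inter> Yi = {}" using y4 dj Yi by blast
        then show ?thesis using fin[of j i Yi] ij Yi by blast
      next
        case False
        then have "X y i \<inter> Yj = {}" using y4 Yj by blast
        then show ?thesis using fin[of i j Yj] ij Yj by blast
      qed
    qed
  qed
qed

text \<open>The edge colours are arranged so that for every \<open>a\<close> some neighbour ends
  with a class \<open>t\<close> other than \<open>a\<close>, over an edge whose index is neither
  \<open>a\<close> nor \<open>t\<close>. Only \<open>u'\<close> has to lie in \<open>B\<close>, so
  \<open>u\<close> or \<open>w\<close> may be a vertex attached separately.\<close>

lemma flex_mixed:
  assumes s: "six c D B k X" "B \<subseteq> V" and z: "z \<in> V - D"
    and n: "u \<in> N z" "u' \<in> N z" "w \<in> N z" and u': "u' \<in> B" "k u' = i"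
    and own: "att c D V u {i}" "att c D V w {j}"
    and ijl: "i < 3" "j < 3" "l < 3" "i \<noteq> j" "i \<noteq> l" "j \<noteq> l"
    and col: "c {z, u} = 3 + j" "c {z, u'} = 3 + l" "c {z, w} = 3 + l"
  shows "flex c D B z"
proof -
  have 1: "reach c D z i {j}" by (rule reach_own[OF z n(1) own(1) ijl(1) col(1) ijl(2)])
  have o': "att c D V u' {i}" using six_att[OF s u'(1) ijl(1)] sixD(2)[OF s(1) u'(1)] u'(2) by simp
  have 2: "reach c D z i {l}" by (rule reach_own[OF z n(2) o' ijl(1) col(2) ijl(3)])
  have 3: "reach c D z j {l}" by (rule reach_own[OF z n(3) own(2) ijl(2) col(3) ijl(3)])
  have "l \<notin> X u' l" using sixD(4)[OF s(1) u'(1) ijl(3)] by blast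
  then have 4: "reach c D z l (insert l (X u' l))" by (rule reach_via[OF s z n(2) u'(1) ijl(3) col(2) ijl(3)])
  have t: "t = i \<or> t = j \<or> t = l" if "t < 3" for t using that ijl by arith
  show ?thesis
  proof (rule flexI[OF s])
    fix t :: nat assume "t < 3"
    then show "\<exists>Y. reach c D z t Y" using 1 3 4 t by blast
  next
    fix a :: nat assume "a < 3"
    then have "\<exists>t<3. t \<noteq> a \<and> (\<exists>Y. reach c D z t Y \<and> Y \<inter> {a, t} = {})"
    proof (cases "a = l")
      case True
      then show ?thesis using 1 ijl by (intro exI[of _ i] conjI exI[of _ "{j}"]) auto
    next
      case False
      show ?thesis
      proof (cases "a = i")
        case True
        then show ?thesis using 3 ijl by (intro exI[of _ j] conjI exI[of _ "{l}"]) auto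
      next
        case False
        then have "a = j" using t \<open>a < 3\<close> \<open>a \<noteq> l\<close> by blast
        then show ?thesis using 2 ijl by (intro exI[of _ i] conjI exI[of _ "{l}"]) auto
      qed
    qed
    then show "(\<exists>t<3. t \<noteq> a \<and> (\<exists>Y. reach c D z t Y \<and> Y \<inter> {a, t} = {})) \<or>
       (\<forall>t<3. t \<noteq> a \<longrightarrow> (\<exists>Y. reach c D z t Y \<and> t \<notin> Y))" by blast
  qed
qed

text \<open>With all four neighbours in class \<open>i\<close>, the difficult case is
  \<open>a = i\<close>. This is where the last clause of \<open>six\<close> enters: for each other
  \<open>t\<close>, one of the adjacent \<open>u\<close>, \<open>u'\<close> ends with
  \<open>t\<close> without spending \<open>3 + i\<close>.\<close>

lemma flex_adjacent:
  assumes s: "six c D B k X" "B \<subseteq> V" and z: "z \<in> V - D"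
    and n: "u \<in> N z" "u' \<in> N z" "w \<in> N z" "w' \<in> N z" and B: "u \<in> B" "u' \<in> B" "w \<in> B" "w' \<in> B"
    and k: "k u = i" "k u' = i" "k w = i" "k w' = i" and adj: "u' \<in> N u"
    and ijl: "i < 3" "j < 3" "l < 3" "i \<noteq> j" "i \<noteq> l" "j \<noteq> l"
    and col: "c {z, u} = 3 + i" "c {z, u'} = 3 + i" "c {z, w} = 3 + j" "c {z, w'} = 3 + l"
  shows "flex c D B z"
proof -
  have own: "att c D V x {i}" if "x \<in> B" "k x = i" for x
    using six_att[OF s that(1) ijl(1)] sixD(2)[OF s(1) that(1)] that(2) by simp
  have 1: "reach c D z i {j}" by (rule reach_own[OF z n(3) own[OF B(3) k(3)] ijl(1) col(3) ijl(2)])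
  have 2: "reach c D z i {l}" by (rule reach_own[OF z n(4) own[OF B(4) k(4)] ijl(1) col(4) ijl(3)])
  have 3: "\<exists>Y. reach c D z t Y \<and> t \<notin> Y" if t: "t < 3" "t \<noteq> i" for t
  proof -
    have "\<not> (i \<in> X u t \<and> i \<in> X u' t)" using sixD(6)[OF s(1) B(1,2) adj _ t(1)] k by auto
    then obtain x where x: "x \<in> B" "x \<in> N z" "c {z, x} = 3 + i" "i \<notin> X x t" using B n col by blast
    have "reach c D z t (insert i (X x t))" by (rule reach_via[OF s z x(2,1) t(1) x(3) ijl(1) x(4)])
    moreover have "t \<notin> insert i (X x t)" using sixD(4)[OF s(1) x(1) t(1)] t(2) by blast
    ultimately show ?thesis by blast
  qed
  have t: "t = i \<or> t = j \<or> t = l" if "t < 3" for t using that ijl by arith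
  show ?thesis
  proof (rule flexI[OF s])
    fix t :: nat assume "t < 3"
    then show "\<exists>Y. reach c D z t Y" using 1 3 by blast
  next
    fix a :: nat assume a: "a < 3"
    show "(\<exists>t<3. t \<noteq> a \<and> (\<exists>Y. reach c D z t Y \<and> Y \<inter> {a, t} = {})) \<or>
       (\<forall>t<3. t \<noteq> a \<longrightarrow> (\<exists>Y. reach c D z t Y \<and> t \<notin> Y))"
    proof (cases "a = i")
      case True
      then show ?thesis using 3 by blast
    next
      case False
      have "\<exists>t<3. t \<noteq> a \<and> (\<exists>Y. reach c D z t Y \<and> Y \<inter> {a, t} = {})"
      proof (cases "a = j")
        case True
        then show ?thesis using 2 ijl by (intro exI[of _ i] conjI exI[of _ "{l}"]) auto
      next
        case aj: False
        then have "a = l" using t a False by blast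
        then show ?thesis using 1 ijl by (intro exI[of _ i] conjI exI[of _ "{j}"]) auto
      qed
      then show ?thesis by blast
    qed
  qed
qed

text \<open>Four vertices in three classes: if the classes are not all equal, two agree and a third
  differs from them. The edge colours are fixed before the final colouring exists, hence the
  quantification over \<open>c'\<close>.\<close>

lemma flex_four:
  assumes s: "six c D B k X" "B \<subseteq> V" and z: "z \<in> V - D"
    and U: "U \<subseteq> N z" "U \<subseteq> B" "card U = 4" and adj: "u \<in> U" "u' \<in> U" "u' \<in> N u"
  obtains e where "\<And>x. e x < 3" "\<And>c'. six c' D B k X \<Longrightarrow> (\<And>x. x \<in> U \<Longrightarrow> c' {z, x} = 3 + e x) \<Longrightarrow> flex c' D B z"
proof (cases "\<forall>x\<in>U. k x = k u")
  case True
  have finU: "finite U" using U(3) card.infinite by fastforce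
  have uu: "u \<noteq> u'" using adj(3) by auto
  have "card (U - {u, u'}) = 2" using U(3) adj uu finU by (simp add: card_Diff_subset)
  then obtain w w' where w: "U - {u, u'} = {w, w'}" "w \<noteq> w'" by (meson card_2_iff)
  have ww: "w \<in> U" "w' \<in> U" "w \<noteq> u" "w \<noteq> u'" "w' \<noteq> u" "w' \<noteq> u'" using w by blast+
  have i3: "k u < 3" using sixD(1)[OF s(1)] U(2) adj(1) by blast
  obtain j l where jl: "j < 3" "l < 3" "k u \<noteq> j" "k u \<noteq> l" "j \<noteq> l" using other_colours[OF i3] .
  define e where "e = (\<lambda>x. if x = w then j else if x = w' then l else k u)"
  show ?thesis
  proof (rule that)
    show "e x < 3" for x using i3 jl by (simp add: e_def)
    fix c' assume c': "six c' D B k X" "\<And>x. x \<in> U \<Longrightarrow> c' {z, x} = 3 + e x"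
    show "flex c' D B z"
    proof (rule flex_adjacent[OF c'(1) s(2) z])
      show "u \<in> N z" "u' \<in> N z" "w \<in> N z" "w' \<in> N z" using U(1) adj ww by blast+
      show "u \<in> B" "u' \<in> B" "w \<in> B" "w' \<in> B" using U(2) adj ww by blast+
      show "k u = k u" "k u' = k u" "k w = k u" "k w' = k u" using True adj ww by blast+
      show "c' {z, u} = 3 + k u" "c' {z, u'} = 3 + k u" "c' {z, w} = 3 + j" "c' {z, w'} = 3 + l"
        using c'(2) adj(1,2) ww w(2) by (simp_all add: e_def)
    qed (fact adj(3) i3 jl)+
  qed
next
  case False
  have "\<exists>a\<in>U. \<exists>a'\<in>U. \<exists>b\<in>U. a \<noteq> a' \<and> k a = k a' \<and> k b \<noteq> k a"
  proof -
    have "k ` U \<subseteq> {0, 1, 2}" using sixD(1)[OF s(1)] U(2) by force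
    then have "card (k ` U) \<le> card {0, 1, 2::nat}" by (intro card_mono) auto
    then have "\<not> inj_on k U" using U(3) by (auto dest: card_image)
    then obtain a a' where a: "a \<in> U" "a' \<in> U" "a \<noteq> a'" "k a = k a'" by (auto simp: inj_on_def)
    obtain b where "b \<in> U" "k b \<noteq> k a" using False adj(1) by (metis (full_types))
    then show ?thesis using a by blast
  qed
  then obtain a a' b where a: "a \<in> U" "a' \<in> U" "b \<in> U" "a \<noteq> a'" "k a = k a'" "k b \<noteq> k a" by blast
  have i3: "k x < 3" if "x \<in> U" for x using sixD(1)[OF s(1)] U(2) that by blast
  obtain l where l: "l < 3" "k a \<noteq> l" "k b \<noteq> l" using other_colour[OF i3[OF a(1)] i3[OF a(3)]] a(6) by metis
  define e where "e = (\<lambda>x. if x = a then k b else l)"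
  show ?thesis
  proof (rule that)
    show "e x < 3" for x using i3 a l by (simp add: e_def)
    fix c' assume c': "six c' D B k X" "\<And>x. x \<in> U \<Longrightarrow> c' {z, x} = 3 + e x"
    have own: "att c' D V x {k x}" if "x \<in> U" for x
      using six_att[OF c'(1) s(2), of x "k x"] sixD(1,2)[OF c'(1), of x] that U(2) by auto
    have "b \<noteq> a" using a by auto
    show "flex c' D B z"
    proof (rule flex_mixed[OF c'(1) s(2) z])
      show "a \<in> N z" "a' \<in> N z" "b \<in> N z" "a' \<in> B" using U(1,2) a(1-3) by blast+
      show "k a' = k a" using a(5) by simp
      show "att c' D V a {k a}" "att c' D V b {k b}" using own a(1,3) by blast+
      show "k a < 3" "k b < 3" using i3 a(1,3) by blast+
      show "c' {z, a} = 3 + k b" "c' {z, a'} = 3 + l" "c' {z, b} = 3 + l"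
        using c'(2) a(1-4) \<open>b \<noteq> a\<close> by (simp_all add: e_def)
      show "k a \<noteq> k b" using a(6) by simp
    qed (fact l)+
  qed
qed

subsection \<open>Colouring the vertices that are not dominated\<close>

lemma NC_leg: "u \<in> NC D - D \<Longrightarrow> N u \<inter> D \<noteq> {}"
  unfolding NC_def using N_sym by blast

lemma T3_rot: "T3 c D x y z \<Longrightarrow> T3 c D y z x" "T3 c D x y z \<Longrightarrow> T3 c D z x y" "T3 c D x y z \<Longrightarrow> T3 c D z y x"
  using T3_perm by metis+

lemma rx3_dominated:
  assumes g: "grow D E" and dom: "NC D = V" "D \<noteq> V" and deg: "\<And>v. v \<in> V \<Longrightarrow> 3 \<le> card (N v)"
  shows "rx3 G \<le> card D - 1 + 6"
proof -
  define B where "B = V - D"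
  have DV: "D \<subseteq> V" using grow_facts(3)[OF g] .
  have "finite B" "B \<inter> D = {}" using finV by (auto simp: B_def)
  moreover have "N u \<inter> D \<noteq> {}" if "u \<in> B" for u using NC_leg[of u D] that dom by (simp add: B_def)
  moreover have "3 \<le> card (N u \<inter> (D \<union> B))" if "u \<in> B" for u
  proof -
    have "N u \<inter> (D \<union> B) = N u" using N_sub by (auto simp: B_def)
    then show ?thesis using deg that by (simp add: B_def)
  qed
  ultimately obtain c k X where s: "six c D B k X" "\<And>e. c e < 6" by (rule six_exists) blast+
  obtain b where b: "b \<in> B" using dom(2) DV by (auto simp: B_def)
  have BV: "B \<subseteq> V" by (auto simp: B_def)
  show ?thesis
  proof (rule rx3_le[OF g s(2) b])
    show "B \<subseteq> V - D" by (simp add: B_def)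
    fix x y z assume "x \<in> V - D" "y \<in> V - D" "z \<in> V - D"
    then have "x \<in> B" "y \<in> B" "z \<in> B" by (simp_all add: B_def)
    then show "T3 c D x y z"
      by (intro T3_via[OF s(1) BV own1_B[OF s(1) BV] _ via_B _ via_B]) auto
  qed
qed

text \<open>Two vertices may be irregular: \<open>u\<close> takes the direct role and
  \<open>v\<close> the flexible one. No triple repeats a vertex outside \<open>B\<close>, so the
  remaining role falls to a vertex of \<open>B\<close>.\<close>

lemma rx3_one_left:
  assumes g: "grow D E" and s: "six c D B k X" "\<And>e. c e < 6" and B: "B \<subseteq> V - D" "b \<in> B"
    and fl: "flex c D B v" and ow: "own1 c D u {}" and VD: "V - D = insert v (insert u B)"
  shows "rx3 G \<le> card D - 1 + 6"
proof (rule rx3_le[OF g s(2) B(2,1)])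
  have BV: "B \<subseteq> V" using B by blast
  have F: "T3 c D p q r" if "p \<in> insert u B" "q \<in> B" "r \<in> insert v B" for p q r
  proof -
    have o: "own1 c D p {}" using that(1) ow own1_B[OF s(1) BV] by blast
    show ?thesis
    proof (cases "r \<in> B")
      case True
      then show ?thesis by (intro T3_via[OF s(1) BV o _ via_B _ via_B]) (use that in auto)
    next
      case False
      then have "r = v" using that by blast
      then show ?thesis by (intro T3_flex[OF s(1) BV o _ via_B]) (use that fl in auto)
    qed
  qed
  fix x y z assume xyz: "x \<in> V - D" "y \<in> V - D" "z \<in> V - D" "x = y \<longrightarrow> x \<in> B" "x = z \<longrightarrow> x \<in> B" "y = z \<longrightarrow> y \<in> B"
  then have i: "x \<in> B \<or> x = u \<or> x = v" "y \<in> B \<or> y = u \<or> y = v" "z \<in> B \<or> z = u \<or> z = v" unfolding VD by auto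
  note P = F[of x y z] F[of x z y, THEN T3_perm(2)] F[of y x z, THEN T3_perm(1)] F[of y z x, THEN T3_rot(2)]
    F[of z x y, THEN T3_rot(1)] F[of z y x, THEN T3_rot(3)]
  show "T3 c D x y z" using i xyz(4-6) P by blast
qed

text \<open>No new colour is spent on \<open>v\<close>. If two of its neighbours are adjacent,
  \<open>flex_four\<close> applies. Otherwise one neighbour \<open>w\<close> is taken out of
  \<open>B\<close>, so that its direct colour can be chosen to suit
  \<open>flex_mixed\<close>.\<close>

lemma rx3_almost_dominated:
  assumes g: "grow D E" and v: "V - NC D = {v}" and deg: "\<And>x. x \<in> V \<Longrightarrow> 4 \<le> card (N x)"
  shows "rx3 G \<le> card D - 1 + 6"
proof -
  have vV: "v \<in> V" "v \<notin> NC D" using v by auto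
  have vD: "v \<notin> D" using vV by (auto simp: NC_def)
  have Nv: "N v \<subseteq> V - D - {v}"
    using N_sub vV(2) N_sym unfolding NC_def by auto
  have leg: "N u \<inter> D \<noteq> {}" if "u \<in> V - D - {v}" for u using NC_leg[of u D] that v by blast
  show ?thesis
  proof (cases "\<exists>u\<in>N v. \<exists>u'\<in>N v. u' \<in> N u")
    case True
    then obtain u u' where u: "u \<in> N v" "u' \<in> N v" "u' \<in> N u" by blast
    have uu: "u \<noteq> u'" using u(3) by auto
    define B where "B = V - D - {v}"
    have BV: "B \<subseteq> V" by (auto simp: B_def)
    have "finite B" "B \<inter> D = {}" using finV by (auto simp: B_def)
    moreover have "N u \<inter> D \<noteq> {}" if "u \<in> B" for u using leg that by (simp add: B_def)
    moreover have "3 \<le> card (N x \<inter> (D \<union> B))" if "x \<in> B" for x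
    proof -
      have "N x \<inter> (D \<union> B) = N x - {v}" using N_sub vD by (auto simp: B_def)
      moreover have "card (N x) - card {v} \<le> card (N x - {v})" by (rule diff_card_le_card_Diff) simp
      ultimately show ?thesis using deg[of x] that by (simp add: B_def)
    qed
    ultimately obtain c k X where s: "six c D B k X" "\<And>e. c e < 6" by (rule six_exists) blast+
    have "card (N v - {u, u'}) = card (N v) - 2" using u(1,2) uu by (simp add: card_Diff_subset)
    then have "2 \<le> card (N v - {u, u'})" using deg[OF vV(1)] by simp
    then obtain T where T: "T \<subseteq> N v - {u, u'}" "card T = 2" "finite T" by (meson obtain_subset_with_card_n)
    define U where "U = insert u (insert u' T)"
    have U: "U \<subseteq> N v" "U \<subseteq> B" "card U = 4" "u \<in> U" "u' \<in> U"
      using T u uu Nv by (auto simp: U_def B_def card_insert_if)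
    have zV: "v \<in> V - D" using vV vD by blast
    obtain e where e: "\<And>x. e x < 3" "\<And>c'. six c' D B k X \<Longrightarrow> (\<And>x. x \<in> U \<Longrightarrow> c' {v, x} = 3 + e x) \<Longrightarrow> flex c' D B v"
      using flex_four[OF s(1) BV zV U(1,2,3,4,5) u(3)] by blast
    define c' where "c' = (\<lambda>f. if v \<in> f then 3 + e (the_elem (f - {v})) else c f)"
    have s': "six c' D B k X"
      by (rule six_cong[OF s(1)]) (use vD in \<open>auto simp: c'_def B_def\<close>)
    have fl: "flex c' D B v"
    proof (rule e(2)[OF s'])
      fix x assume "x \<in> U"
      then have "x \<noteq> v" using U(1) by auto
      then have "{v, x} - {v} = {x}" by auto
      then show "c' {v, x} = 3 + e x" by (simp add: c'_def)
    qed
    have uB: "u \<in> B" using U(2,4) by blast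
    show ?thesis
    proof (rule rx3_one_left[OF g s' _ _ uB fl own1_B[OF s' BV uB]])
      show "c' f < 6" for f using s(2) e(1)[of "the_elem (f - {v})"] by (simp add: c'_def)
    qed (use uB zV in \<open>auto simp: B_def\<close>)
  next
    case False
    have "N v \<noteq> {}" using deg[OF vV(1)] by auto
    then obtain w where w: "w \<in> N v" by blast
    \<comment> \<open>The neighbourhood of \<open>v\<close> is independent, so no vertex is adjacent
      to both \<open>v\<close> and \<open>w\<close>; leaving out both still leaves three neighbours
      to every vertex of \<open>B\<close>.\<close>
    define B where "B = V - D - {v} - {w}"
    have BV: "B \<subseteq> V" by (auto simp: B_def)
    have wD: "w \<notin> D" "w \<noteq> v" "w \<in> V" using w Nv by blast+
    have "finite B" "B \<inter> D = {}" using finV by (auto simp: B_def)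
    moreover have "N u \<inter> D \<noteq> {}" if "u \<in> B" for u using leg that by (simp add: B_def)
    moreover have "3 \<le> card (N x \<inter> (D \<union> B))" if "x \<in> B" for x
    proof -
      have 1: "N x \<inter> (D \<union> B) = N x - {v, w}" using N_sub vD wD by (auto simp: B_def)
      have "\<not> (v \<in> N x \<and> w \<in> N x)" using False w N_sym by blast
      then have "\<exists>y. N x - {v, w} = N x - {y}" by blast
      then obtain y where y: "N x - {v, w} = N x - {y}" by blast
      have "card (N x) - card {y} \<le> card (N x - {y})" by (rule diff_card_le_card_Diff) simp
      then show ?thesis unfolding 1 y using deg[of x] that by (simp add: B_def)
    qed
    ultimately obtain c k X where s: "six c D B k X" "\<And>e. c e < 6" by (rule six_exists) blast+
    have "card (N v - {w}) = card (N v) - 1" using w by simp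
    then have "2 \<le> card (N v - {w})" using deg[OF vV(1)] by simp
    then obtain T where T: "T \<subseteq> N v - {w}" "card T = 2" "finite T" by (meson obtain_subset_with_card_n)
    then obtain x y where "T = {x, y}" "x \<noteq> y" by (meson card_2_iff)
    then have xy: "x \<in> N v" "y \<in> N v" "x \<noteq> w" "y \<noteq> w" "x \<noteq> y" using T by auto
    have xyB: "x \<in> B" "y \<in> B" using xy Nv by (auto simp: B_def)
    have k3: "k x < 3" "k y < 3" using sixD(1)[OF s(1)] xyB by blast+
    \<comment> \<open>If \<open>x\<close> and \<open>y\<close> agree in class, \<open>w\<close> is
      given a different one; otherwise \<open>w\<close> copies the class of \<open>x\<close>. The
      vertex \<open>u'\<close> must differ from \<open>w\<close>, since it has to lie in
      \<open>B\<close>.\<close>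
    have "\<exists>a u u' q. a < 3 \<and> u \<in> N v \<and> u' \<in> N v \<and> q \<in> N v \<and> u' \<noteq> w \<and> u \<noteq> u' \<and> (k(w := a)) u = (k(w := a)) u' \<and> (k(w := a)) q \<noteq> (k(w := a)) u"
    proof (cases "k x = k y")
      case True
      obtain j where j: "j < 3" "k x \<noteq> j" using other_colours[OF k3(1)] by metis
      show ?thesis by (rule exI[of _ j], rule exI[of _ x], rule exI[of _ y], rule exI[of _ w]) (use j xy w True in auto)
    next
      case False
      show ?thesis by (rule exI[of _ "k x"], rule exI[of _ w], rule exI[of _ x], rule exI[of _ y]) (use k3 xy w False in auto)
    qed
    then obtain a u u' q where a: "a < 3" "u \<in> N v" "u' \<in> N v" "q \<in> N v" "u' \<noteq> w" "u \<noteq> u'"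
      "(k(w := a)) u = (k(w := a)) u'" "(k(w := a)) q \<noteq> (k(w := a)) u" by blast
    define k' where "k' = k(w := a)"
    have kk: "k' u = k' u'" "k' q \<noteq> k' u" using a(7,8) by (simp_all add: k'_def)
    have NB: "z \<in> B \<or> z = w" if "z \<in> N v" for z using that Nv by (auto simp: B_def)
    have k'3: "k' z < 3" if "z \<in> N v" for z using NB[OF that] sixD(1)[OF s(1)] a(1) by (auto simp: k'_def)
    obtain l where l: "l < 3" "k' u \<noteq> l" "k' q \<noteq> l" using other_colour[OF k'3[OF a(2)] k'3[OF a(4)]] kk(2) by metis
    define c' where "c' = (\<lambda>f. if v \<in> f then 3 + (if f = {v, u} then k' q else l) else if w \<in> f then a else c f)"
    have s': "six c' D B k X"
      by (rule six_cong[OF s(1)]) (use vD wD in \<open>auto simp: c'_def B_def\<close>)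
    have zV: "v \<in> V - D" using vV vD by blast
    have attw: "att c' D V w {a}"
    proof -
      obtain f where f: "f \<in> N w" "f \<in> D" using leg[of w] wD by blast
      have "c' {w, f} = a" using f vD wD by (auto simp: c'_def)
      then show ?thesis using att.ext[of w V D f c' "{}"] att.nil[of f D c' V] f wD by simp
    qed
    have att': "att c' D V z {k' z}" if "z \<in> N v" for z
    proof (cases "z = w")
      case True
      then show ?thesis using attw by (simp add: k'_def)
    next
      case False
      then have zB: "z \<in> B" using NB that by blast
      then show ?thesis using six_att[OF s' BV zB sixD(1)[OF s' zB]] sixD(2)[OF s' zB] False by (simp add: k'_def)
    qed
    have fl: "flex c' D B v"
    proof (rule flex_mixed[OF s' BV zV a(2,3,4)])
      show "u' \<in> B" using NB a(3,5) by blast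
      show "k u' = k' u'" using a(5) by (simp add: k'_def)
      show "att c' D V u {k' u'}" using att'[OF a(2)] kk by simp
      show "att c' D V q {k' q}" using att'[OF a(4)] .
      show "k' u' < 3" "k' q < 3" using k'3 a by blast+
      show "k' u' \<noteq> k' q" "k' u' \<noteq> l" using kk l by auto
      show "c' {v, u} = 3 + k' q" by (simp add: c'_def)
      show "c' {v, u'} = 3 + l" using a(6) by (auto simp: c'_def doubleton_eq_iff)
      have "q \<noteq> u" using kk by auto
      then show "c' {v, q} = 3 + l" by (auto simp: c'_def doubleton_eq_iff)
    qed (fact l)+
    show ?thesis
    proof (rule rx3_one_left[OF g s' _ _ xyB(1) fl])
      show "c' f < 6" for f using s(2)[of f] k'3[OF a(4)] l(1) a(1) by (simp add: c'_def)
      show "own1 c' D w {}" unfolding own1_def using attw a(1) by blast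
    qed (use zV wD in \<open>auto simp: B_def\<close>)
  qed
qed

text \<open>Ignoring the vertices outside \<open>NC D\<close> costs a boundary vertex at most one
  neighbour, so three of its four remain for \<open>six_exists\<close>.\<close>

lemma extended_six:
  assumes g: "grow D E" and deg: "\<And>v. v \<in> V \<Longrightarrow> 4 \<le> card (N v)"
    and priv: "\<And>u. u \<in> NC D - D \<Longrightarrow> card (N u - NC D) \<le> 1"
  obtains c k X where "six c D (NC D - D) k X" "\<And>e. c e < 6"
proof -
  define B where "B = NC D - D"
  have DV: "D \<subseteq> V" using grow_facts(3)[OF g] .
  have BV: "B \<subseteq> V" using NC_sub[OF DV] by (auto simp: B_def)
  have "finite B" "B \<inter> D = {}" using finV BV finite_subset by (auto simp: B_def)
  moreover have "N u \<inter> D \<noteq> {}" if "u \<in> B" for u using NC_leg[of u D] that by (simp add: B_def)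
  moreover have "3 \<le> card (N x \<inter> (D \<union> B))" if "x \<in> B" for x
  proof -
    have "N x = (N x \<inter> (D \<union> B)) \<union> (N x - NC D)" by (auto simp: B_def NC_def)
    then have "card (N x) \<le> card (N x \<inter> (D \<union> B)) + card (N x - NC D)" by (metis card_Un_le)
    then show ?thesis using deg[of x] priv[of x] that BV by (auto simp: B_def)
  qed
  ultimately obtain c k X where s: "six c D B k X" "\<And>e. c e < 6" by (rule six_exists) blast+
  show ?thesis by (rule that[OF s[unfolded B_def]])
qed

text \<open>Three edges from every outer vertex into \<open>B\<close> get the colours 6, 7, 8, one
  for each role in a triple, so the roles can be assigned arbitrarily.\<close>

lemma rx3_tokens:
  assumes g: "grow D E" and W: "V \<noteq> NC D" and deg: "\<And>v. v \<in> V \<Longrightarrow> 4 \<le> card (N v)"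
    and priv: "\<And>u. u \<in> NC D - D \<Longrightarrow> card (N u - NC D) \<le> 1"
    and three: "\<And>v. v \<in> V - NC D \<Longrightarrow> 3 \<le> card (N v \<inter> NC D)"
  shows "rx3 G \<le> card D - 1 + 9"
proof -
  define B where "B = NC D - D"
  have DV: "D \<subseteq> V" using grow_facts(3)[OF g] .
  have BV: "B \<subseteq> V - D" "B \<subseteq> V" using NC_sub[OF DV] by (auto simp: B_def)
  obtain c k X where s: "six c D B k X" "\<And>e. c e < 6"
    using extended_six[OF g deg priv] unfolding B_def by blast
  have NB: "N v \<inter> NC D \<subseteq> B" if "v \<in> V - NC D" for v
    using that N_sym by (auto simp: B_def NC_def)
  have "\<exists>a b d. a \<in> N v \<inter> B \<and> b \<in> N v \<inter> B \<and> d \<in> N v \<inter> B \<and> a \<noteq> b \<and> a \<noteq> d \<and> b \<noteq> d" if v: "v \<in> V - NC D" for v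
  proof -
    obtain T where "T \<subseteq> N v \<inter> NC D" "card T = 3" "finite T" using three[OF v] by (meson obtain_subset_with_card_n)
    moreover obtain a b d where "T = {a, b, d}" "a \<noteq> b" "a \<noteq> d" "b \<noteq> d" using \<open>card T = 3\<close> by (auto simp: card_3_iff)
    ultimately show ?thesis using NB[OF v] by (intro exI[of _ a] exI[of _ b] exI[of _ d]) auto
  qed
  then obtain n1 n2 n3 where n: "\<And>v. v \<in> V - NC D \<Longrightarrow> n1 v \<in> N v \<inter> B \<and> n2 v \<in> N v \<inter> B \<and> n3 v \<in> N v \<inter> B \<and> n1 v \<noteq> n2 v \<and> n1 v \<noteq> n3 v \<and> n2 v \<noteq> n3 v"
    by metis
  define c' where "c' = (\<lambda>f. if f \<subseteq> NC D then c f else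
    (let v = the_elem (f - NC D); u = the_elem (f \<inter> NC D) in if u = n1 v then 6 else if u = n2 v then 7 else 8))"
  have c'e: "c' {v, u} = (if u = n1 v then 6 else if u = n2 v then 7 else 8)" if "v \<in> V - NC D" "u \<in> B" for v u
  proof -
    have "{v, u} - NC D = {v}" "{v, u} \<inter> NC D = {u}" using that by (auto simp: B_def)
    then show ?thesis using that by (auto simp: c'_def B_def)
  qed
  have s': "six c' D B k X"
    by (rule six_cong[OF s(1)]) (auto simp: c'_def B_def NC_def)
  have o: "own1 c' D v {6}" "via c' D B v {7}" "via c' D B v {8}" if v: "v \<in> V - NC D" for v
  proof -
    have vD: "v \<in> V - D" using v by (auto simp: NC_def)
    note nv = n[OF v]
    show "own1 c' D v {6}"
      by (rule own1_step[OF vD _ own1_B[OF s' BV(2)], of "n1 v"]) (use nv c'e[OF v] in auto)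
    show "via c' D B v {7}"
      by (rule via_step[OF vD _ via_B, of "n2 v"]) (use nv c'e[OF v] in auto)
    show "via c' D B v {8}"
      by (rule via_step[OF vD _ via_B, of "n3 v"]) (use nv c'e[OF v] in auto)
  qed
  obtain v where v: "v \<in> V - NC D" using W NC_sub[OF DV] by blast
  have b: "n1 v \<in> B" using n[OF v] by blast
  show ?thesis
  proof (rule rx3_le[OF g _ b BV(1)])
    show "c' f < 9" for f using s(2)[of f] by (auto simp: c'_def Let_def)
    fix x y z assume xyz: "x \<in> V - D" "y \<in> V - D" "z \<in> V - D"
    have dis: "p \<in> B \<or> p \<in> V - NC D" if "p \<in> V - D" for p using that by (auto simp: B_def)
    obtain S1 where S1: "own1 c' D x S1" "S1 \<subseteq> {6}" using dis[OF xyz(1)] o(1) own1_B[OF s' BV(2)] by blast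
    obtain S2 where S2: "via c' D B y S2" "S2 \<subseteq> {7}" using dis[OF xyz(2)] o(2) via_B by blast
    obtain S3 where S3: "via c' D B z S3" "S3 \<subseteq> {8}" using dis[OF xyz(3)] o(3) via_B by blast
    show "T3 c' D x y z"
      by (rule T3_via[OF s' BV(2) S1(1) _ S2(1) _ S3(1)]) (use S1(2) S2(2) S3(2) in auto)
  qed
qed

lemma maximal_independent:
  assumes "finite W"
  obtains I where "I \<subseteq> W" "\<And>x y. x \<in> I \<Longrightarrow> y \<in> I \<Longrightarrow> y \<notin> N x" "\<And>x. x \<in> W - I \<Longrightarrow> N x \<inter> I \<noteq> {}"
proof -
  let ?P = "\<lambda>I. I \<subseteq> W \<and> (\<forall>x\<in>I. \<forall>y\<in>I. y \<notin> N x)"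
  have "\<exists>I. ?P I \<and> (\<forall>J. ?P J \<longrightarrow> card J \<le> card I)"
    by (rule ex_has_greatest_nat[of ?P "{}" card "Suc (card W)"])
      (use assms in \<open>auto simp: less_Suc_eq_le intro: card_mono\<close>)
  then obtain I where I0: "?P I \<and> (\<forall>J. ?P J \<longrightarrow> card J \<le> card I)" by (elim exE)
  note I = conjunct1[OF I0] conjunct2[OF I0]
  have "N x \<inter> I \<noteq> {}" if x: "x \<in> W - I" for x
  proof
    assume e: "N x \<inter> I = {}"
    then have "?P (insert x I)" using I(1) x N_sym by (auto simp: disjoint_iff)
    then have "card (insert x I) \<le> card I" using I(2) by blast
    moreover have "finite I" using I(1) assms finite_subset by blast
    ultimately show False using x by simp
  qed
  then show ?thesis using that[of I] I(1) by blast
qed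

text \<open>Two neighbours in \<open>B\<close> give only two of the three roles. Vertices of a
  maximal independent set \<open>I\<close> own 6 and 7, the others own 7 and 8. A vertex outside
  \<open>I\<close> borrows 6 from a neighbour in \<open>I\<close> over an edge of colour 9; a vertex
  of \<open>I\<close> finds 8 at a third neighbour in \<open>B\<close> or borrows it in the same
  way. One loan per triple suffices, so 9 is spent at most once.\<close>

lemma rx3_tokens2:
  assumes g: "grow D E" and W: "V \<noteq> NC D" and deg: "\<And>v. v \<in> V \<Longrightarrow> 4 \<le> card (N v)"
    and priv: "\<And>u. u \<in> NC D - D \<Longrightarrow> card (N u - NC D) \<le> 1"
    and two: "\<And>v. v \<in> V - NC D \<Longrightarrow> 2 \<le> card (N v \<inter> NC D)"
  shows "rx3 G \<le> card D - 1 + 10"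
proof -
  define B where "B = NC D - D"
  have DV: "D \<subseteq> V" using grow_facts(3)[OF g] .
  have BV: "B \<subseteq> V - D" "B \<subseteq> V" using NC_sub[OF DV] by (auto simp: B_def)
  obtain c k X where s: "six c D B k X" "\<And>e. c e < 6"
    using extended_six[OF g deg priv] unfolding B_def by blast
  have NB: "N v \<inter> NC D \<subseteq> B" if "v \<in> V - NC D" for v
    using that N_sym by (auto simp: B_def NC_def)
  have "\<exists>a b. a \<in> N v \<inter> B \<and> b \<in> N v \<inter> B \<and> a \<noteq> b" if v: "v \<in> V - NC D" for v
  proof -
    obtain T where "T \<subseteq> N v \<inter> NC D" "card T = 2" "finite T" using two[OF v] by (meson obtain_subset_with_card_n)
    moreover obtain a b where "T = {a, b}" "a \<noteq> b" using \<open>card T = 2\<close> by (auto simp: card_2_iff)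
    ultimately show ?thesis using NB[OF v] by (intro exI[of _ a] exI[of _ b]) auto
  qed
  then obtain n1 n2 where n: "\<And>v. v \<in> V - NC D \<Longrightarrow> n1 v \<in> N v \<inter> B \<and> n2 v \<in> N v \<inter> B \<and> n1 v \<noteq> n2 v"
    by metis
  obtain I where I: "I \<subseteq> V - NC D" "\<And>x y. x \<in> I \<Longrightarrow> y \<in> I \<Longrightarrow> y \<notin> N x"
    "\<And>x. x \<in> V - NC D - I \<Longrightarrow> N x \<inter> I \<noteq> {}" using maximal_independent[of "V - NC D"] finV by auto
  define c' where "c' = (\<lambda>f. if f \<subseteq> NC D then c f else if f \<inter> NC D = {} then 9 else
    (let v = the_elem (f - NC D); u = the_elem (f \<inter> NC D) in
      if u = n1 v then (if v \<in> I then 6 else 8) else if u = n2 v then 7 else if v \<in> I then 8 else 6))"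
  have c'e: "c' {v, u} = (if u = n1 v then (if v \<in> I then 6 else 8) else if u = n2 v then 7 else if v \<in> I then 8 else 6)"
    if "v \<in> V - NC D" "u \<in> B" for v u
  proof -
    have 1: "{v, u} - NC D = {v}" "{v, u} \<inter> NC D = {u}" using that by (auto simp: B_def)
    have 2: "\<not> {v, u} \<subseteq> NC D" using that by auto
    show ?thesis unfolding c'_def Let_def if_not_P[OF 2] 1 by simp
  qed
  have c'9: "c' {v, u} = 9" if "v \<in> V - NC D" "u \<in> V - NC D" for v u
    using that by (auto simp: c'_def)
  have s': "six c' D B k X"
    by (rule six_cong[OF s(1)]) (auto simp: c'_def B_def NC_def)
  have vD: "v \<in> V - D" if "v \<in> V - NC D" for v using that by (auto simp: NC_def)
  have other: "(\<exists>u\<in>N v \<inter> B. u \<noteq> n1 v \<and> u \<noteq> n2 v) \<or> (\<exists>w\<in>N v. w \<in> V - NC D)" if v: "v \<in> V - NC D" for v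
  proof -
    have "card (N v) \<ge> 4" using deg v by blast
    moreover have "card {n1 v, n2 v} \<le> 2" by (simp add: card_insert_if)
    ultimately have "\<not> N v \<subseteq> {n1 v, n2 v}" using card_mono[of "{n1 v, n2 v}" "N v"] by auto
    then obtain u where "u \<in> N v" "u \<noteq> n1 v" "u \<noteq> n2 v" by blast
    then show ?thesis using NB[OF v] N_sub by blast
  qed
  have o7: "via c' D B v {7}" if v: "v \<in> V - NC D" for v
    by (rule via_step[OF vD[OF v] _ via_B, of "n2 v"]) (use n[OF v] c'e[OF v] in auto)
  have o6: "own1 c' D v {6}" if v: "v \<in> I" for v
    by (rule own1_step[OF vD _ own1_B[OF s' BV(2)], of v "n1 v"]) (use v I(1) n[of v] c'e[of v "n1 v"] in auto)
  have o8: "via c' D B v {8}" if v: "v \<in> V - NC D - I" for v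
    by (rule via_step[OF vD _ via_B, of v "n1 v"]) (use v n[of v] c'e[of v "n1 v"] in auto)
  have o8': "via c' D B v {8} \<or> via c' D B v {9, 8}" if v: "v \<in> I" for v
  proof -
    have vW: "v \<in> V - NC D" using v I by blast
    consider u where "u \<in> N v" "u \<in> B" "u \<noteq> n1 v" "u \<noteq> n2 v" | w where "w \<in> N v" "w \<in> V - NC D" using other[OF vW] by blast
    then show ?thesis
    proof cases
      case 1
      have "via c' D B v {8}" by (rule via_step[OF vD[OF vW] 1(1) via_B]) (use 1 v c'e[OF vW 1(2)] in auto)
      then show ?thesis ..
    next
      case 2
      have "w \<notin> I" using I(2) v 2 by blast
      then have "via c' D B w {8}" using o8 2 by blast
      then have "via c' D B v {9, 8}" by (rule via_step[OF vD[OF vW] 2(1)]) (use c'9[OF vW 2(2)] in auto)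
      then show ?thesis ..
    qed
  qed
  have o6': "own1 c' D v {6} \<or> own1 c' D v {9, 6}" if v: "v \<in> V - NC D - I" for v
  proof -
    obtain w where w: "w \<in> N v" "w \<in> I" using I(3)[OF v] by blast
    have "own1 c' D v {9, 6}" by (rule own1_step[OF vD w(1) o6[OF w(2)]]) (use v w I(1) c'9[of v w] in auto)
    then show ?thesis ..
  qed
  obtain v where v: "v \<in> V - NC D" using W NC_sub[OF DV] by blast
  have b: "n1 v \<in> B" using n[OF v] by blast
  show ?thesis
  proof (rule rx3_le[OF g _ b BV(1)])
    show "c' f < 10" for f using s(2)[of f] by (auto simp: c'_def Let_def)
    have dis: "p \<in> B \<or> p \<in> I \<or> p \<in> V - NC D - I" if "p \<in> V - D" for p using that by (auto simp: B_def)
    have S2: "\<exists>S. via c' D B q S \<and> S \<subseteq> {7}" if "q \<in> V - D" for q using dis[OF that] o7 I(1) via_B by blast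
    have F: "T3 c' D p q r" if pqr: "p \<in> B \<union> I" "q \<in> V - D" "r \<in> V - D" for p q r
    proof -
      obtain S1 where S1: "own1 c' D p S1" "S1 \<subseteq> {6}" using pqr(1) o6 own1_B[OF s' BV(2)] by blast
      obtain S2 where S2: "via c' D B q S2" "S2 \<subseteq> {7}" using S2[OF pqr(2)] by blast
      have "\<exists>S. via c' D B r S \<and> S \<subseteq> {9, 8}"
        using dis[OF pqr(3)] o8 o8' via_B by (metis empty_subsetI insertI1 insertI2 insert_subset subset_refl)
      then obtain S3 where S3: "via c' D B r S3" "S3 \<subseteq> {9, 8}" by blast
      show ?thesis
        by (rule T3_via[OF s' BV(2) S1(1) _ S2(1) _ S3(1)]) (use S1(2) S2(2) S3(2) in auto)
    qed
    fix x y z assume xyz: "x \<in> V - D" "y \<in> V - D" "z \<in> V - D"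
    show "T3 c' D x y z"
    proof (cases "x \<in> B \<union> I \<or> y \<in> B \<union> I \<or> z \<in> B \<union> I")
      case True
      then show ?thesis using F[of x y z] F[of y x z] F[of z x y] xyz T3_perm T3_rot by metis
    next
      case False
      then have N: "x \<in> V - NC D - I" "y \<in> V - NC D - I" "z \<in> V - NC D - I" using dis xyz by blast+
      obtain S1 where S1: "own1 c' D x S1" "S1 \<subseteq> {9, 6}" using o6'[OF N(1)] by blast
      have "via c' D B y {7}" "via c' D B z {8}" using o7 o8 N by blast+
      then show ?thesis
        by (intro T3_via[OF s' BV(2) S1(1)]) (use S1(2) in auto)
    qed
  qed
qed

text \<open>Two new colours serve four vertices. Four edges make \<open>v1\<close> and
  \<open>v2\<close> flexible, and a fifth gives colour 6 to \<open>v1\<close> and colour 7 to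
  \<open>v2\<close>; \<open>v3\<close> and \<open>v4\<close> have both colours. Any three of them
  can then share out the roles 6, 7 and flexible.\<close>

lemma rx3_four_left:
  assumes g: "grow D E" and W: "V - NC D = {v1, v2, v3, v4}" "card (V - NC D) = 4"
    and deg: "\<And>v. v \<in> V \<Longrightarrow> 5 \<le> card (N v)"
    and priv: "\<And>u. u \<in> NC D - D \<Longrightarrow> card (N u - NC D) \<le> 1"
    and ind: "\<And>v. v \<in> V - NC D \<Longrightarrow> N v \<subseteq> NC D"
    and adj: "\<And>v. v \<in> V - NC D \<Longrightarrow> \<exists>u\<in>N v. \<exists>u'\<in>N v. u' \<in> N u"
  shows "rx3 G \<le> card D - 1 + 8"
proof -
  define B where "B = NC D - D"
  have DV: "D \<subseteq> V" using grow_facts(3)[OF g] .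
  have BV: "B \<subseteq> V - D" "B \<subseteq> V" using NC_sub[OF DV] by (auto simp: B_def)
  have deg4: "\<And>v. v \<in> V \<Longrightarrow> 4 \<le> card (N v)" using deg by fastforce
  obtain c k X where s: "six c D B k X" "\<And>e. c e < 6"
    using extended_six[OF g deg4 priv] unfolding B_def by blast
  have NB: "N v \<subseteq> B" if "v \<in> V - NC D" for v
    using that N_sym ind[OF that] by (auto simp: B_def NC_def)
  have vD: "v \<in> V - D" if "v \<in> V - NC D" for v using that by (auto simp: NC_def)
  have dist: "v1 \<noteq> v2" "v1 \<noteq> v3" "v1 \<noteq> v4" "v2 \<noteq> v3" "v2 \<noteq> v4" "v3 \<noteq> v4"
    using W(2) unfolding W(1) by (auto simp: card_insert_if split: if_splits)
  have vW: "v1 \<in> V - NC D" "v2 \<in> V - NC D" "v3 \<in> V - NC D" "v4 \<in> V - NC D" unfolding W(1) by auto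
  have ex: "\<exists>U e n. U \<subseteq> N v \<and> n \<in> N v - U \<and> (\<forall>x. e x < 3) \<and>
      (\<forall>c'. six c' D B k X \<longrightarrow> (\<forall>x\<in>U. c' {v, x} = 3 + e x) \<longrightarrow> flex c' D B v)" if v: "v \<in> V - NC D" for v
  proof -
    obtain u u' where u: "u \<in> N v" "u' \<in> N v" "u' \<in> N u" using adj[OF v] by blast
    have uu: "u \<noteq> u'" using u(3) by auto
    have "card (N v - {u, u'}) = card (N v) - 2" using u(1,2) uu by (simp add: card_Diff_subset)
    then have "2 \<le> card (N v - {u, u'})" using deg[of v] v by simp
    then obtain T where T: "T \<subseteq> N v - {u, u'}" "card T = 2" "finite T" by (meson obtain_subset_with_card_n)
    define U where "U = insert u (insert u' T)"
    have U: "U \<subseteq> N v" "U \<subseteq> B" "card U = 4" "u \<in> U" "u' \<in> U"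
      using T u uu NB[OF v] by (auto simp: U_def card_insert_if)
    obtain e where e: "\<And>x. e x < 3" "\<And>c'. six c' D B k X \<Longrightarrow> (\<And>x. x \<in> U \<Longrightarrow> c' {v, x} = 3 + e x) \<Longrightarrow> flex c' D B v"
      using flex_four[OF s(1) BV(2) vD[OF v] U(1,2,3,4,5) u(3)] by blast
    have "finite U" using U(1) finN finite_subset by blast
    then have "\<not> N v \<subseteq> U" using card_mono[of U "N v"] U(3) deg[of v] v by auto
    then obtain n where "n \<in> N v - U" by blast
    then show ?thesis using U(1) e by (intro exI[of _ U] exI[of _ e] exI[of _ n]) auto
  qed
  obtain U1 e1 n1 where U1: "U1 \<subseteq> N v1" "n1 \<in> N v1 - U1" "\<And>x. e1 x < (3::nat)"
    "\<And>c'. six c' D B k X \<Longrightarrow> (\<forall>x\<in>U1. c' {v1, x} = 3 + e1 x) \<Longrightarrow> flex c' D B v1" using ex[OF vW(1)] by blast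
  obtain U2 e2 n2 where U2: "U2 \<subseteq> N v2" "n2 \<in> N v2 - U2" "\<And>x. e2 x < (3::nat)"
    "\<And>c'. six c' D B k X \<Longrightarrow> (\<forall>x\<in>U2. c' {v2, x} = 3 + e2 x) \<Longrightarrow> flex c' D B v2" using ex[OF vW(2)] by blast
  have "\<exists>a b. a \<in> N v \<and> b \<in> N v \<and> a \<noteq> b" if v: "v \<in> V" for v
  proof -
    obtain T where "T \<subseteq> N v" "card T = 2" "finite T" using deg[OF v] obtain_subset_with_card_n[of 2 "N v"] by auto
    then show ?thesis by (auto simp: card_2_iff)
  qed
  then obtain a b where ab: "\<And>v. v \<in> V \<Longrightarrow> a v \<in> N v \<and> b v \<in> N v \<and> a v \<noteq> b v" by metis
  define c' where "c' = (\<lambda>f. if f \<subseteq> NC D then c f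
    else if v1 \<in> f then (let u = the_elem (f - {v1}) in if u \<in> U1 then 3 + e1 u else 6)
    else if v2 \<in> f then (let u = the_elem (f - {v2}) in if u \<in> U2 then 3 + e2 u else 7)
    else (let u = the_elem (f \<inter> NC D); v = the_elem (f - NC D) in if u = a v then 6 else 7))"
  have s': "six c' D B k X"
    by (rule six_cong[OF s(1)]) (auto simp: c'_def B_def NC_def)
  have c1: "c' {v1, u} = (if u \<in> U1 then 3 + e1 u else 6)" if "u \<in> N v1" for u
  proof -
    have "u \<noteq> v1" using that by auto
    then have "{v1, u} - {v1} = {u}" by auto
    then show ?thesis using vW(1) by (simp add: c'_def)
  qed
  have c2: "c' {v2, u} = (if u \<in> U2 then 3 + e2 u else 7)" if "u \<in> N v2" for u
  proof -
    have "u \<noteq> v2" "u \<noteq> v1" using that NB[OF vW(2)] vW(1) by (auto simp: B_def)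
    then have "{v2, u} - {v2} = {u}" "v1 \<notin> {v2, u}" using dist by auto
    then show ?thesis using vW(2) by (simp add: c'_def)
  qed
  have c3: "c' {v, u} = (if u = a v then 6 else 7)" if "u \<in> N v" "v = v3 \<or> v = v4" for u v
  proof -
    have v: "v \<in> V - NC D" using that(2) vW by blast
    have uB: "u \<in> NC D" using NB[OF v] that by (auto simp: B_def)
    then have "v1 \<notin> {v, u}" "v2 \<notin> {v, u}" using that(2) dist vW by auto
    moreover have "{v, u} \<inter> NC D = {u}" "{v, u} - NC D = {v}" using v uB by auto
    ultimately show ?thesis using v by (simp add: c'_def)
  qed
  have fl: "flex c' D B v1" "flex c' D B v2"
  proof -
    show "flex c' D B v1" by (rule U1(4)[OF s']) (use c1 U1(1) in auto)
    show "flex c' D B v2" by (rule U2(4)[OF s']) (use c2 U2(1) in auto)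
  qed
  have own: "own1 c' D v {6}" if v: "v = v1 \<or> v = v3 \<or> v = v4" for v
  proof -
    have vv: "v \<in> V - NC D" using v vW by blast
    obtain u where u: "u \<in> N v" "c' {v, u} = 6" using v c1[of n1] U1(2) c3[of "a v" v] ab[of v] vv by auto
    then show ?thesis using NB[OF vv] by (intro own1_step[OF vD[OF vv] u(1) own1_B[OF s' BV(2)]]) auto
  qed
  have vi: "via c' D B v {7}" if v: "v = v2 \<or> v = v3 \<or> v = v4" for v
  proof -
    have vv: "v \<in> V - NC D" using v vW by blast
    obtain u where u: "u \<in> N v" "c' {v, u} = 7" using v c2[of n2] U2(2) c3[of "b v" v] ab[of v] vv by auto
    then show ?thesis using NB[OF vv] by (intro via_step[OF vD[OF vv] u(1) via_B]) auto
  qed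
  have b: "n1 \<in> B" using U1(2) NB[OF vW(1)] by blast
  show ?thesis
  proof (rule rx3_le[OF g _ b BV(1)])
    show "c' f < 8" for f
    proof -
      have "3 + e1 u < 8" "3 + e2 u < 8" for u using U1(3)[of u] U2(3)[of u] by auto
      moreover have "c f < 8" using s(2)[of f] by simp
      ultimately show ?thesis by (simp add: c'_def Let_def)
    qed
    define P Q R where "P = (\<lambda>p. p \<in> B \<or> p = v1 \<or> p = v3 \<or> p = v4)" and "Q = (\<lambda>p. p \<in> B \<or> p = v2 \<or> p = v3 \<or> p = v4)"
      and "R = (\<lambda>p. p \<in> B \<or> p = v1 \<or> p = v2)"
    have F: "T3 c' D p q r" if pqr: "P p" "Q q" "R r" for p q r
    proof -
      obtain S1 where S1: "own1 c' D p S1" "S1 \<subseteq> {6}" using pqr(1) own own1_B[OF s' BV(2)] unfolding P_def by blast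
      obtain S2 where S2: "via c' D B q S2" "S2 \<subseteq> {7}" using pqr(2) vi via_B unfolding Q_def by blast
      have S12: "S1 \<subseteq> {6..}" "S2 \<subseteq> {6..}" "S1 \<inter> S2 = {}" using S1(2) S2(2) by auto
      show ?thesis
      proof (cases "r \<in> B")
        case True
        show ?thesis by (rule T3_via[OF s' BV(2) S1(1) S12(1) S2(1) S12(2) via_B[OF True]]) (use S12 in auto)
      next
        case False
        then have "flex c' D B r" using pqr(3) fl by (auto simp: R_def)
        then show ?thesis by (rule T3_flex[OF s' BV(2) S1(1) S12(1) S2(1) S12(2) _ S12(3)])
      qed
    qed
    fix x y z assume xyz: "x \<in> V - D" "y \<in> V - D" "z \<in> V - D" "x = y \<longrightarrow> x \<in> B" "x = z \<longrightarrow> x \<in> B" "y = z \<longrightarrow> y \<in> B"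
    have dis: "p \<in> B \<or> p = v1 \<or> p = v2 \<or> p = v3 \<or> p = v4" if "p \<in> V - D" for p
      using that W(1) by (auto simp: B_def)
    have "P x \<and> Q y \<and> R z \<or> P x \<and> Q z \<and> R y \<or> P y \<and> Q x \<and> R z \<or> P y \<and> Q z \<and> R x \<or> P z \<and> Q x \<and> R y \<or> P z \<and> Q y \<and> R x"
      using dis[OF xyz(1)] dis[OF xyz(2)] dis[OF xyz(3)] xyz(4-6) unfolding P_def Q_def R_def
      by (elim disjE) simp_all
    then show "T3 c' D x y z" using F T3_perm T3_rot by metis
  qed
qed

subsection \<open>Choosing the tree\<close>

lemma NC_add: "u \<in> NC D \<Longrightarrow> NC (insert u D) = NC D \<union> N u"
  by (auto simp: NC_insert)

lemma grow_add: assumes "grow D E" "u \<in> NC D - D" obtains E' where "grow (insert u D) E'"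
proof -
  obtain v where "v \<in> D" "u \<in> N v" using assms(2) by (auto simp: NC_def)
  then show ?thesis using that grow.step[OF assms(1)] assms(2) by blast
qed

lemma grow_NC: assumes "grow D E" shows "NC D \<subseteq> V" "finite (NC D)" "D \<subseteq> NC D" "card (NC D) + card (V - NC D) = card V"
proof -
  show 1: "NC D \<subseteq> V" using NC_sub grow_facts(3)[OF assms] by blast
  then show 2: "finite (NC D)" using finV finite_subset by blast
  show "D \<subseteq> NC D" by (auto simp: NC_def)
  show "card (NC D) + card (V - NC D) = card V"
    using 1 2 finV by (simp add: card_Diff_subset card_mono)
qed

lemma boundary_edge:
  assumes "grow D E" "NC D \<noteq> V" shows "\<exists>u\<in>NC D - D. \<exists>v\<in>V - NC D. v \<in> N u"
proof -
  have "NC D \<noteq> {}" using grow_NC(3)[OF assms(1)] grow_facts(6)[OF assms(1)] by blast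
  then obtain a b where "a \<in> NC D" "b \<in> V - NC D" "b \<in> N a"
    using connected_cut[OF grow_NC(1)[OF assms(1)]] assms(2) by blast
  moreover have "a \<notin> D" using \<open>b \<in> V - NC D\<close> \<open>b \<in> N a\<close> by (auto simp: NC_def)
  ultimately show ?thesis by blast
qed

text \<open>Every added boundary vertex dominates at least one more vertex. One vertex may remain,
  because \<open>rx3_almost_dominated\<close> serves it at no extra cost.\<close>

lemma fill_up:
  assumes "grow D E" "card (V - NC D) \<le> Suc m"
  shows "\<exists>D' E'. grow D' E' \<and> card D' \<le> card D + m \<and> card (V - NC D') \<le> 1"
  using assms
proof (induction m arbitrary: D E)
  case 0
  then show ?case by auto
next
  case (Suc m)
  show ?case
  proof (cases "NC D = V")
    case True
    then show ?thesis using Suc.prems(1) by (intro exI[of _ D] exI[of _ E]) simp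
  next
    case False
    obtain u v where u: "u \<in> NC D - D" "v \<in> V - NC D" "v \<in> N u" using boundary_edge[OF Suc.prems(1) False] by blast
    obtain E' where E': "grow (insert u D) E'" using grow_add[OF Suc.prems(1) u(1)] .
    have "V - NC (insert u D) \<subseteq> (V - NC D) - {v}" using u NC_add[of u D] by auto
    then have "card (V - NC (insert u D)) \<le> card (V - NC D - {v})" using finV by (intro card_mono) auto
    also have "\<dots> \<le> Suc m" using Suc.prems(2) u(2) finV by simp
    finally obtain D' E'' where "grow D' E''" "card D' \<le> card (insert u D) + m" "card (V - NC D') \<le> 1"
      using Suc.IH[OF E'] by blast
    moreover have "card (insert u D) \<le> Suc (card D)" by (rule card_insert_le_m1) auto
    ultimately show ?thesis by (intro exI[of _ D'] exI[of _ E'']) auto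
  qed
qed

text \<open>Needed when the tree already contains all vertices, so that \<open>rx3_le\<close> finds
  no \<open>b\<close>. One more colour covers all edges outside the tree.\<close>

lemma rx3_spanning:
  assumes "grow V E" shows "rx3 G \<le> card V"
proof -
  note f = grow_facts[OF assms]
  obtain h :: "'a set \<Rightarrow> nat" where h: "bij_betw h E {..<card E}"
    using f(2) by (metis atLeast0LessThan ex_bij_betw_finite_nat)
  define c where "c = (\<lambda>e. if e \<in> E then h e else card E)"
  have "three_rainbow_coloring G c" unfolding three_rainbow_coloring_def
  proof (intro allI impI exI conjI)
    show "is_tree \<lparr>verts = V, edges = E\<rparr>" by (rule grow_tree[OF assms])
    show "subgraph \<lparr>verts = V, edges = E\<rparr> G" using f by (simp add: subgraph_def)
    show "rainbow c \<lparr>verts = V, edges = E\<rparr>"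
      using h by (auto simp: rainbow_def inj_on_def c_def bij_betw_def)
  qed auto
  then have "rx3 G \<le> card (c ` edges G)" by (rule rx3_le_colours)
  also have "c ` edges G \<subseteq> {..card E}" using h by (auto simp: c_def bij_betw_def dest: less_imp_le)
  then have "card (c ` edges G) \<le> card {..card E}" by (intro card_mono) auto
  also have "\<dots> = card V" using f(7) by simp
  finally show ?thesis .
qed

lemma rx3_few_left:
  assumes g: "grow D E" and deg: "\<And>x. x \<in> V \<Longrightarrow> 4 \<le> card (N x)" and m: "card (V - NC D) \<le> Suc m"
  shows "rx3 G \<le> card D + m + 5"
proof -
  obtain D' E' where D': "grow D' E'" "card D' \<le> card D + m" "card (V - NC D') \<le> 1"
    using fill_up[OF g m] by blast
  have pos: "0 < card D'" using grow_facts(1,6)[OF D'(1)] by (simp add: card_gt_0_iff)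
  have "rx3 G \<le> card D' - 1 + 6"
  proof (cases "NC D' = V")
    case True
    show ?thesis
    proof (cases "D' = V")
      case True
      then show ?thesis using rx3_spanning D'(1) by force
    next
      case False
      show ?thesis by (rule rx3_dominated[OF D'(1) True False]) (use deg in force)
    qed
  next
    case False
    then have "card (V - NC D') \<noteq> 0" using finV grow_NC(1)[OF D'(1)] by auto
    then have "card (V - NC D') = 1" using D'(3) by linarith
    then obtain v where "V - NC D' = {v}" by (meson card_1_singletonE)
    then show ?thesis by (rule rx3_almost_dominated[OF D'(1) _ deg])
  qed
  then show ?thesis using D'(2) pos by linarith
qed

lemma two_outside:
  assumes g: "grow D E" and v: "v \<in> V - NC D" "u \<in> N v \<inter> NC D" "k \<le> card (N v - NC D)"
  shows "\<exists>D' E'. grow D' E' \<and> card D' = card D + 2 \<and> card (NC D) + Suc k \<le> card (NC D') \<and>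
    card (V - NC D') + Suc k \<le> card (V - NC D)"
proof -
  have u: "u \<in> NC D - D" using v N_sym by (auto simp: NC_def)
  obtain E1 where E1: "grow (insert u D) E1" using grow_add[OF g u] .
  have vu: "v \<in> N u" using v N_sym by blast
  have v2: "v \<in> NC (insert u D) - insert u D" using v u vu by (auto simp: NC_def)
  obtain E2 where E2: "grow (insert v (insert u D)) E2" using grow_add[OF E1 v2] .
  let ?D = "insert v (insert u D)"
  have fD: "finite D" using grow_facts(1)[OF g] .
  have "v \<noteq> u" using vu by auto
  then have cD: "card ?D = card D + 2" using v2 u fD by simp
  have sub: "NC D \<union> insert v (N v - NC D) \<subseteq> NC ?D" by (auto simp: NC_def)
  have fN: "finite (NC ?D)" using grow_NC(2)[OF E2] .
  have "card (NC D \<union> insert v (N v - NC D)) = card (NC D) + Suc (card (N v - NC D))"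
    using v grow_NC(2)[OF g] by (subst card_Un_disjoint) auto
  then have c1: "card (NC D) + Suc k \<le> card (NC ?D)" using card_mono[OF fN sub] v(3) by linarith
  then have "card (V - NC ?D) + Suc k \<le> card (V - NC D)" using grow_NC(4)[OF g] grow_NC(4)[OF E2] by linarith
  then show ?thesis using E2 cD c1 by blast
qed

text \<open>Among the trees whose closed neighbourhood is large compared with their size, take one with the largest
  neighbourhood: no extension by one, two or three vertices keeps the ratio.\<close>

lemma greedy:
  assumes g0: "grow D0 E0" "\<beta> * card D0 + \<gamma> \<le> \<alpha> * card (NC D0)"
    and deg: "\<And>x. x \<in> V \<Longrightarrow> m \<le> card (N x)"
    and ratio: "\<beta> \<le> 2 * \<alpha>" "3 * \<beta> \<le> \<alpha> * Suc m"
  obtains D E where "grow D E" "\<beta> * card D + \<gamma> \<le> \<alpha> * card (NC D)"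
    "\<And>u. u \<in> NC D - D \<Longrightarrow> card (N u - NC D) \<le> 1"
    "\<And>v. v \<in> V - NC D \<Longrightarrow> card (N v - NC D) \<le> 2"
    "\<And>v. v \<in> V - NC D \<Longrightarrow> N v \<inter> NC D \<noteq> {}"
proof -
  let ?P = "\<lambda>q. grow (fst q) (snd q) \<and> \<beta> * card (fst q) + \<gamma> \<le> \<alpha> * card (NC (fst q))"
  have "\<exists>q. ?P q \<and> (\<forall>q'. ?P q' \<longrightarrow> card (NC (fst q')) \<le> card (NC (fst q)))"
    by (rule ex_has_greatest_nat[of ?P "(D0, E0)" _ "Suc (card V)"])
      (use g0 grow_NC(1) finV in \<open>auto simp: less_Suc_eq_le intro: card_mono\<close>)
  then obtain q where q: "?P q \<and> (\<forall>q'. ?P q' \<longrightarrow> card (NC (fst q')) \<le> card (NC (fst q)))" by (elim exE)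
  define D E where "D = fst q" and "E = snd q"
  have g: "grow D E" "\<beta> * card D + \<gamma> \<le> \<alpha> * card (NC D)" using q by (simp_all add: D_def E_def)
  have mx: "\<not> \<beta> * card D' + \<gamma> \<le> \<alpha> * card (NC D')" if "grow D' E'" "card (NC D) < card (NC D')" for D' E'
    using q that by (metis D_def fst_conv not_less snd_conv)
  \<comment> \<open>The ratio survives when \<open>i\<close> new vertices dominate \<open>j\<close>
    more and \<open>\<beta> * i \<le> \<alpha> * j\<close>. The two ratio hypotheses provide this
    for one vertex gaining 2, two gaining 4, and three gaining \<open>Suc m\<close>.\<close>
  have gain: False if "grow D' E'" "card D' = card D + i" "card (NC D) + j \<le> card (NC D')" "\<beta> * i \<le> \<alpha> * j" "0 < j" for D' E' i j
  proof -
    have "\<alpha> * (card (NC D) + j) \<le> \<alpha> * card (NC D')" using that(3) by (rule mult_le_mono2)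
    then have "\<beta> * card D' + \<gamma> \<le> \<alpha> * card (NC D')" using that(2,4) g(2) by (simp add: algebra_simps)
    then show False using mx[OF that(1)] that(3,5) by simp
  qed
  have fD: "finite D" using grow_facts(1)[OF g(1)] .
  have r1: "card (N u - NC D) \<le> 1" if u: "u \<in> NC D - D" for u
  proof (rule ccontr)
    assume k: "\<not> ?thesis"
    obtain E' where E': "grow (insert u D) E'" using grow_add[OF g(1) u] .
    have "NC (insert u D) = NC D \<union> (N u - NC D)" using NC_add u by auto
    then have "card (NC (insert u D)) = card (NC D) + card (N u - NC D)"
      using grow_NC(2)[OF g(1)] by (subst \<open>NC (insert u D) = _\<close>, subst card_Un_disjoint) auto
    then show False using k u fD ratio(1) by (intro gain[OF E', of 1 2]) auto
  qed
  have near: "N v \<inter> NC D \<noteq> {}" if v: "v \<in> V - NC D" for v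
  proof
    assume e: "N v \<inter> NC D = {}"
    \<comment> \<open>\<open>A\<close> is the set of vertices at distance at most two from
      \<open>D\<close>. If \<open>v\<close> is farther away, some edge leads from \<open>A\<close>
      to a vertex \<open>b\<close> outside; adding the path \<open>u\<close>, \<open>a\<close>,
      \<open>b\<close> gains \<open>b\<close> and its entire neighbourhood.\<close>
    define A where "A = NC D \<union> {x \<in> V. N x \<inter> NC D \<noteq> {}}"
    have "A \<subseteq> V" "A \<noteq> {}" "A \<noteq> V"
      using grow_NC(1,3)[OF g(1)] grow_facts(6)[OF g(1)] v e by (auto simp: A_def)
    then obtain a b where ab: "a \<in> A" "b \<in> V - A" "b \<in> N a" using connected_cut by meson
    have aN: "a \<notin> NC D"
    proof
      assume "a \<in> NC D"
      moreover have "a \<in> N b" using ab(3) N_sym by blast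
      ultimately show False using ab(2) by (auto simp: A_def)
    qed
    then obtain u where u: "u \<in> N a" "u \<in> NC D" using ab(1) by (auto simp: A_def)
    have b: "b \<notin> NC D" "N b \<inter> NC D = {}" "b \<in> V" using ab(2) by (auto simp: A_def)
    have uD: "u \<in> NC D - D" using u aN N_sym by (auto simp: NC_def)
    obtain E1 where E1: "grow (insert u D) E1" using grow_add[OF g(1) uD] .
    have "a \<in> N u" using u N_sym by blast
    then have "a \<in> NC (insert u D) - insert u D" using aN u uD by (auto simp: NC_def)
    then obtain E2 where E2: "grow (insert a (insert u D)) E2" using grow_add[OF E1] by blast
    have ba: "b \<notin> insert a (insert u D)" using b u ab(3) N_irrefl by (auto simp: NC_def)
    then have "b \<in> NC (insert a (insert u D)) - insert a (insert u D)" using ab(3) by (auto simp: NC_def)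
    then obtain E3 where E3: "grow (insert b (insert a (insert u D))) E3" using grow_add[OF E2] by blast
    let ?D = "insert b (insert a (insert u D))"
    have "a \<noteq> u" using u by auto
    moreover have "a \<notin> D" using aN by (auto simp: NC_def)
    ultimately have cD: "card ?D = card D + 3" using ba uD fD by simp
    have sub: "NC D \<union> insert b (N b) \<subseteq> NC ?D" by (auto simp: NC_def)
    have "card (NC D \<union> insert b (N b)) = card (NC D) + Suc (card (N b))"
      using b grow_NC(2)[OF g(1)] by (subst card_Un_disjoint) auto
    then have "card (NC D) + Suc m \<le> card (NC ?D)"
      using card_mono[OF grow_NC(2)[OF E3] sub] deg[OF b(3)] by linarith
    then show False using ratio(2) by (intro gain[OF E3 cD, of "Suc m"]) (auto simp: mult.commute)
  qed
  have r2: "card (N v - NC D) \<le> 2" if v: "v \<in> V - NC D" for v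
  proof (rule ccontr)
    assume "\<not> ?thesis"
    then have k: "3 \<le> card (N v - NC D)" by simp
    obtain u where u: "u \<in> N v \<inter> NC D" using near[OF v] by blast
    obtain D' E' where D': "grow D' E'" "card D' = card D + 2" "card (NC D) + Suc 3 \<le> card (NC D')"
      using two_outside[OF g(1) v u k] by blast
    show False by (rule gain[OF D']) (use ratio(1) in auto)
  qed
  show ?thesis by (rule that[OF g r1 r2 near])
qed

section \<open>Degree counts, parity and minimum degree five\<close>

lemma card_inter_outside:
  "card (N v) = card (N v \<inter> NC D) + card (N v - NC D)"
  using card_Un_disjoint[of "N v \<inter> NC D" "N v - NC D"] by (auto simp: Int_Diff_Un)

lemma grow_edge:
  assumes "x \<in> V" "y \<in> N x" shows "grow {x, y} {{x, y}}" "NC {x, y} = N x \<union> N y"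
proof -
  have "y \<noteq> x" using assms N_irrefl by blast
  then have "grow (insert y {x}) (insert {x, y} {})" using assms by (intro grow.step grow.base) auto
  then show "grow {x, y} {{x, y}}" by (simp add: insert_commute)
  show "NC {x, y} = N x \<union> N y" using assms N_sym by (auto simp: NC_def)
qed

lemma NC_single: "card (NC {x}) = Suc (card (N x))"
  by (simp add: NC_def)

lemma even_degree_sum: "even (\<Sum>v\<in>V. card (N v))"
proof -
  have "(\<Sum>v\<in>V. card (N v)) = (\<Sum>v\<in>V. \<Sum>e\<in>edges G. if v \<in> e then 1 else 0)"
    using finE by (simp flip: degree_N add: degree_def sum.If_cases Int_def)
  also have "\<dots> = (\<Sum>e\<in>edges G. \<Sum>v\<in>V. if v \<in> e then 1 else 0)" by (rule sum.swap)
  also have "\<dots> = (\<Sum>e\<in>edges G. 2)"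
  proof (rule sum.cong)
    fix e assume "e \<in> edges G"
    then have "V \<inter> {v. v \<in> e} = e" "card e = 2" using sg by (auto simp: simple_graph_def)
    then show "(\<Sum>v\<in>V. if v \<in> e then 1 else 0) = (2::nat)" using finV by (simp add: sum.If_cases)
  qed simp
  finally show ?thesis by simp
qed

text \<open>In the cubic and the 5-regular case the counting misses the target by one; parity rounds
  it down.\<close>

lemma even_order:
  assumes "\<And>v. v \<in> V \<Longrightarrow> card (N v) = r" "odd r" shows "even (card V)"
  using even_degree_sum assms by simp

text \<open>At most \<open>r\<close> of at least \<open>r + 3\<close> neighbours of an outer vertex
  are outside \<open>NC D\<close>, which leaves the three that \<open>rx3_tokens\<close>
  needs.\<close>

lemma rx3_private:
  assumes g: "grow D E" and W: "V \<noteq> NC D" and deg: "\<And>x. x \<in> V \<Longrightarrow> r + 3 \<le> card (N x)" and r: "1 \<le> r"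
    and priv: "\<And>u. u \<in> NC D - D \<Longrightarrow> card (N u - NC D) \<le> 1"
    and few: "\<And>v. v \<in> V - NC D \<Longrightarrow> card (N v - NC D) \<le> r"
  shows "rx3 G \<le> card D + 8"
proof -
  have pos: "0 < card D" using grow_facts(1,6)[OF g] by (simp add: card_gt_0_iff)
  have "rx3 G \<le> card D - 1 + 9"
  proof (rule rx3_tokens[OF g W _ priv])
    show "4 \<le> card (N x)" if "x \<in> V" for x using deg[OF that] r by linarith
    show "3 \<le> card (N v \<inter> NC D)" if v: "v \<in> V - NC D" for v
    proof -
      have "r + 3 \<le> card (N v)" using deg v by blast
      then show ?thesis using card_inter_outside[of v D] few[OF v] by linarith
    qed
  qed
  then show ?thesis using pos by linarith
qed

text \<open>One colour cheaper than filling up. As 5 + 5 exceeds 9, adjacent vertices have a common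
  neighbour. If an outer vertex has two outer neighbours, two added vertices leave at most one
  undominated. Otherwise the outer vertices are independent: the common neighbour of an outer edge
  would have two outer neighbours, or be itself a second outer neighbour of an end. Then
  \<open>rx3_four_left\<close> applies.\<close>

lemma four_left:
  assumes g: "grow D E" and deg: "\<And>x. x \<in> V \<Longrightarrow> 5 \<le> card (N x)"
    and t: "card (V - NC D) = 4"
    and priv: "\<And>u. u \<in> NC D - D \<Longrightarrow> card (N u - NC D) \<le> 1"
    and near: "\<And>v. v \<in> V - NC D \<Longrightarrow> N v \<inter> NC D \<noteq> {}"
    and dense: "\<And>x y. x \<in> V \<Longrightarrow> y \<in> N x \<Longrightarrow> card (N x \<union> N y) \<le> 9"
  shows "rx3 G \<le> card D + 7"
proof -
  have pos: "0 < card D" using grow_facts(1,6)[OF g] by (simp add: card_gt_0_iff)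
  have deg4: "\<And>x. x \<in> V \<Longrightarrow> 4 \<le> card (N x)" using deg by fastforce
  have common: "N x \<inter> N y \<noteq> {}" if x: "x \<in> V" and y: "y \<in> N x" for x y
  proof
    assume e: "N x \<inter> N y = {}"
    have "card (N x \<union> N y) = card (N x) + card (N y)" by (rule card_Un_disjoint) (use e in auto)
    moreover have "y \<in> V" using y N_V by blast
    ultimately show False using deg[of x] deg[of y] x dense[OF x y] by simp
  qed
  show ?thesis
  proof (cases "\<exists>v\<in>V - NC D. 2 \<le> card (N v - NC D)")
    case True
    then obtain v where v: "v \<in> V - NC D" "2 \<le> card (N v - NC D)" by blast
    obtain u where u: "u \<in> N v \<inter> NC D" using near[OF v(1)] by blast
    obtain D' E' where D': "grow D' E'" "card D' = card D + 2" "card (V - NC D') + Suc 2 \<le> card (V - NC D)"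
      using two_outside[OF g v(1) u v(2)] by blast
    have "card (V - NC D') \<le> Suc 0" using D'(3) t by simp
    then have "rx3 G \<le> card D' + 0 + 5" by (intro rx3_few_left[OF D'(1) deg4])
    then show ?thesis using D'(2) by simp
  next
    case False
    have ind: "N v \<subseteq> NC D" if v: "v \<in> V - NC D" for v
    proof
      fix w assume w: "w \<in> N v"
      show "w \<in> NC D"
      proof (rule ccontr)
        assume nw: "w \<notin> NC D"
        have vV: "v \<in> V" using v by blast
        obtain x where x: "x \<in> N v" "x \<in> N w" using common[OF vV w] by blast
        have sub: "{v, w} \<subseteq> N x" using x N_sym by blast
        have vw: "v \<noteq> w" using w by auto
        show False
        proof (cases "x \<in> NC D")
          case True
          then have xb: "x \<in> NC D - D" using x v N_sym by (auto simp: NC_def)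
          have "card {v, w} \<le> card (N x - NC D)" by (rule card_mono) (use sub v nw in auto)
          then show False using priv[OF xb] vw by simp
        next
          case xn: False
          have "x \<noteq> w" using x by auto
          have "card {w, x} \<le> card (N v - NC D)" by (rule card_mono) (use w x nw xn in auto)
          moreover have "card {w, x} = 2" using \<open>x \<noteq> w\<close> by auto
          ultimately have "2 \<le> card (N v - NC D)" by linarith
          then show False using False v by blast
        qed
      qed
    qed
    have fin: "finite (V - NC D)" using finV by simp
    obtain v1 T1 where 1: "V - NC D = insert v1 T1" "v1 \<notin> T1" "card T1 = 3" "finite T1"
      using card_eq_SucD[of "V - NC D" 3] t fin by (metis Suc_numeral finite_insert semiring_norm(2,8))
    obtain v2 v3 v4 where 2: "T1 = {v2, v3, v4}" using 1(3) by (auto simp: card_3_iff)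
    have "rx3 G \<le> card D - 1 + 8"
    proof (rule rx3_four_left[OF g _ t deg priv ind])
      show "V - NC D = {v1, v2, v3, v4}" using 1 2 by simp
      show "\<exists>u\<in>N v. \<exists>u'\<in>N v. u' \<in> N u" if v: "v \<in> V - NC D" for v
      proof -
        obtain u where u: "u \<in> N v" using near[OF v] by blast
        have "v \<in> V" using v by blast
        then show ?thesis using common[OF _ u] u by blast
      qed
    qed auto
    then show ?thesis using pos by linarith
  qed
qed

text \<open>Suppose \<open>2 * card D + \<gamma> \<le> card (NC D)\<close> and \<open>t > 0\<close>
  vertices are undominated. Then \<open>few\<close>, with \<open>t + 4\<close> colours beyond
  \<open>card D\<close>, reaches the target for \<open>t \<le> \<gamma> - 2\<close>, and 8 colours
  beyond \<open>card D\<close> reach it for \<open>t \<ge> 10 - \<gamma>\<close>. An edge with ten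
  neighbours gives \<open>\<gamma> = 6\<close> and no gap; a vertex of degree 6 gives 5, with
  \<open>t = 4\<close> left to \<open>seven\<close>; the 5-regular case gives 4 and is rounded by
  parity.\<close>

lemma bound5:
  assumes deg: "\<And>x. x \<in> V \<Longrightarrow> 5 \<le> card (N x)"
  shows "2 * rx3 G \<le> card V + 6"
proof -
  have deg4: "\<And>x. x \<in> V \<Longrightarrow> 4 \<le> card (N x)" using deg by fastforce
  have few: "rx3 G \<le> card D + (card (V - NC D) - 1) + 5" if "grow D E" for D E
    by (rule rx3_few_left[OF that deg4]) auto
  have many: "rx3 G \<le> card D + 8"
    if "grow D E" "\<And>u. u \<in> NC D - D \<Longrightarrow> card (N u - NC D) \<le> 1" "\<And>v. v \<in> V - NC D \<Longrightarrow> card (N v - NC D) \<le> 2"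
      "5 \<le> card (V - NC D)" for D E
  proof (rule rx3_private[OF that(1) _ _ _ that(2,3)])
    show "V \<noteq> NC D" using that(4) by auto
  qed (use deg in simp_all)
  obtain x0 where x0: "x0 \<in> V" using con by (auto simp: connected_graph_def)
  show ?thesis
  proof (cases "\<exists>x\<in>V. \<exists>y\<in>N x. 10 \<le> card (N x \<union> N y)")
    case True
    then obtain x y where xy: "x \<in> V" "y \<in> N x" "10 \<le> card (N x \<union> N y)" by blast
    have "y \<noteq> x" using xy(2) by auto
    then have "2 * card {x, y} + 6 \<le> 1 * card (NC {x, y})" using xy grow_edge(2)[OF xy(1,2)] by simp
    then obtain D E where D: "grow D E" "2 * card D + 6 \<le> 1 * card (NC D)"
      "\<And>u. u \<in> NC D - D \<Longrightarrow> card (N u - NC D) \<le> 1" "\<And>v. v \<in> V - NC D \<Longrightarrow> card (N v - NC D) \<le> 2"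
      by (rule greedy[OF grow_edge(1)[OF xy(1,2)] _ deg _ _ that]) simp_all
    show ?thesis using few[OF D(1)] many[OF D(1,3,4)] D(2) grow_NC(4)[OF D(1)]
      by (cases "5 \<le> card (V - NC D)") auto
  next
    case dense: False
    have dn: "card (N x \<union> N y) \<le> 9" if "x \<in> V" "y \<in> N x" for x y
    proof -
      have "\<not> 10 \<le> card (N x \<union> N y)" using dense that by blast
      then show ?thesis by simp
    qed
    have seven: "rx3 G \<le> card D + 7"
      if "grow D E" "card (V - NC D) = 4" "\<And>u. u \<in> NC D - D \<Longrightarrow> card (N u - NC D) \<le> 1"
        "\<And>v. v \<in> V - NC D \<Longrightarrow> N v \<inter> NC D \<noteq> {}" for D E
      by (rule four_left[OF that(1) deg that(2,3,4) dn])
    show ?thesis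
    proof (cases "\<exists>x\<in>V. 6 \<le> card (N x)")
      case True
      then obtain x where x: "x \<in> V" "6 \<le> card (N x)" by blast
      have "2 * card {x} + 5 \<le> 1 * card (NC {x})" using x NC_single by simp
      then obtain D E where D: "grow D E" "2 * card D + 5 \<le> 1 * card (NC D)"
        "\<And>u. u \<in> NC D - D \<Longrightarrow> card (N u - NC D) \<le> 1" "\<And>v. v \<in> V - NC D \<Longrightarrow> card (N v - NC D) \<le> 2"
        "\<And>v. v \<in> V - NC D \<Longrightarrow> N v \<inter> NC D \<noteq> {}"
        by (rule greedy[OF grow.base[OF x(1)] _ deg _ _ that]) simp_all
      consider "card (V - NC D) \<le> 3" | "card (V - NC D) = 4" | "5 \<le> card (V - NC D)" by linarith
      then show ?thesis
        using few[OF D(1)] many[OF D(1,3,4)] seven[OF D(1) _ D(3,5)] D(2) grow_NC(4)[OF D(1)] by cases auto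
    next
      case False
      have d5: "card (N x) = 5" if "x \<in> V" for x
      proof -
        have "\<not> 6 \<le> card (N x)" using False that by blast
        then show ?thesis using deg[OF that] by linarith
      qed
      have ev: "even (card V)" by (rule even_order[OF d5]) auto
      have "2 * card {x0} + 4 \<le> 1 * card (NC {x0})" using d5[OF x0] NC_single by simp
      then obtain D E where D: "grow D E" "2 * card D + 4 \<le> 1 * card (NC D)"
        "\<And>u. u \<in> NC D - D \<Longrightarrow> card (N u - NC D) \<le> 1" "\<And>v. v \<in> V - NC D \<Longrightarrow> card (N v - NC D) \<le> 2"
        "\<And>v. v \<in> V - NC D \<Longrightarrow> N v \<inter> NC D \<noteq> {}"
        by (rule greedy[OF grow.base[OF x0] _ deg _ _ that]) simp_all
      consider "card (V - NC D) \<le> 3" | "card (V - NC D) = 4" | "5 \<le> card (V - NC D)" by linarith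
      then have "2 * rx3 G \<le> card V + 7"
        using few[OF D(1)] many[OF D(1,3,4)] seven[OF D(1) _ D(3,5)] D(2) grow_NC(4)[OF D(1)] by cases auto
      then show ?thesis using ev by presburger
    qed
  qed
qed

section \<open>Minimum degree four\<close>

text \<open>Only the octahedron is possible. For \<open>f\<close> in \<open>D\<close> adjacent to
  \<open>u\<close>, each common neighbour \<open>x\<close> of \<open>v\<close> and \<open>f\<close>
  is allowed two neighbours outside \<open>N v\<close>, which are \<open>v\<close> and
  \<open>f\<close>, and likewise for \<open>N f\<close>. So its other two neighbours lie in
  \<open>A\<close>, and \<open>A\<close> has three or four elements. With four, \<open>A\<close>
  together with \<open>v\<close> and \<open>f\<close> is closed under adjacency. With three, the
  fourth neighbour \<open>z\<close> of \<open>v\<close> has no neighbour in \<open>N v\<close>, too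
  many differences.\<close>

lemma dense_four_regular:
  assumes reg: "\<And>x. x \<in> V \<Longrightarrow> card (N x) = 4"
    and dense: "\<And>x y. x \<in> V \<Longrightarrow> y \<in> N x \<Longrightarrow> card (N x \<union> N y) \<le> 6"
    and v: "v \<in> V - NC D" "u \<in> N v" "u \<in> NC D"
  shows "card (V - NC D) \<le> 1"
proof -
  have vD: "v \<notin> NC D" "v \<in> V" using v by auto
  have uD: "u \<notin> D" using v(1,2) N_sym by (auto simp: NC_def)
  obtain f where f: "f \<in> D" "u \<in> N f" using v(3) uD by (auto simp: NC_def)
  have fV: "f \<in> V" using f(2) N_V by blast
  have fv: "f \<notin> N v" "v \<notin> N f" "f \<noteq> v" using f(1) vD(1) N_sym by (auto simp: NC_def)
  have diff: "card (N y - N x) \<le> 2" if "x \<in> V" "y \<in> N x" for x y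
  proof -
    have "card (N x \<union> N y) = card (N x) + card (N y - N x)"
      by (subst card_Un_disjoint[symmetric]) auto
    then show ?thesis using dense[OF that] reg[OF that(1)] by linarith
  qed
  define A where "A = N v \<inter> N f"
  have fA: "finite A" by (simp add: A_def)
  have Nx: "N x \<subseteq> insert v (insert f A)" if x: "x \<in> A" for x
  proof -
    have xv: "v \<in> N x" "f \<in> N x" using x N_sym by (auto simp: A_def)
    have "card (N x - N v) \<le> 2" using diff[of v x] x vD by (simp add: A_def)
    moreover have "{v, f} \<subseteq> N x - N v" using xv fv by auto
    ultimately have 1: "N x - N v = {v, f}" using fv(3) by (intro card_seteq[symmetric]) auto
    have "card (N x - N f) \<le> 2" using diff[of f x] x fV by (simp add: A_def)
    moreover have "{v, f} \<subseteq> N x - N f" using xv fv by auto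
    ultimately have 2: "N x - N f = {v, f}" using fv(3) by (intro card_seteq[symmetric]) auto
    show ?thesis using 1 2 unfolding A_def by blast
  qed
  have Nx': "card (N x - {v, f}) = 2" if x: "x \<in> A" for x
  proof -
    have "{v, f} \<subseteq> N x" using x N_sym by (auto simp: A_def)
    moreover have "x \<in> V" using x N_V by (auto simp: A_def)
    ultimately show ?thesis using reg fv(3) by (simp add: card_Diff_subset)
  qed
  have uA: "u \<in> A" using v(2) f(2) by (simp add: A_def)
  have A4: "card A \<le> 4" using card_mono[of "N v" A] reg[OF vD(2)] by (auto simp: A_def)
  have A3: "3 \<le> card A"
  proof -
    have "N u - {v, f} \<subseteq> A - {u}" using Nx[OF uA] by auto
    then have "card (N u - {v, f}) \<le> card (A - {u})" using fA by (intro card_mono) auto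
    then show ?thesis using Nx'[OF uA] uA fA by simp
  qed
  show ?thesis
  proof (cases "card A = 4")
    case True
    have 1: "N v = A" "N f = A"
      using True reg[OF vD(2)] reg[OF fV] card_subset_eq[of "N v" A] card_subset_eq[of "N f" A] by (auto simp: A_def)
    have "insert v (insert f A) = V"
    proof (rule ccontr)
      assume n: "insert v (insert f A) \<noteq> V"
      have "insert v (insert f A) \<subseteq> V" using vD fV N_sub by (auto simp: A_def)
      then obtain a b where "a \<in> insert v (insert f A)" "b \<in> V - insert v (insert f A)" "b \<in> N a"
        using connected_cut[of "insert v (insert f A)"] n by blast
      then show False using 1 Nx by blast
    qed
    moreover have "A \<subseteq> NC D" "f \<in> NC D" using f(1) 1 by (auto simp: NC_def)
    ultimately have "V - NC D \<subseteq> {v}" by blast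
    then have "card (V - NC D) \<le> card {v}" by (intro card_mono) auto
    then show ?thesis by simp
  next
    case False
    then have c3: "card A = 3" using A3 A4 by linarith
    have "N v - A \<noteq> {}"
    proof
      assume "N v - A = {}"
      then have "card (N v) \<le> card A" using fA by (intro card_mono) auto
      then show False using c3 reg[OF vD(2)] by simp
    qed
    then obtain z where z: "z \<in> N v" "z \<notin> A" by blast
    have "card (insert z A) = card (N v)" using z c3 fA reg[OF vD(2)] by simp
    then have Nv: "N v = insert z A" using z by (intro card_subset_eq[symmetric]) (auto simp: A_def)
    have "N z \<inter> N v = {}"
    proof (rule ccontr)
      assume "N z \<inter> N v \<noteq> {}"
      then obtain x where x: "x \<in> N z" "x \<in> N v" by blast
      then have "x \<in> A" using Nv by auto
      moreover have "z \<in> N x" using x N_sym by blast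
      ultimately have "z \<in> insert v (insert f A)" using Nx by blast
      then show False using z fv by auto
    qed
    then have "N z - N v = N z" by blast
    moreover have "z \<in> V" using z N_V by blast
    ultimately have False using diff[OF vD(2) z(1)] reg[of z] by simp
    then show ?thesis ..
  qed
qed

text \<open>The constant 11 is \<open>3 * 7 - 5 * 2\<close>, from an edge with seven neighbours; a
  vertex of degree 5 gives even 13. It lets \<open>few\<close> reach up to four undominated
  vertices, \<open>five\<close> handle five and \<open>many\<close> the rest. Failing that, the
  graph is 4-regular and dense, at most one vertex stays undominated, and
  \<open>10 = 3 * 5 - 5\<close> suffices.\<close>

lemma bound4:
  assumes deg: "\<And>x. x \<in> V \<Longrightarrow> 4 \<le> card (N x)"
  shows "5 * rx3 G \<le> 3 * card V + 17"
proof -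
  have few: "rx3 G \<le> card D + (card (V - NC D) - 1) + 5" if "grow D E" for D E
    by (rule rx3_few_left[OF that deg]) auto
  have five: "rx3 G \<le> card D + 8"
    if D: "grow D E" "\<And>u. u \<in> NC D - D \<Longrightarrow> card (N u - NC D) \<le> 1" "\<And>v. v \<in> V - NC D \<Longrightarrow> N v \<inter> NC D \<noteq> {}"
      "card (V - NC D) = 5" for D E
  proof (cases "\<exists>v\<in>V - NC D. 2 \<le> card (N v - NC D)")
    case True
    then obtain v where v: "v \<in> V - NC D" "2 \<le> card (N v - NC D)" by blast
    obtain u where u: "u \<in> N v \<inter> NC D" using D(3)[OF v(1)] by blast
    obtain D' E' where D': "grow D' E'" "card D' = card D + 2" "card (V - NC D') + Suc 2 \<le> card (V - NC D)"
      using two_outside[OF D(1) v(1) u v(2)] by blast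
    have "card (V - NC D') \<le> Suc 1" using D'(3) D(4) by simp
    then have "rx3 G \<le> card D' + 1 + 5" by (intro rx3_few_left[OF D'(1) deg])
    then show ?thesis using D'(2) by simp
  next
    case False
    show ?thesis
    proof (rule rx3_private[OF D(1) _ _ _ D(2)])
      show "V \<noteq> NC D" using D(4) by auto
      show "card (N v - NC D) \<le> 1" if "v \<in> V - NC D" for v
      proof -
        have "\<not> 2 \<le> card (N v - NC D)" using False that by blast
        then show ?thesis by simp
      qed
    qed (use deg in simp_all)
  qed
  have many: "rx3 G \<le> card D + 9"
    if D: "grow D E" "\<And>u. u \<in> NC D - D \<Longrightarrow> card (N u - NC D) \<le> 1" "\<And>v. v \<in> V - NC D \<Longrightarrow> card (N v - NC D) \<le> 2"
      "6 \<le> card (V - NC D)" for D E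
  proof -
    have pos: "0 < card D" using grow_facts(1,6)[OF D(1)] by (simp add: card_gt_0_iff)
    have "rx3 G \<le> card D - 1 + 10"
    proof (rule rx3_tokens2[OF D(1) _ deg D(2)])
      show "V \<noteq> NC D" using D(4) by auto
      show "2 \<le> card (N v \<inter> NC D)" if v: "v \<in> V - NC D" for v
      proof -
        have "4 \<le> card (N v)" using deg v by blast
        then show ?thesis using card_inter_outside[of v D] D(3)[OF v] by linarith
      qed
    qed auto
    then show ?thesis using pos by linarith
  qed
  obtain x0 where x0: "x0 \<in> V" using con by (auto simp: connected_graph_def)
  show ?thesis
  proof (cases "\<exists>D0 E0. grow D0 E0 \<and> 5 * card D0 + 11 \<le> 3 * card (NC D0)")
    case True
    then obtain D0 E0 where D0: "grow D0 E0" "5 * card D0 + 11 \<le> 3 * card (NC D0)" by blast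
    obtain D E where D: "grow D E" "5 * card D + 11 \<le> 3 * card (NC D)"
      "\<And>u. u \<in> NC D - D \<Longrightarrow> card (N u - NC D) \<le> 1" "\<And>v. v \<in> V - NC D \<Longrightarrow> card (N v - NC D) \<le> 2"
      "\<And>v. v \<in> V - NC D \<Longrightarrow> N v \<inter> NC D \<noteq> {}"
      by (rule greedy[OF D0 deg _ _ that]) simp_all
    consider "card (V - NC D) \<le> 4" | "card (V - NC D) = 5" | "6 \<le> card (V - NC D)" by linarith
    then show ?thesis
      using few[OF D(1)] many[OF D(1,3,4)] five[OF D(1,3,5)] D(2) grow_NC(4)[OF D(1)] by cases auto
  next
    case False
    have reg: "card (N x) = 4" if "x \<in> V" for x
    proof -
      have "\<not> 5 * card {x} + 11 \<le> 3 * card (NC {x})" using False grow.base[OF that] by blast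
      then show ?thesis using deg[OF that] NC_single[of x] by simp
    qed
    have dense: "card (N x \<union> N y) \<le> 6" if "x \<in> V" "y \<in> N x" for x y
    proof -
      have "\<not> 5 * card {x, y} + 11 \<le> 3 * card (NC {x, y})" using False grow_edge(1)[OF that] by blast
      moreover have "y \<noteq> x" using that by auto
      ultimately show ?thesis using grow_edge(2)[OF that] by simp
    qed
    have "5 * card {x0} + 10 \<le> 3 * card (NC {x0})" using reg[OF x0] NC_single by simp
    then obtain D E where D: "grow D E" "5 * card D + 10 \<le> 3 * card (NC D)"
      "\<And>u. u \<in> NC D - D \<Longrightarrow> card (N u - NC D) \<le> 1" "\<And>v. v \<in> V - NC D \<Longrightarrow> card (N v - NC D) \<le> 2"
      "\<And>v. v \<in> V - NC D \<Longrightarrow> N v \<inter> NC D \<noteq> {}"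
      by (rule greedy[OF grow.base[OF x0] _ deg _ _ that]) simp_all
    have "card (V - NC D) \<le> 1"
    proof (cases "V - NC D = {}")
      case False
      then obtain v where v: "v \<in> V - NC D" by blast
      then obtain u where "u \<in> N v" "u \<in> NC D" using D(5) by blast
      then show ?thesis by (intro dense_four_regular[OF reg dense v])
    qed (metis card.empty zero_le)
    then show ?thesis using few[OF D(1)] D(2) grow_NC(4)[OF D(1)] by auto
  qed
qed

section \<open>Minimum degree three\<close>

definition alive :: "'a set \<Rightarrow> 'a set" where "alive D = {u \<in> NC D - D. \<not> N u \<subseteq> NC D}"

text \<open>Once \<open>D\<close> dominates, no vertex is alive and the potential is \<open>3 card V - 4 card D\<close>.\<close>

definition pot :: "'a set \<Rightarrow> int" where
  "pot D = 4 * int (card (NC D - D)) - int (card (alive D)) - int (card (NC D))"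

text \<open>If no boundary vertex has two outer neighbours, all boundary neighbours of
  \<open>v\<close> see only \<open>v\<close> outside and cease to be alive once \<open>v\<close> is
  dominated. That pays for adding \<open>u\<close>, and for \<open>v\<close> as well when
  \<open>v\<close> has two outer neighbours. After the last step nothing is alive, which yields the
  extra 2.\<close>

lemma bound3_step:
  assumes g: "grow D E" and n: "NC D \<noteq> V" and deg: "\<And>x. x \<in> V \<Longrightarrow> 3 \<le> card (N x)"
  shows "\<exists>D' E'. grow D' E' \<and> card (V - NC D') < card (V - NC D) \<and> pot D \<le> pot D' \<and>
    (NC D' = V \<longrightarrow> pot D + 2 \<le> pot D')"
proof -
  have fin: "finite (NC D)" "finite D" using grow_NC(2)[OF g] grow_facts(1)[OF g] by auto
  have fal: "finite (alive D)" using fin by (auto simp: alive_def intro: finite_subset)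
  have full: "alive D' = {}" if "NC D' = V" for D' using that N_sub by (auto simp: alive_def)
  have smaller: "card (V - NC D') < card (V - NC D)" if "grow D' E'" "NC D \<subset> NC D'" for D' E'
    using grow_NC(4)[OF g] grow_NC(4)[OF that(1)] psubset_card_mono[OF grow_NC(2)[OF that(1)] that(2)] by linarith
  show ?thesis
  proof (cases "\<exists>u\<in>NC D - D. 2 \<le> card (N u - NC D)")
    case True
    then obtain u where u: "u \<in> NC D - D" "2 \<le> card (N u - NC D)" by blast
    obtain E' where E': "grow (insert u D) E'" using grow_add[OF g u(1)] .
    let ?D = "insert u D" and ?k = "card (N u - NC D)"
    have NCD: "NC ?D = NC D \<union> (N u - NC D)" using NC_add u(1) by auto
    have c1: "card (NC ?D) = card (NC D) + ?k" unfolding NCD using fin by (subst card_Un_disjoint) auto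
    have "NC ?D - ?D = (NC D - D - {u}) \<union> (N u - NC D)" unfolding NCD using u(1) grow_NC(3)[OF g] by auto
    moreover have "card ((NC D - D - {u}) \<union> (N u - NC D)) = card (NC D - D - {u}) + ?k"
      using fin by (subst card_Un_disjoint) auto
    moreover have "card (NC D - D - {u}) = card (NC D - D) - 1" using u(1) fin by simp
    moreover have p: "0 < card (NC D - D)" using u(1) fin by (auto simp: card_gt_0_iff)
    ultimately have c2: "int (card (NC ?D - ?D)) = int (card (NC D - D)) - 1 + int ?k" by simp
    have ua: "u \<in> alive D"
    proof -
      have "N u - NC D \<noteq> {}" using u(2) by (metis card.empty not_numeral_le_zero)
      then show ?thesis using u(1) by (auto simp: alive_def)
    qed
    have c4: "1 \<le> card (alive D)" using ua fal by (metis One_nat_def Suc_leI card_gt_0_iff empty_iff)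
    have "alive ?D \<subseteq> (alive D - {u}) \<union> (N u - NC D)" unfolding alive_def NCD using u(1) by auto
    then have "card (alive ?D) \<le> card ((alive D - {u}) \<union> (N u - NC D))" using fal by (intro card_mono) auto
    also have "\<dots> \<le> card (alive D - {u}) + ?k" by (rule card_Un_le)
    also have "\<dots> = card (alive D) - 1 + ?k" using ua fal by simp
    finally have c3: "int (card (alive ?D)) \<le> int (card (alive D)) - 1 + int ?k"
      using c4 by linarith
    have k2: "2 \<le> int ?k" using u(2) by simp
    have "pot D \<le> pot ?D" using c1 c2 c3 k2 unfolding pot_def by simp
    moreover have "NC ?D = V \<longrightarrow> pot D + 2 \<le> pot ?D"
    proof
      assume "NC ?D = V"
      then have "card (alive ?D) = 0" using full by simp
      then show "pot D + 2 \<le> pot ?D" using c1 c2 c4 k2 unfolding pot_def by linarith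
    qed
    moreover have "NC D \<subset> NC ?D" using c1 k2 NCD by (metis Un_upper1 add_cancel_right_right not_numeral_le_zero of_nat_0 psubsetI)
    ultimately show ?thesis using E' smaller[OF E'] by blast
  next
    case False
    have one: "card (N u - NC D) \<le> 1" if "u \<in> NC D - D" for u
    proof -
      have "\<not> 2 \<le> card (N u - NC D)" using False that by blast
      then show ?thesis by simp
    qed
    obtain u v where u: "u \<in> NC D - D" "v \<in> V - NC D" "v \<in> N u" using boundary_edge[OF g n] by blast
    have only: "N x - NC D = {v}" if "x \<in> NC D - D" "v \<in> N x" for x
    proof -
      have "{v} \<subseteq> N x - NC D" using that u(2) by blast
      then show ?thesis using one[OF that(1)] by (intro card_seteq[symmetric]) auto
    qed
    obtain E1 where E1: "grow (insert u D) E1" using grow_add[OF g u(1)] .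
    have NC1: "NC (insert u D) = insert v (NC D)" using NC_add[of u D] u(1) only[OF u(1,3)] by auto
    have vv: "v \<noteq> u" "v \<notin> D" using u grow_NC(3)[OF g] by auto
    have p: "0 < card (NC D - D)" using u(1) fin by (auto simp: card_gt_0_iff)
    let ?R = "N v \<inter> NC D" and ?k = "card (N v - NC D)"
    have RB: "?R \<subseteq> NC D - D" using u(2) N_sym by (auto simp: NC_def)
    have Ral: "?R \<subseteq> alive D" using RB u(2) N_sym unfolding alive_def by blast
    have rk: "3 \<le> card ?R + ?k" using deg[of v] card_inter_outside[of v D] u(2) by auto
    have uR: "u \<in> ?R" using u N_sym by blast
    have Rle: "card ?R \<le> card (alive D)" by (rule card_mono[OF fal Ral])
    have R1: "1 \<le> card ?R" using uR by (metis One_nat_def Suc_leI card_gt_0_iff empty_iff finN finite_Int)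
    have dl: "card (alive D - ?R) = card (alive D) - card ?R" using Ral by (simp add: card_Diff_subset)
    show ?thesis
    proof (cases "2 \<le> ?k")
      case True
      have v1: "v \<in> NC (insert u D) - insert u D" using NC1 vv by simp
      obtain E2 where E2: "grow (insert v (insert u D)) E2" using grow_add[OF E1 v1] .
      let ?D = "insert v (insert u D)"
      have NC2: "NC ?D = NC D \<union> insert v (N v - NC D)" using NC_add[of v "insert u D"] NC1 by auto
      have c1: "card (NC ?D) = card (NC D) + Suc ?k" unfolding NC2 using fin u(2) by (subst card_Un_disjoint) auto
      have "NC ?D - ?D = (NC D - D - {u}) \<union> (N v - NC D)" unfolding NC2 using u grow_NC(3)[OF g] vv by auto
      moreover have "card ((NC D - D - {u}) \<union> (N v - NC D)) = card (NC D - D - {u}) + ?k"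
        using fin by (subst card_Un_disjoint) auto
      moreover have "card (NC D - D - {u}) = card (NC D - D) - 1" using u(1) fin by simp
      ultimately have c2: "int (card (NC ?D - ?D)) = int (card (NC D - D)) - 1 + int ?k" using p by simp
      have "alive ?D \<subseteq> (alive D - ?R) \<union> (N v - NC D)"
      proof
        fix x assume x: "x \<in> alive ?D"
        show "x \<in> (alive D - ?R) \<union> (N v - NC D)"
        proof (cases "x \<in> N v - NC D")
          case nx: False
          then have xD: "x \<in> NC D - D" "x \<noteq> v" "x \<noteq> u" "\<not> N x \<subseteq> NC ?D" using x unfolding alive_def NC2 by auto
          then have "x \<in> alive D" unfolding alive_def NC2 by auto
          moreover have "x \<notin> ?R"
          proof
            assume "x \<in> ?R"
            then have "v \<in> N x" using N_sym by blast
            then have "N x - NC D = {v}" using only xD by blast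
            then show False using xD(4) unfolding NC2 by auto
          qed
          ultimately show ?thesis by blast
        qed blast
      qed
      then have "card (alive ?D) \<le> card ((alive D - ?R) \<union> (N v - NC D))" using fal by (intro card_mono) auto
      also have "\<dots> \<le> card (alive D - ?R) + ?k" by (rule card_Un_le)
      finally have c3: "card (alive ?D) \<le> card (alive D) - card ?R + ?k" using dl by simp
      have k2: "2 \<le> ?k" using True .
      have "pot D \<le> pot ?D" using c1 c2 c3 k2 R1 Rle unfolding pot_def by simp
      moreover have "NC ?D = V \<longrightarrow> pot D + 2 \<le> pot ?D"
      proof
        assume "NC ?D = V"
        then have "card (alive ?D) = 0" using full by simp
        then show "pot D + 2 \<le> pot ?D" using c1 c2 k2 R1 Rle unfolding pot_def by linarith
      qed
      moreover have "NC D \<subset> NC ?D" unfolding NC2 using u(2) by blast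
      ultimately show ?thesis using E2 smaller[OF E2] by blast
    next
      case False
      let ?D = "insert u D"
      have c1: "card (NC ?D) = Suc (card (NC D))" unfolding NC1 using fin u(2) by simp
      have "NC ?D - ?D = insert v (NC D - D - {u})" unfolding NC1 using vv by auto
      moreover have "card (insert v (NC D - D - {u})) = Suc (card (NC D - D) - 1)" using u fin by simp
      ultimately have c2: "card (NC ?D - ?D) = card (NC D - D)" using p by simp
      have "alive ?D \<subseteq> (alive D - ?R) \<union> {v}"
      proof
        fix x assume x: "x \<in> alive ?D"
        show "x \<in> (alive D - ?R) \<union> {v}"
        proof (cases "x = v")
          case nx: False
          then have xD: "x \<in> NC D - D" "x \<noteq> u" "\<not> N x \<subseteq> NC ?D" using x unfolding alive_def NC1 by auto
          then have "x \<in> alive D" unfolding alive_def NC1 by auto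
          moreover have "x \<notin> ?R"
          proof
            assume "x \<in> ?R"
            then have "v \<in> N x" using N_sym by blast
            then have "N x - NC D = {v}" using only xD by blast
            then show False using xD(3) unfolding NC1 by auto
          qed
          ultimately show ?thesis by blast
        qed blast
      qed
      then have "card (alive ?D) \<le> card ((alive D - ?R) \<union> {v})" using fal by (intro card_mono) auto
      also have "\<dots> \<le> card (alive D - ?R) + card {v}" by (rule card_Un_le)
      finally have c3: "card (alive ?D) \<le> card (alive D) - card ?R + 1" using dl by simp
      have r2: "2 \<le> card ?R" using rk False by linarith
      have "pot D \<le> pot ?D" using c1 c2 c3 r2 Rle unfolding pot_def by simp
      moreover have "NC ?D = V \<longrightarrow> pot D + 2 \<le> pot ?D"
      proof
        assume V: "NC ?D = V"
        have "N v \<subseteq> insert v (NC D)" using V NC1 N_sub[of v] by simp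
        then have "N v - NC D = {}" using N_self[of v] by blast
        then have "?k = 0" by (metis card.empty)
        then have "3 \<le> card ?R" using rk by linarith
        then show "pot D + 2 \<le> pot ?D" using full[OF V] c1 c2 Rle unfolding pot_def by simp
      qed
      moreover have "NC D \<subset> NC ?D" unfolding NC1 using u(2) by blast
      ultimately show ?thesis using E1 smaller[OF E1] by blast
    qed
  qed
qed

lemma bound3_final:
  assumes "grow D E" "NC D \<noteq> V" and deg: "\<And>x. x \<in> V \<Longrightarrow> 3 \<le> card (N x)"
  shows "\<exists>D' E'. grow D' E' \<and> NC D' = V \<and> pot D + 2 \<le> pot D'"
  using assms(1,2)
proof (induction "card (V - NC D)" arbitrary: D E rule: less_induct)
  case less
  obtain D1 E1 where 1: "grow D1 E1" "card (V - NC D1) < card (V - NC D)" "pot D \<le> pot D1"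
    "NC D1 = V \<longrightarrow> pot D + 2 \<le> pot D1" using bound3_step[OF less.prems deg] by blast
  show ?case
  proof (cases "NC D1 = V")
    case True
    then show ?thesis using 1 by blast
  next
    case False
    obtain D2 E2 where "grow D2 E2" "NC D2 = V" "pot D1 + 2 \<le> pot D2" using less.hyps[OF 1(2,1) False] by blast
    then show ?thesis using 1(3) by (intro exI[of _ D2] exI[of _ E2]) simp
  qed
qed

text \<open>Six colours around a dominating \<open>D\<close> give
  \<open>4 * rx3 G \<le> 3 * card V + 20 - pot D\<close>, so potential 8 is the aim. A start at
  \<open>x\<close> has at least twice the degree minus 1, and the last step adds 2: this is 9 for
  degree 4, but only 7 for a cubic graph, where the even order closes the gap.\<close>

lemma bound3:
  assumes deg: "\<And>x. x \<in> V \<Longrightarrow> 3 \<le> card (N x)"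
  shows "4 * rx3 G \<le> 3 * card V + 12"
proof -
  have start: "2 * int (card (N x)) - 1 \<le> pot {x}" for x
  proof -
    have B: "NC {x} - {x} = N x" using N_self by (auto simp: NC_def)
    then have "alive {x} \<subseteq> N x" by (auto simp: alive_def)
    then have "card (alive {x}) \<le> card (N x)" by (intro card_mono) auto
    then show ?thesis using B NC_single[of x] by (simp add: pot_def)
  qed
  have fin: "\<exists>D E. grow D E \<and> NC D = V \<and> min 8 (pot {x} + 2) \<le> pot D" if x: "x \<in> V" for x
  proof (cases "NC {x} = V")
    case True
    have B: "NC {x} - {x} = N x" using N_self by (auto simp: NC_def)
    have "alive {x} = {}" using True N_sub by (auto simp: alive_def)
    then have "pot {x} = 3 * int (card (N x)) - 1" using B NC_single[of x] by (simp add: pot_def)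
    then have "8 \<le> pot {x}" using deg[OF x] by simp
    then show ?thesis using grow.base[OF x] True by (intro exI[of _ "{x}"] exI[of _ "{}"]) simp
  next
    case False
    then show ?thesis using bound3_final[OF grow.base[OF x] False deg] by (meson min.coboundedI2)
  qed
  have use: "4 * rx3 G + p \<le> 3 * card V + 20" if D: "grow D E" "NC D = V" "int p \<le> pot D" "0 < p" for D E p
  proof -
    have "alive D = {}" using D(2) N_sub by (auto simp: alive_def)
    then have p4: "int p + int (card V) \<le> 4 * int (card (V - D))" using D(2,3) by (simp add: pot_def)
    have cV: "card (V - D) + card D = card V"
      using grow_facts(1,3)[OF D(1)] finV by (simp add: card_Diff_subset card_mono)
    have "D \<noteq> V" using p4 D(4) by auto
    then have "rx3 G \<le> card D - 1 + 6" by (rule rx3_dominated[OF D(1,2) _ deg])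
    moreover have "0 < card D" using grow_facts(1,6)[OF D(1)] by (simp add: card_gt_0_iff)
    ultimately show ?thesis using p4 cV by linarith
  qed
  obtain x0 where x0: "x0 \<in> V" using con by (auto simp: connected_graph_def)
  show ?thesis
  proof (cases "\<exists>x\<in>V. 4 \<le> card (N x)")
    case True
    then obtain x where x: "x \<in> V" "4 \<le> card (N x)" by blast
    obtain D E where D: "grow D E" "NC D = V" "min 8 (pot {x} + 2) \<le> pot D" using fin[OF x(1)] by blast
    have "int 8 \<le> pot D" using D(3) start[of x] x(2) by simp
    then show ?thesis using use[OF D(1,2), of 8] by simp
  next
    case False
    have d3: "card (N x) = 3" if "x \<in> V" for x
    proof -
      have "\<not> 4 \<le> card (N x)" using False that by blast
      then show ?thesis using deg[OF that] by linarith
    qed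
    have ev: "even (card V)" by (rule even_order[OF d3]) auto
    obtain D E where D: "grow D E" "NC D = V" "min 8 (pot {x0} + 2) \<le> pot D" using fin[OF x0] by blast
    have "int 7 \<le> pot D" using D(3) start[of x0] d3[OF x0] by simp
    then have "4 * rx3 G + 7 \<le> 3 * card V + 20" using use[OF D(1,2), of 7] by simp
    then show ?thesis using ev by presburger
  qed
qed

end

subsection \<open>The lower bound\<close>

text \<open>Every step of a walk changes the level by at most one, so a tree joining the first to the
  last level has an edge leaving each level upwards.\<close>

lemma (in fin_graph) rx3_ge_levels:
  fixes lev :: "'a \<Rightarrow> nat"
  assumes step: "\<And>x y. {x, y} \<in> edges G \<Longrightarrow> lev y \<le> Suc (lev x)"
    and ab: "a \<in> V" "b \<in> V" "lev a = 0" "lev b = L" "3 \<le> card V"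
  shows "L \<le> rx3 G"
proof -
  obtain c :: "'a set \<Rightarrow> nat" where c: "three_rainbow_coloring G c" "card (c ` edges G) = rx3 G"
    using rx3_attained by blast
  have "\<exists>S. {a, b} \<subseteq> S \<and> S \<subseteq> V \<and> card S = 3"
  proof -
    have "card {a, b} \<le> 2" by (simp add: card_insert_if)
    then show ?thesis using exists_subset_between[of "{a, b}" 3 V] ab finV by auto
  qed
  then obtain S where S: "{a, b} \<subseteq> S" "S \<subseteq> V" "card S = 3" by blast
  then obtain T where T: "is_tree T" "subgraph T G" "rainbow c T" "S \<subseteq> verts T"
    using c(1) unfolding three_rainbow_coloring_def by blast
  have ET: "edges T \<subseteq> edges G" using T(2) by (simp add: subgraph_def)
  have conT: "(a, b) \<in> {(x, y). {x, y} \<in> edges T}\<^sup>*"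
    using T(1,4) S(1) by (intro connected_graph_rtrancl) (auto simp: is_tree_def)
  have cross: "\<exists>x y. {x, y} \<in> edges T \<and> lev x = l \<and> lev y = Suc l" if l: "l < L" for l
  proof (rule ccontr)
    assume no: "\<not> ?thesis"
    have "lev y \<le> l" if "(a, y) \<in> {(x, y). {x, y} \<in> edges T}\<^sup>*" for y
      using that
    proof (induction rule: rtrancl_induct)
      case base
      then show ?case using ab(3) by simp
    next
      case (step y z)
      have e: "{y, z} \<in> edges T" using step by simp
      then have "lev z \<le> Suc (lev y)" using assms(1) ET by blast
      moreover have "\<not> (lev y = l \<and> lev z = Suc l)" using no e by blast
      ultimately show ?case using step.IH by linarith
    qed
    then have "lev b \<le> l" using conT by blast
    then show False using l ab(4) by simp
  qed
  have "{..<L} \<subseteq> (\<lambda>e. Min (lev ` e)) ` edges T"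
  proof
    fix l assume "l \<in> {..<L}"
    then obtain x y where xy: "{x, y} \<in> edges T" "lev x = l" "lev y = Suc l" using cross by blast
    then have "Min (lev ` {x, y}) = l" by simp
    then show "l \<in> (\<lambda>e. Min (lev ` e)) ` edges T" using xy(1) by (metis imageI)
  qed
  moreover have "finite (edges T)" using ET finE finite_subset by blast
  ultimately have "L \<le> card (edges T)" using surj_card_le[of "edges T" "{..<L}"] by simp
  also have "\<dots> = card (c ` edges T)" using T(3) by (simp add: rainbow_def card_image)
  also have "\<dots> \<le> card (c ` edges G)" using ET finE by (intro card_mono image_mono) auto
  finally show ?thesis using c(2) by simp
qed

text \<open>Vertices are numbered level by level. Truncated subtraction puts the extra vertex 0 on
  the level of vertex 1, and \<open>min\<close> keeps the other extra vertex, which would open block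
  \<open>m + 1\<close>, on the top level \<open>3 * m + 2\<close>.\<close>

definition ladder_level :: "nat \<Rightarrow> nat \<Rightarrow> nat \<Rightarrow> nat" where
  "ladder_level \<delta> m v = (let w = v - 1 in min (3 * m + 2)
     (3 * (w div (\<delta> + 1)) + (if w mod (\<delta> + 1) = 0 then 0 else if w mod (\<delta> + 1) = \<delta> then 2 else 1)))"

text \<open>Cliques of sizes 1, \<open>\<delta> - 1\<close>, 1, 1, \<open>\<delta> - 1\<close>, 1, \<dots>, consecutive ones completely joined; one extra
  vertex in the first and one in the last clique lift their degrees to \<open>\<delta>\<close>.\<close>

definition ladder :: "nat \<Rightarrow> nat \<Rightarrow> nat ugraph" where
  "ladder \<delta> m = \<lparr>verts = {..<(m + 1) * (\<delta> + 1) + 2},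
     edges = {{u, v} | u v. u \<noteq> v \<and> u < (m + 1) * (\<delta> + 1) + 2 \<and> v < (m + 1) * (\<delta> + 1) + 2 \<and>
       ladder_level \<delta> m u \<le> Suc (ladder_level \<delta> m v) \<and> ladder_level \<delta> m v \<le> Suc (ladder_level \<delta> m u)}\<rparr>"

lemma ladder_edge:
  "{u, v} \<in> edges (ladder \<delta> m) \<longleftrightarrow> u \<noteq> v \<and> u < (m + 1) * (\<delta> + 1) + 2 \<and> v < (m + 1) * (\<delta> + 1) + 2 \<and>
     ladder_level \<delta> m u \<le> Suc (ladder_level \<delta> m v) \<and> ladder_level \<delta> m v \<le> Suc (ladder_level \<delta> m u)"
  unfolding ladder_def by (auto simp: doubleton_eq_iff)

lemma ladder_level_block:
  assumes "3 \<le> \<delta>" "r \<le> \<delta>" "b \<le> m"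
  shows "ladder_level \<delta> m (1 + b * (\<delta> + 1) + r) = 3 * b + (if r = 0 then 0 else if r = \<delta> then 2 else 1)"
proof -
  have d: "(b * (\<delta> + 1) + r) div (\<delta> + 1) = b" "(b * (\<delta> + 1) + r) mod (\<delta> + 1) = r"
    using assms(2) by (simp_all only: div_mult_self3 mod_mult_self3 div_less mod_less)
  have w: "1 + b * (\<delta> + 1) + r - 1 = b * (\<delta> + 1) + r" by simp
  show ?thesis unfolding ladder_level_def Let_def w d using assms by simp
qed

lemma ladder_level_0: "3 \<le> \<delta> \<Longrightarrow> ladder_level \<delta> m 0 = 0"
  by (simp add: ladder_level_def)

lemma ladder_level_last: "3 \<le> \<delta> \<Longrightarrow> ladder_level \<delta> m (1 + (m + 1) * (\<delta> + 1)) = 3 * m + 2"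
proof -
  have "(m + 1) * (\<delta> + 1) div (\<delta> + 1) = m + 1" "(m + 1) * (\<delta> + 1) mod (\<delta> + 1) = 0"
    by (rule nonzero_mult_div_cancel_right, simp) (rule mod_mult_self2_is_0)
  then show ?thesis unfolding ladder_level_def Let_def add_diff_cancel_left' by simp
qed

lemma ladder_vertex_cases:
  fixes v m \<delta> :: nat
  assumes "v < (m + 1) * (\<delta> + 1) + 2"
  obtains "v = 0" | b r where "v = 1 + b * (\<delta> + 1) + r" "r \<le> \<delta>" "b \<le> m" | "v = 1 + (m + 1) * (\<delta> + 1)"
proof -
  consider "v = 0" | "0 < v" "v - 1 < (m + 1) * (\<delta> + 1)" | "v = 1 + (m + 1) * (\<delta> + 1)" using assms by linarith
  then show ?thesis
  proof cases
    case 2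
    have "(v - 1) div (\<delta> + 1) < m + 1" using 2(2) by (simp add: less_mult_imp_div_less)
    moreover have "(v - 1) mod (\<delta> + 1) < \<delta> + 1" by simp
    moreover have "v = 1 + (v - 1) div (\<delta> + 1) * (\<delta> + 1) + (v - 1) mod (\<delta> + 1)"
      using 2(1) div_mult_mod_eq[of "v - 1" "\<delta> + 1"] by linarith
    ultimately show ?thesis using that(2)[of "(v - 1) div (\<delta> + 1)" "(v - 1) mod (\<delta> + 1)"] by linarith
  qed (use that in auto)
qed

lemma ladder_level_Suc:
  assumes "3 \<le> \<delta>" "Suc v < (m + 1) * (\<delta> + 1) + 2"
  shows "ladder_level \<delta> m v \<le> ladder_level \<delta> m (Suc v)" "ladder_level \<delta> m (Suc v) \<le> Suc (ladder_level \<delta> m v)"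
proof -
  have "ladder_level \<delta> m v \<le> ladder_level \<delta> m (Suc v) \<and> ladder_level \<delta> m (Suc v) \<le> Suc (ladder_level \<delta> m v)"
  proof -
    have "v < (m + 1) * (\<delta> + 1) + 2" using assms(2) by simp
    then show ?thesis
    proof (cases rule: ladder_vertex_cases[consumes 1])
      case 1
      then show ?thesis using ladder_level_0 ladder_level_block[OF assms(1), of 0 0 m] assms(1) by simp
    next
      case (2 b r)
      show ?thesis
      proof (cases "r = \<delta>")
        case False
        then have r: "Suc r \<le> \<delta>" using 2 by simp
        have "Suc v = 1 + b * (\<delta> + 1) + Suc r" using 2 by simp
        then show ?thesis using ladder_level_block[OF assms(1) r 2(3)] ladder_level_block[OF assms(1) 2(2,3)] 2(1) assms(1) False
          by (auto split: if_splits)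
      next
        case True
        have lv: "ladder_level \<delta> m v = 3 * b + 2" using ladder_level_block[OF assms(1) 2(2,3)] True 2(1) assms(1) by simp
        show ?thesis
        proof (cases "b = m")
          case True
          then have "Suc v = 1 + (m + 1) * (\<delta> + 1)" using 2 \<open>r = \<delta>\<close> by simp
          then show ?thesis using lv True ladder_level_last[OF assms(1)] by simp
        next
          case False
          then have b: "Suc b \<le> m" using 2 by simp
          have "Suc v = 1 + Suc b * (\<delta> + 1) + 0" using 2 \<open>r = \<delta>\<close> by simp
          then show ?thesis using lv ladder_level_block[OF assms(1) _ b, of 0] by simp
        qed
      qed
    next
      case 3
      then show ?thesis using assms(2) by simp
    qed
  qed
  then show "ladder_level \<delta> m v \<le> ladder_level \<delta> m (Suc v)" "ladder_level \<delta> m (Suc v) \<le> Suc (ladder_level \<delta> m v)" by auto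
qed

lemma ladder_level_mono:
  assumes "3 \<le> \<delta>" "v \<le> w" "w < (m + 1) * (\<delta> + 1) + 2"
  shows "ladder_level \<delta> m v \<le> ladder_level \<delta> m w"
  using assms(2,3)
proof (induction w rule: dec_induct)
  case (step n)
  then show ?case using ladder_level_Suc(1)[OF assms(1), of n m] by simp
qed simp

lemma ladder_simple: "simple_graph (ladder \<delta> m)"
  unfolding simple_graph_def ladder_def by auto

lemma ladder_connected:
  assumes "3 \<le> \<delta>" shows "connected_graph (ladder \<delta> m)"
proof -
  let ?n = "(m + 1) * (\<delta> + 1) + 2" and ?R = "{(a, b). {a, b} \<in> edges (ladder \<delta> m)}"
  have up: "(0, v) \<in> ?R\<^sup>*" if "v < ?n" for v
    using that
  proof (induction v)
    case (Suc v)
    have "(v, Suc v) \<in> ?R"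
      using ladder_level_Suc[OF assms Suc.prems] Suc.prems by (simp add: ladder_edge)
    then show ?case using Suc by (simp add: rtrancl.rtrancl_into_rtrancl)
  qed simp
  have "sym ?R" by (auto simp: sym_def insert_commute)
  then have "sym (?R\<^sup>*)" by (rule sym_rtrancl)
  then have all: "(u, v) \<in> ?R\<^sup>*" if "u < ?n" "v < ?n" for u v
    using up that by (meson rtrancl_trans symD)
  show ?thesis
    unfolding connected_graph_def
  proof (intro conjI ballI)
    show "verts (ladder \<delta> m) \<noteq> {}" by (auto simp: ladder_def)
    fix u v assume "u \<in> verts (ladder \<delta> m)" "v \<in> verts (ladder \<delta> m)"
    then show "\<exists>p. walk (ladder \<delta> m) p \<and> hd p = u \<and> last p = v"
      using ladder_simple[of \<delta> m] by (intro rtrancl_walk all) (auto simp: ladder_def simple_graph_def)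
  qed
qed

text \<open>Levels increase with the numbering, so it is enough to find an interval of
  \<open>\<delta> + 1\<close> consecutive vertices around \<open>v\<close> whose two ends are within
  one level of \<open>v\<close>.\<close>

lemma ladder_degree:
  assumes d: "3 \<le> \<delta>" and v: "v < (m + 1) * (\<delta> + 1) + 2"
  shows "\<delta> \<le> degree (ladder \<delta> m) v"
proof -
  let ?n = "(m + 1) * (\<delta> + 1) + 2"
  interpret fin_graph "ladder \<delta> m" by unfold_locales (use ladder_simple ladder_connected d in auto)
  have key: ?thesis if s: "s \<le> v" "v \<le> s + \<delta>" "s + \<delta> < ?n"
    "ladder_level \<delta> m (s + \<delta>) \<le> Suc (ladder_level \<delta> m v)" "ladder_level \<delta> m v \<le> Suc (ladder_level \<delta> m s)" for s
  proof -
    have "{s..s + \<delta>} - {v} \<subseteq> N v"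
    proof
      fix w assume w: "w \<in> {s..s + \<delta>} - {v}"
      have "ladder_level \<delta> m w \<le> ladder_level \<delta> m (s + \<delta>)" using ladder_level_mono[OF d _ s(3)] w by simp
      moreover have "ladder_level \<delta> m s \<le> ladder_level \<delta> m w" using ladder_level_mono[OF d] w s(3) by simp
      ultimately show "w \<in> N v" unfolding N_def using w v s by (auto simp: ladder_edge)
    qed
    then have "card ({s..s + \<delta>} - {v}) \<le> card (N v)" by (intro card_mono) auto
    then show ?thesis using s(1,2) by (simp add: degree_N)
  qed
  show ?thesis using v
  proof (cases rule: ladder_vertex_cases[consumes 1])
    case 1
    have "ladder_level \<delta> m (0 + \<delta>) \<le> 1"
      using ladder_level_block[OF d, of "\<delta> - 1" 0 m] d by (simp split: if_splits)
    then show ?thesis using key[of 0] 1 d by (simp add: ladder_level_0)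
  next
    case (2 b r)
    have bm: "b * (\<delta> + 1) \<le> m * (\<delta> + 1)" using 2(3) by (rule mult_le_mono1)
    note lv = ladder_level_block[OF d 2(2,3)]
    consider "r = 0" | "0 < r" "r < \<delta>" | "r = \<delta>" using 2(2) by linarith
    then show ?thesis
    proof cases
      case c: 1
      have s: "v - 1 + \<delta> = 1 + b * (\<delta> + 1) + (\<delta> - 1)" using 2(1) c d by simp
      have "ladder_level \<delta> m (v - 1 + \<delta>) \<le> 3 * b + 1"
        using ladder_level_block[OF d _ 2(3), of "\<delta> - 1"] d unfolding s by (simp split: if_splits)
      moreover have "ladder_level \<delta> m v \<le> Suc (ladder_level \<delta> m (v - 1))"
        using ladder_level_Suc(2)[OF d, of "v - 1" m] v 2(1) by simp
      ultimately show ?thesis using key[of "v - 1"] lv c 2(1) bm d by simp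
    next
      case c: 2
      have "ladder_level \<delta> m (1 + b * (\<delta> + 1) + \<delta>) = 3 * b + 2" "ladder_level \<delta> m (1 + b * (\<delta> + 1) + 0) = 3 * b"
        using ladder_level_block[OF d _ 2(3), of \<delta>] ladder_level_block[OF d _ 2(3), of 0] d by simp_all
      then show ?thesis using key[of "1 + b * (\<delta> + 1)"] lv c 2(1) bm d by simp
    next
      case c: 3
      have s: "v + 1 - \<delta> = 1 + b * (\<delta> + 1) + 1" "v + 1 - \<delta> + \<delta> = Suc v" using 2(1) c d by simp_all
      have "Suc v < ?n" using 2(1) c bm by simp
      then have "ladder_level \<delta> m (Suc v) \<le> Suc (ladder_level \<delta> m v)" by (rule ladder_level_Suc(2)[OF d])
      moreover have "ladder_level \<delta> m (v + 1 - \<delta>) = 3 * b + 1"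
        using ladder_level_block[OF d _ 2(3), of 1] d unfolding s(1) by simp
      ultimately show ?thesis using key[of "v + 1 - \<delta>"] s(2) lv c 2(1) bm d by simp
    qed
  next
    case 3
    have s: "v - \<delta> = 1 + m * (\<delta> + 1) + 1" using 3 d by simp
    have "ladder_level \<delta> m (v - \<delta>) = 3 * m + 1"
      using ladder_level_block[OF d, of 1 m m] d unfolding s by simp
    moreover have "ladder_level \<delta> m v = 3 * m + 2" using ladder_level_last[OF d] 3 by simp
    moreover have "v - \<delta> + \<delta> = v" using 3 by simp
    ultimately show ?thesis using key[of "v - \<delta>"] v by simp
  qed
qed

lemma ladder_rx3:
  assumes "3 \<le> \<delta>" shows "3 * m + 2 \<le> rx3 (ladder \<delta> m)"
proof -
  interpret fin_graph "ladder \<delta> m" by unfold_locales (use ladder_simple ladder_connected assms in auto)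
  show ?thesis
  proof (rule rx3_ge_levels[where lev = "ladder_level \<delta> m" and a = 0 and b = "1 + (m + 1) * (\<delta> + 1)"])
    show "{x, y} \<in> edges (ladder \<delta> m) \<Longrightarrow> ladder_level \<delta> m y \<le> Suc (ladder_level \<delta> m x)" for x y
      by (simp add: ladder_edge)
    show "ladder_level \<delta> m (1 + (m + 1) * (\<delta> + 1)) = 3 * m + 2" by (rule ladder_level_last[OF assms])
  qed (use assms in \<open>auto simp: ladder_def ladder_level_0\<close>)
qed

text \<open>The main term is \<open>3 * (m + 1) + q\<close>, with \<open>q \<le> 2\<close> due to
  the two extra vertices, and \<open>ladder_rx3\<close> gives \<open>3 * m + 2\<close>; hence the
  constant 3. Isomorphism is excluded by the different orders.\<close>

lemma ladder_family:
  assumes "3 \<le> \<delta>"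
  shows "\<exists>\<G> :: nat ugraph set. infinite \<G> \<and> pairwise (\<lambda>G H. \<not> graph_isomorphic G H) \<G> \<and>
    (\<forall>G \<in> \<G>. simple_graph G \<and> connected_graph G \<and> min_degree G \<ge> \<delta> \<and>
       real (rx3 G) \<ge> 3 / (real \<delta> + 1) * real (card (verts G)) - 3)"
proof (intro exI conjI ballI)
  let ?F = "range (ladder \<delta>)"
  have card: "card (verts (ladder \<delta> m)) = (m + 1) * (\<delta> + 1) + 2" for m by (simp add: ladder_def)
  have inj: "m = m'" if "card (verts (ladder \<delta> m)) = card (verts (ladder \<delta> m'))" for m m'
  proof -
    have "(m + 1) * (\<delta> + 1) = (m' + 1) * (\<delta> + 1)" using that unfolding card by simp
    then have "m + 1 = m' + 1" by (metis mult_cancel2 add_is_0 one_neq_zero)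
    then show ?thesis by simp
  qed
  have "inj (ladder \<delta>)" by (rule injI, rule inj) simp
  then show "infinite ?F" using finite_imageD infinite_UNIV_nat by blast
  show "pairwise (\<lambda>G H. \<not> graph_isomorphic G H) ?F"
  proof (rule pairwiseI)
    fix G H assume "G \<in> ?F" "H \<in> ?F" "G \<noteq> H"
    then obtain m m' where GH: "G = ladder \<delta> m" "H = ladder \<delta> m'" "m \<noteq> m'" by blast
    show "\<not> graph_isomorphic G H"
    proof
      assume "graph_isomorphic G H"
      then obtain f where "bij_betw f (verts G) (verts H)" unfolding graph_isomorphic_def by blast
      then show False using inj[of m m'] bij_betw_same_card[of f] GH by blast
    qed
  qed
  fix G assume "G \<in> ?F"
  then obtain m where G: "G = ladder \<delta> m" by blast
  show "simple_graph G" "connected_graph G" using ladder_simple ladder_connected assms G by auto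
  show "min_degree G \<ge> \<delta>"
    unfolding min_degree_def G using ladder_degree[OF assms, of _ m]
    by (intro Min.boundedI) (auto simp: ladder_def)
  define q where "q = 6 / (real \<delta> + 1)"
  have e: "3 / (real \<delta> + 1) * real (card (verts G)) = 3 * (real m + 1) + q"
    unfolding G card q_def by (simp add: field_simps)
  have "q \<le> 2" using assms by (simp add: q_def divide_le_eq)
  moreover have "3 * real m + 2 \<le> real (rx3 G)"
    unfolding G using of_nat_mono[OF ladder_rx3[OF assms, of m], where 'a = real] by simp
  ultimately show "3 / (real \<delta> + 1) * real (card (verts G)) - 3 \<le> real (rx3 G)"
    unfolding e by simp
qed

theorem corollary6:
  shows "(\<forall>(G :: 'a ugraph) (n :: nat).
            simple_graph G \<and> connected_graph G \<and> card (verts G) = n \<longrightarrow>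
              (min_degree G \<ge> 3 \<longrightarrow> real (rx3 G) \<le> 3 / 4 * real n + 3) \<and>
              (min_degree G \<ge> 4 \<longrightarrow> real (rx3 G) \<le> 3 / 5 * real n + 17 / 5) \<and>
              (min_degree G \<ge> 5 \<longrightarrow> real (rx3 G) \<le> 1 / 2 * real n + 3)) \<and>
         (\<forall>\<delta> \<in> {3, 4, 5 :: nat}. \<exists>C :: real. \<exists>\<G> :: nat ugraph set.
            infinite \<G> \<and>
            pairwise (\<lambda>G H. \<not> graph_isomorphic G H) \<G> \<and>
            (\<forall>G \<in> \<G>. simple_graph G \<and> connected_graph G \<and> min_degree G \<ge> \<delta> \<and>
               real (rx3 G) \<ge> 3 / (real \<delta> + 1) * real (card (verts G)) - C))"
proof (intro conjI allI impI ballI)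
  fix G :: "'a ugraph" and n :: nat
  assume G: "simple_graph G \<and> connected_graph G \<and> card (verts G) = n"
  interpret fin_graph G by unfold_locales (use G in auto)
  have deg: "k \<le> card (N x)" if "k \<le> min_degree G" "x \<in> V" for k x
    using min_degree_le[OF that(2)] that(1) by linarith
  show "real (rx3 G) \<le> 3 / 4 * real n + 3" if "min_degree G \<ge> 3"
  proof -
    have "4 * rx3 G \<le> 3 * n + 12" using bound3[OF deg[OF that]] G by simp
    then show ?thesis by linarith
  qed
  show "real (rx3 G) \<le> 3 / 5 * real n + 17 / 5" if "min_degree G \<ge> 4"
  proof -
    have "5 * rx3 G \<le> 3 * n + 17" using bound4[OF deg[OF that]] G by simp
    then show ?thesis by linarith
  qed
  show "real (rx3 G) \<le> 1 / 2 * real n + 3" if "min_degree G \<ge> 5"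
  proof -
    have "2 * rx3 G \<le> n + 6" using bound5[OF deg[OF that]] G by simp
    then show ?thesis by linarith
  qed
next
  fix \<delta> :: nat assume "\<delta> \<in> {3, 4, 5}"
  then have "3 \<le> \<delta>" by auto
  then show "\<exists>C :: real. \<exists>\<G> :: nat ugraph set. infinite \<G> \<and> pairwise (\<lambda>G H. \<not> graph_isomorphic G H) \<G> \<and>
      (\<forall>G \<in> \<G>. simple_graph G \<and> connected_graph G \<and> min_degree G \<ge> \<delta> \<and>
         real (rx3 G) \<ge> 3 / (real \<delta> + 1) * real (card (verts G)) - C)"
    by (intro exI[of _ 3] ladder_family)
qed

end
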